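(* Let $T$ be a complete first-order theory in a language $\mathcal L$ with monster model $\mathcal U$. (i) Suppose $A\subseteq\mathcal U$ is a (small) set and $p\in S(A)$ is compressible but not l-isolated. Then: (a) There are tuples $a_i,b_i$ ($i<\omega$) in $A$ which witness the order property for some $\mathcal L$-formula, i.e. for some $\mathcal L$-formula $\theta(y,z)$, for all $i,j<\omega$, $\mathcal U\vDash\theta(a_i,b_j)$ iff $i<j$. (b) $p$ is not stable. In particular, if $T$ is stable then any compressible type is l-isolated. (ii) Suppose $T$ is countable and NIP. Then the following are equivalent: $T$ is stable; any compressible type is l-isolated; there is some $\omega$-saturated model $M\vDash T$ such that every strongly compressible type over $M$ is l-isolated.
   Context: $\mathcal U$ is a large saturated model of $T$; small means of cardinality $<|\mathcal U|$; parameter sets and models are small and contained in $\mathcal U$. $S(A)$ is the set of complete types over $A$; $\vdash$ is implication in $\mathcal U$. $T$ is NIP if for every formula $\phi(x,y)$ the family $\{\phi(\mathcal U^x,b):b\in\mathcal U^y\}$ has finite VC-dimension. $T$ is stable if no $\mathcal L$-formula has the order property. For a set $\Delta$ of partitioned $\mathcal L$-formulas $\phi(x,y)$, $p(x)\in S(A)$ and $A_0\subseteq A$, $(p\restriction\Delta)|_{A_0}$ is the set of formulas $\phi(x,a)$, $\neg\phi(x,a)$ in $p$ with $\phi\in\Delta$ and $a$ a tuple from $A_0$; $p\restriction\Delta=(p\restriction\Delta)|_A$ and $p\restriction\phi=p\restriction\{\phi\}$. $p(x)\in S(A)$ is compressible if for every $\mathcal L$-formula $\phi(x,y)$ there is an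 $\mathcal L$-formula $\psi(x,z)$ such that for every finite $A_0\subseteq A$ there is $c\in A^z$ with $\psi(x,c)\in p$ and $\psi(x,c)\vdash(p\restriction\phi)|_{A_0}$. $p(x)\in S(A)$ is strongly compressible if for every $\mathcal L$-formula $\phi(x,y)$ there is a finite set $\Delta\ni\phi$ of $\mathcal L$-formulas and an $\mathcal L$-formula $\zeta(x,z)$ such that for every finite $A_0\subseteq A$ there is $c\in A^z$ with $p\restriction\Delta\vdash\zeta(x,c)$ and $\zeta(x,c)\vdash(p\restriction\Delta)|_{A_0}$. $p(x)\in S(A)$ is l-isolated if for each $\mathcal L$-formula $\phi(x,y)$ there is a formula $\zeta(x)\in p$ with $\zeta\vdash p\restriction\phi$. A partial type $\pi(x)$ over $A$ is stable if every extension $q\in S(B)$ of $\pi$, over every $B\supseteq A$, is definable (for every $\mathcal L$-formula $\phi(x,y)$ the set $\{b\in B^y:\phi(x,b)\in q\}$ is definable over $B$). *)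

theory Defs
  imports Main "HOL-Library.Countable_Set" "HOL-Library.Equipollence"
begin

section \<open>First-order syntax and semantics\<close>

text \<open>
  The arity maps are partial: the symbols of the language are the elements of the domains of
  \<open>far\<close> and \<open>rar\<close>, so that relational languages, languages without relation symbols, and
  the pure language of equality are all covered.  Constants are function symbols of arity 0.
\<close>

record ('f, 'r) lang =
  far :: "'f \<Rightarrow> nat option"
  rar :: "'r \<Rightarrow> nat option"

datatype 'f tm = Var nat | Fn 'f "'f tm list"

datatype ('f, 'r) fm =
    Eq "'f tm" "'f tm"
  | Rel 'r "'f tm list"
  | Neg "('f, 'r) fm"
  | And "('f, 'r) fm" "('f, 'r) fm"
  | Ex nat "('f, 'r) fm"

fun wf_tm :: "('f, 'r) lang \<Rightarrow> 'f tm \<Rightarrow> bool" where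
  "wf_tm L (Var i) \<longleftrightarrow> True"
| "wf_tm L (Fn f ts) \<longleftrightarrow> far L f = Some (length ts) \<and> list_all (wf_tm L) ts"

primrec wf_fm :: "('f, 'r) lang \<Rightarrow> ('f, 'r) fm \<Rightarrow> bool" where
  "wf_fm L (Eq s t) \<longleftrightarrow> wf_tm L s \<and> wf_tm L t"
| "wf_fm L (Rel r ts) \<longleftrightarrow> rar L r = Some (length ts) \<and> list_all (wf_tm L) ts"
| "wf_fm L (Neg \<phi>) \<longleftrightarrow> wf_fm L \<phi>"
| "wf_fm L (And \<phi> \<psi>) \<longleftrightarrow> wf_fm L \<phi> \<and> wf_fm L \<psi>"
| "wf_fm L (Ex i \<phi>) \<longleftrightarrow> wf_fm L \<phi>"

fun fv_tm :: "'f tm \<Rightarrow> nat set" where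
  "fv_tm (Var i) = {i}"
| "fv_tm (Fn f ts) = (\<Union>t\<in>set ts. fv_tm t)"

primrec fv :: "('f, 'r) fm \<Rightarrow> nat set" where
  "fv (Eq s t) = fv_tm s \<union> fv_tm t"
| "fv (Rel r ts) = (\<Union>t\<in>set ts. fv_tm t)"
| "fv (Neg \<phi>) = fv \<phi>"
| "fv (And \<phi> \<psi>) = fv \<phi> \<union> fv \<psi>"
| "fv (Ex i \<phi>) = fv \<phi> - {i}"

definition fms :: "('f, 'r) lang \<Rightarrow> nat \<Rightarrow> ('f, 'r) fm set" where
  "fms L k = {\<phi>. wf_fm L \<phi> \<and> fv \<phi> \<subseteq> {..<k}}"

record ('f, 'r, 'u) struct =
  univ :: "'u set"
  fint :: "'f \<Rightarrow> 'u list \<Rightarrow> 'u"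
  rint :: "'r \<Rightarrow> 'u list \<Rightarrow> bool"

definition tuples :: "'u set \<Rightarrow> nat \<Rightarrow> 'u list set" where
  "tuples A m = {a. length a = m \<and> set a \<subseteq> A}"

definition is_structure :: "('f, 'r) lang \<Rightarrow> ('f, 'r, 'u) struct \<Rightarrow> bool" where
  "is_structure L M \<longleftrightarrow> univ M \<noteq> {} \<and>
     (\<forall>f k. far L f = Some k \<longrightarrow> (\<forall>a\<in>tuples (univ M) k. fint M f a \<in> univ M))"

primrec val :: "('f, 'r, 'u) struct \<Rightarrow> (nat \<Rightarrow> 'u) \<Rightarrow> 'f tm \<Rightarrow> 'u" where
  "val M e (Var i) = e i"
| "val M e (Fn f ts) = fint M f (map (val M e) ts)"

primrec sat :: "('f, 'r, 'u) struct \<Rightarrow> (nat \<Rightarrow> 'u) \<Rightarrow> ('f, 'r) fm \<Rightarrow> bool" where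
  "sat M e (Eq s t) \<longleftrightarrow> val M e s = val M e t"
| "sat M e (Rel r ts) \<longleftrightarrow> rint M r (map (val M e) ts)"
| "sat M e (Neg \<phi>) \<longleftrightarrow> \<not> sat M e \<phi>"
| "sat M e (And \<phi> \<psi>) \<longleftrightarrow> sat M e \<phi> \<and> sat M e \<psi>"
| "sat M e (Ex i \<phi>) \<longleftrightarrow> (\<exists>u\<in>univ M. sat M (e(i := u)) \<phi>)"

text \<open>
  \<open>holds M \<phi> a\<close> is only used for \<open>\<phi> \<in> fms L (length a)\<close>; by \<open>sat_cong\<close> the values of
  \<open>a ! i\<close> beyond the length of \<open>a\<close> are then irrelevant.
\<close>

definition holds :: "('f, 'r, 'u) struct \<Rightarrow> ('f, 'r) fm \<Rightarrow> 'u list \<Rightarrow> bool" where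
  "holds M \<phi> a \<longleftrightarrow> sat M (\<lambda>i. a ! i) \<phi>"

lemma val_cong: "(\<And>i. i \<in> fv_tm t \<Longrightarrow> e i = e' i) \<Longrightarrow> val M e t = val M e' t"
proof (induction t)
  case (Fn f ts)
  then have "map (val M e) ts = map (val M e') ts" by (intro map_cong) auto
  then show ?case by (simp only: val.simps)
qed simp

lemma sat_cong: "(\<And>i. i \<in> fv \<phi> \<Longrightarrow> e i = e' i) \<Longrightarrow> sat M e \<phi> \<longleftrightarrow> sat M e' \<phi>"
proof (induction \<phi> arbitrary: e e')
  case (Eq s t)
  then have "val M e s = val M e' s" "val M e t = val M e' t" by (auto intro: val_cong)
  then show ?case by simp
next
  case (Rel r ts)
  then have "map (val M e) ts = map (val M e') ts" by (intro map_cong) (auto intro: val_cong)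
  then show ?case by (simp only: sat.simps)
next
  case (Neg \<phi>)
  then show ?case by (metis fv.simps(3) sat.simps(3))
next
  case (And \<phi> \<psi>)
  then show ?case by (metis UnCI fv.simps(4) sat.simps(4))
next
  case (Ex i \<phi>)
  have "sat M (e(i := u)) \<phi> \<longleftrightarrow> sat M (e'(i := u)) \<phi>" for u
    by (rule Ex.IH) (use Ex.prems in auto)
  then show ?case by simp
qed

text \<open>
  A complete theory is identified with its deductive closure, i.e. it contains exactly one of
  \<open>\<phi>\<close>, \<open>Neg \<phi>\<close> for every sentence \<open>\<phi>\<close>.  (Consistency comes from the model \<open>U\<close> below.)  In
  particular it is a countable set iff the language has countably many symbols.
\<close>

definition complete_theory :: "('f, 'r) lang \<Rightarrow> ('f, 'r) fm set \<Rightarrow> bool" where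
  "complete_theory L T \<longleftrightarrow> T \<subseteq> fms L 0 \<and> (\<forall>\<phi>\<in>fms L 0. \<phi> \<in> T \<longleftrightarrow> Neg \<phi> \<notin> T)"

definition is_model :: "('f, 'r) lang \<Rightarrow> ('f, 'r) fm set \<Rightarrow> ('f, 'r, 'u) struct \<Rightarrow> bool" where
  "is_model L T M \<longleftrightarrow> is_structure L M \<and> (\<forall>\<phi>\<in>T. holds M \<phi> [])"


section \<open>Types and the monster model\<close>

text \<open>
  A formula \<open>\<phi>(x, a)\<close> over a parameter set, where \<open>x\<close> is an \<open>n\<close>-tuple of variables, is the pair
  of \<open>\<phi> \<in> fms L (n + length a)\<close> and the list \<open>a\<close>: the variables \<open>0, \<dots>, n - 1\<close> are \<open>x\<close>, and the
  following ones are to be replaced by \<open>a\<close>.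
\<close>

type_synonym ('f, 'r, 'u) pfm = "('f, 'r) fm \<times> 'u list"

definition pfms :: "('f, 'r) lang \<Rightarrow> nat \<Rightarrow> 'u set \<Rightarrow> ('f, 'r, 'u) pfm set" where
  "pfms L n A = {(\<phi>, a). \<phi> \<in> fms L (n + length a) \<and> set a \<subseteq> A}"

definition realises ::
    "('f, 'r, 'u) struct \<Rightarrow> 'u list \<Rightarrow> ('f, 'r, 'u) pfm set \<Rightarrow> bool" where
  "realises M b \<Theta> \<longleftrightarrow> (\<forall>(\<phi>, a)\<in>\<Theta>. holds M \<phi> (b @ a))"

definition entails ::
    "('f, 'r, 'u) struct \<Rightarrow> nat \<Rightarrow> ('f, 'r, 'u) pfm set \<Rightarrow> ('f, 'r, 'u) pfm set \<Rightarrow> bool" where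
  "entails M n \<Theta> \<Psi> \<longleftrightarrow> (\<forall>b\<in>tuples (univ M) n. realises M b \<Theta> \<longrightarrow> realises M b \<Psi>)"

text \<open>
  \<open>types L M n A\<close> is the space of complete \<open>n\<close>-types over \<open>A\<close> in \<open>M\<close>; consistency with the
  elementary diagram of \<open>M\<close> is finite satisfiability in \<open>M\<close>.
\<close>

definition types ::
    "('f, 'r) lang \<Rightarrow> ('f, 'r, 'u) struct \<Rightarrow> nat \<Rightarrow> 'u set \<Rightarrow> ('f, 'r, 'u) pfm set set" where
  "types L M n A = {p. p \<subseteq> pfms L n A \<and>
     (\<forall>\<Theta>. finite \<Theta> \<and> \<Theta> \<subseteq> p \<longrightarrow> (\<exists>b\<in>tuples (univ M) n. realises M b \<Theta>)) \<and>
     (\<forall>(\<phi>, a)\<in>pfms L n A. (\<phi>, a) \<in> p \<or> (Neg \<phi>, a) \<in> p)}"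

text \<open>\<open>\<kappa>\<close>-saturation, where the cardinal \<open>\<kappa>\<close> is given as the cardinality of the set \<open>K\<close>.\<close>

definition saturated_card ::
    "('f, 'r) lang \<Rightarrow> 'k set \<Rightarrow> ('f, 'r, 'u) struct \<Rightarrow> bool" where
  "saturated_card L K M \<longleftrightarrow> (\<forall>A \<subseteq> univ M. A \<prec> K \<longrightarrow>
     (\<forall>n. \<forall>p\<in>types L M n A. \<exists>b\<in>tuples (univ M) n. realises M b p))"

definition saturated :: "('f, 'r) lang \<Rightarrow> ('f, 'r, 'u) struct \<Rightarrow> bool" where
  "saturated L M \<longleftrightarrow> saturated_card L (univ M) M"

definition omega_saturated :: "('f, 'r) lang \<Rightarrow> ('f, 'r, 'u) struct \<Rightarrow> bool" where
  "omega_saturated L M \<longleftrightarrow> saturated_card L (UNIV :: nat set) M"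

text \<open>
  ``Large'' is read as \<open>|U| > 2 ^ |L|\<close>, with \<open>|L|\<close> the (infinite) number of formulas.  This is what
  guarantees that there are small \<open>\<omega>\<close>-saturated models: a theory in a countable language
  may have continuum many types over the empty set, and all of its \<open>\<omega>\<close>-saturated models then
  have at least the cardinality of the continuum.
\<close>

definition monster ::
    "('f, 'r) lang \<Rightarrow> ('f, 'r) fm set \<Rightarrow> ('f, 'r, 'u) struct \<Rightarrow> bool" where
  "monster L T U \<longleftrightarrow> is_model L T U \<and> saturated L U \<and> Pow {\<phi>. wf_fm L \<phi>} \<prec> univ U"

definition small :: "('f, 'r, 'u) struct \<Rightarrow> 'u set \<Rightarrow> bool" where
  "small U A \<longleftrightarrow> A \<subseteq> univ U \<and> A \<prec> univ U"

definition substruct :: "('f, 'r, 'u) struct \<Rightarrow> 'u set \<Rightarrow> ('f, 'r, 'u) struct" where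
  "substruct U M = U\<lparr>univ := M\<rparr>"

text \<open>Small models contained in \<open>U\<close> are, as usual, elementary substructures of \<open>U\<close>.\<close>

definition small_model ::
    "('f, 'r) lang \<Rightarrow> ('f, 'r) fm set \<Rightarrow> ('f, 'r, 'u) struct \<Rightarrow> 'u set \<Rightarrow> bool" where
  "small_model L T U M \<longleftrightarrow> small U M \<and> is_model L T (substruct U M) \<and>
     (\<forall>k. \<forall>\<phi>\<in>fms L k. \<forall>a\<in>tuples M k. holds (substruct U M) \<phi> a \<longleftrightarrow> holds U \<phi> a)"


section \<open>Stability and NIP of theories\<close>

text \<open>
  The theory is that of the monster model \<open>U\<close>.  In a partitioned formula \<open>\<phi>(y, z)\<close> with \<open>y\<close> an
  \<open>m\<close>-tuple and \<open>z\<close> a \<open>k\<close>-tuple, \<open>y\<close> consists of the first \<open>m\<close> variables, \<open>z\<close> of the next \<open>k\<close>.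
\<close>

definition order_in ::
    "('f, 'r) lang \<Rightarrow> ('f, 'r, 'u) struct \<Rightarrow> 'u set \<Rightarrow> nat \<Rightarrow> nat \<Rightarrow> ('f, 'r) fm \<Rightarrow> bool" where
  "order_in L U A m k \<theta> \<longleftrightarrow> (\<exists>(a :: nat \<Rightarrow> 'u list) (b :: nat \<Rightarrow> 'u list).
     (\<forall>i. a i \<in> tuples A m \<and> b i \<in> tuples A k) \<and>
     (\<forall>i j. holds U \<theta> (a i @ b j) \<longleftrightarrow> i < j))"

definition stable_theory :: "('f, 'r) lang \<Rightarrow> ('f, 'r, 'u) struct \<Rightarrow> bool" where
  "stable_theory L U \<longleftrightarrow> (\<forall>m k. \<forall>\<theta>\<in>fms L (m + k). \<not> order_in L U (univ U) m k \<theta>)"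

definition shatters :: "'a set set \<Rightarrow> 'a set \<Rightarrow> bool" where
  "shatters F X \<longleftrightarrow> (\<forall>Y \<subseteq> X. \<exists>S\<in>F. S \<inter> X = Y)"

definition finite_VC_dim :: "'a set set \<Rightarrow> bool" where
  "finite_VC_dim F \<longleftrightarrow> (\<exists>d. \<forall>X. finite X \<and> shatters F X \<longrightarrow> card X \<le> d)"

definition NIP :: "('f, 'r) lang \<Rightarrow> ('f, 'r, 'u) struct \<Rightarrow> bool" where
  "NIP L U \<longleftrightarrow> (\<forall>n m. \<forall>\<phi>\<in>fms L (n + m).
     finite_VC_dim ((\<lambda>b. {a \<in> tuples (univ U) n. holds U \<phi> (a @ b)}) ` tuples (univ U) m))"


section \<open>Compressible, l-isolated and stable types\<close>

text \<open>
  A set \<open>\<Delta>\<close> of partitioned formulas \<open>\<phi>(x, y)\<close>, for a fixed \<open>n\<close>-tuple \<open>x\<close>, is a set of pairs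
  \<open>(m, \<phi>)\<close> with \<open>m\<close> the length of \<open>y\<close> and \<open>\<phi> \<in> fms L (n + m)\<close>.
  \<open>restr p \<Delta> A\<^sub>0\<close> is the restriction of \<open>p\<close> to instances of \<open>\<Delta>\<close> with parameters in \<open>A\<^sub>0\<close>.
\<close>

definition part_fms :: "('f, 'r) lang \<Rightarrow> nat \<Rightarrow> (nat \<times> ('f, 'r) fm) set" where
  "part_fms L n = {(m, \<phi>). \<phi> \<in> fms L (n + m)}"

definition restr ::
    "('f, 'r, 'u) pfm set \<Rightarrow> (nat \<times> ('f, 'r) fm) set \<Rightarrow> 'u set \<Rightarrow> ('f, 'r, 'u) pfm set" where
  "restr p \<Delta> A\<^sub>0 =
     {(\<phi>, a) | \<phi> a. (\<phi>, a) \<in> p \<and> (length a, \<phi>) \<in> \<Delta> \<and> set a \<subseteq> A\<^sub>0} \<union>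
     {(Neg \<phi>, a) | \<phi> a. (Neg \<phi>, a) \<in> p \<and> (length a, \<phi>) \<in> \<Delta> \<and> set a \<subseteq> A\<^sub>0}"

definition compressible ::
    "('f, 'r) lang \<Rightarrow> ('f, 'r, 'u) struct \<Rightarrow> nat \<Rightarrow> 'u set \<Rightarrow> ('f, 'r, 'u) pfm set \<Rightarrow> bool" where
  "compressible L U n A p \<longleftrightarrow> (\<forall>(m, \<phi>)\<in>part_fms L n. \<exists>(k, \<psi>)\<in>part_fms L n.
     \<forall>A\<^sub>0 \<subseteq> A. finite A\<^sub>0 \<longrightarrow>
       (\<exists>c\<in>tuples A k. (\<psi>, c) \<in> p \<and> entails U n {(\<psi>, c)} (restr p {(m, \<phi>)} A\<^sub>0)))"

definition strongly_compressible ::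
    "('f, 'r) lang \<Rightarrow> ('f, 'r, 'u) struct \<Rightarrow> nat \<Rightarrow> 'u set \<Rightarrow> ('f, 'r, 'u) pfm set \<Rightarrow> bool" where
  "strongly_compressible L U n A p \<longleftrightarrow> (\<forall>(m, \<phi>)\<in>part_fms L n.
     \<exists>\<Delta> \<subseteq> part_fms L n. finite \<Delta> \<and> (m, \<phi>) \<in> \<Delta> \<and> (\<exists>(k, \<zeta>)\<in>part_fms L n.
       \<forall>A\<^sub>0 \<subseteq> A. finite A\<^sub>0 \<longrightarrow>
         (\<exists>c\<in>tuples A k. entails U n (restr p \<Delta> A) {(\<zeta>, c)} \<and>
                          entails U n {(\<zeta>, c)} (restr p \<Delta> A\<^sub>0))))"

definition l_isolated ::
    "('f, 'r) lang \<Rightarrow> ('f, 'r, 'u) struct \<Rightarrow> nat \<Rightarrow> 'u set \<Rightarrow> ('f, 'r, 'u) pfm set \<Rightarrow> bool" where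
  "l_isolated L U n A p \<longleftrightarrow> (\<forall>(m, \<phi>)\<in>part_fms L n. \<exists>\<zeta>\<in>p. entails U n {\<zeta>} (restr p {(m, \<phi>)} A))"

definition definable_type ::
    "('f, 'r) lang \<Rightarrow> ('f, 'r, 'u) struct \<Rightarrow> nat \<Rightarrow> 'u set \<Rightarrow> ('f, 'r, 'u) pfm set \<Rightarrow> bool" where
  "definable_type L U n B q \<longleftrightarrow> (\<forall>(m, \<phi>)\<in>part_fms L n. \<exists>(\<theta>, c)\<in>pfms L m B.
     {b \<in> tuples B m. (\<phi>, b) \<in> q} = {b \<in> tuples B m. holds U \<theta> (b @ c)})"

definition stable_type ::
    "('f, 'r) lang \<Rightarrow> ('f, 'r, 'u) struct \<Rightarrow> nat \<Rightarrow> 'u set \<Rightarrow> ('f, 'r, 'u) pfm set \<Rightarrow> bool" where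
  "stable_type L U n A \<pi> \<longleftrightarrow>
     (\<forall>B q. A \<subseteq> B \<and> small U B \<and> q \<in> types L U n B \<and> \<pi> \<subseteq> q \<longrightarrow> definable_type L U n B q)"

definition all_compressible_l_isolated :: "('f, 'r) lang \<Rightarrow> ('f, 'r, 'u) struct \<Rightarrow> bool" where
  "all_compressible_l_isolated L U \<longleftrightarrow>
     (\<forall>A n. small U A \<longrightarrow> (\<forall>p\<in>types L U n A. compressible L U n A p \<longrightarrow> l_isolated L U n A p))"

end

theory Submission
  imports Defs "HOL-Library.Ramsey"
begin

text \<open>
  (i) Let \<open>\<psi>\<close> compress \<open>\<phi>\<close> in \<open>p\<close> while no formula of \<open>p\<close> implies \<open>p\<restriction>\<phi>\<close>.  Choose alternately
  \<open>c\<^sub>i\<close> with \<open>\<psi>(x,c\<^sub>i) \<in> p\<close> deciding \<open>\<phi>(x,a\<^sub>j)\<close> for \<open>j < i\<close>, and \<open>a\<^sub>i\<close>, \<open>e\<^sub>i\<close> such that \<open>e\<^sub>i\<close> satisfies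
  \<open>\<psi>(x,c\<^sub>0), \<dots>, \<psi>(x,c\<^sub>i)\<close> but disagrees with \<open>p\<close> on \<open>\<phi>(x,a\<^sub>i)\<close>.  Then ``\<open>\<psi>(x,c\<^sub>j)\<close> decides \<open>\<phi>(x,a\<^sub>i)\<close>''
  holds iff \<open>i < j\<close>, and \<open>\<psi>(e\<^sub>i,c\<^sub>j)\<close> holds iff \<open>j \<le> i\<close>.  As \<open>e\<^sub>i\<close> can be taken in any given formula of
  \<open>p\<close>, saturation gives pairs \<open>c\<^sub>N, c'\<^sub>N\<close> of the same type over \<open>A\<close> and the previous pairs such that
  all \<open>\<psi>(x,c\<^sub>N)\<close> and \<open>\<not>\<psi>(x,c'\<^sub>N)\<close> are consistent with \<open>p\<close>; an extension of \<open>p\<close> containing them is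
  not definable.

  (ii) If \<open>T\<close> is NIP and unstable, some uniformly definable family of sets has infinite chains, and
  a maximal chain in \<open>M\<close> has a cut that \<open>M\<close> does not realise.  No type over \<open>M\<close> containing the
  formulas of this cut is l-isolated, because a consistent formula over \<open>M\<close> has a solution in \<open>M\<close>.
  It remains to complete the cut, one formula after the other, to a strongly compressible type.
  This rests on the existence of teaching sets of bounded size for set systems of finite VC
  dimension, in a version for infinite systems: a filter of sets that is minimal among those
  generated by conditions on at most \<open>k\<close> points has fewer traces on sets of a fixed size.
\<close>

text \<open>In (i) an infinite ladder cannot be carried along by saturation, since it is not a
  first-order condition. What is carried along is that every finite part of the type contains finite
  ladders of all lengths: each single instance of this is a formula, and a long enough ladder
  contains two parameters that agree on any given finite set of formulas. In (ii), for a finite set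
  system one would pass to a smallest nonempty part cut out by few points. In an infinite system
  such parts can shrink forever, so filters take their place and the concept found is only a limit
  of members of the system. That is enough, because a type only asks for finite satisfiability. The
  bound on the number of points is essential: it leaves finitely many sign patterns on teaching
  sets, hence one formula \<zeta> for all finite parts. Deciding one formula per stage suits strong
  compressibility since \<Delta> may be the set of all formulas decided up to some stage, and the
  restriction of the final type to it is exactly that stage. Countability of the language lets every
  formula appear at a finite stage.\<close>

lemma tuples_append: "a \<in> tuples A m \<Longrightarrow> b \<in> tuples A n \<Longrightarrow> a @ b \<in> tuples A (m + n)"
  by (simp add: tuples_def)

lemma tuples_mono: "A \<subseteq> B \<Longrightarrow> tuples A m \<subseteq> tuples B m"
  by (auto simp: tuples_def)

lemma finite_tuples: "finite A \<Longrightarrow> finite (tuples A m)"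
  using finite_lists_length_eq[of A m] by (simp add: tuples_def conj_commute)

text \<open>Sequences of tuples are flattened into one long tuple and read back by offset and
  length, so quantifying over a sequence becomes quantifying over one tuple.\<close>

definition slice :: "'a list \<Rightarrow> nat \<Rightarrow> nat \<Rightarrow> 'a list" where
  "slice b i n = take n (drop i b)"

lemma slice_append:
  "i + n \<le> length a \<Longrightarrow> slice (a @ b) i n = slice a i n"
  "length a \<le> i \<Longrightarrow> slice (a @ b) i n = slice b (i - length a) n"
  by (simp_all add: slice_def)

lemma slice_all: "length b = n \<Longrightarrow> slice b 0 n = b"
  by (simp add: slice_def)

lemma slice_in_tuples: "b \<in> tuples A k \<Longrightarrow> i + n \<le> k \<Longrightarrow> slice b i n \<in> tuples A n"
  by (auto simp: tuples_def slice_def dest: in_set_takeD in_set_dropD)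

lemma slice_eq_map: "i + n \<le> length b \<Longrightarrow> slice b i n = map ((!) b) [i..<i + n]"
  by (simp add: slice_def list_eq_iff_nth_eq)

lemma slice_concat:
  assumes "\<forall>x\<in>set xs. length x = n" "i < length xs"
  shows "slice (concat xs) (i * n) n = xs ! i"
  using assms
proof (induction xs arbitrary: i)
  case (Cons x xs)
  then show ?case by (cases i) (auto simp: slice_def)
qed simp

lemma length_concat_uniform: "\<forall>x\<in>set xs. length x = n \<Longrightarrow> length (concat xs) = length xs * n"
  by (induction xs) auto

lemma concat_in_tuples: "\<forall>x\<in>set xs. x \<in> tuples A n \<Longrightarrow> concat xs \<in> tuples A (length xs * n)"
  using length_concat_uniform[of xs n] by (auto simp: tuples_def)

lemma block_le: "(i::nat) < l \<Longrightarrow> i * n + n \<le> l * n"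
  using mult_le_mono1[of "Suc i" l n] by simp

section \<open>Substitution and definable relations\<close>

lemma finite_fv_tm: "finite (fv_tm t)"
  by (induction t) auto

lemma finite_fv: "finite (fv \<phi>)"
  by (induction \<phi>) (auto simp: finite_fv_tm)

fun subst_tm :: "(nat \<Rightarrow> nat) \<Rightarrow> 'f tm \<Rightarrow> 'f tm" where
  "subst_tm f (Var i) = Var (f i)"
| "subst_tm f (Fn g ts) = Fn g (map (subst_tm f) ts)"

text \<open>Only variables are substituted for variables, along an arbitrary map. The map may
  identify variables, so each bound variable is renamed to one outside the image of the remaining
  free variables, which rules out capture.\<close>

primrec subst_fm :: "('f, 'r) fm \<Rightarrow> (nat \<Rightarrow> nat) \<Rightarrow> ('f, 'r) fm" where
  "subst_fm (Eq s t) f = Eq (subst_tm f s) (subst_tm f t)"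
| "subst_fm (Rel r ts) f = Rel r (map (subst_tm f) ts)"
| "subst_fm (Neg \<phi>) f = Neg (subst_fm \<phi> f)"
| "subst_fm (And \<phi> \<psi>) f = And (subst_fm \<phi> f) (subst_fm \<psi> f)"
| "subst_fm (Ex i \<phi>) f =
    (let k = (SOME k. k \<notin> f ` (fv \<phi> - {i})) in Ex k (subst_fm \<phi> (f(i := k))))"

lemma some_fresh:
  assumes "finite (X :: nat set)" shows "(SOME k. k \<notin> X) \<notin> X"
  by (rule someI_ex) (use assms ex_new_if_finite infinite_UNIV_nat in blast)

lemma wf_subst_tm: "wf_tm L t \<Longrightarrow> wf_tm L (subst_tm f t)"
  by (induction t) (auto simp: list_all_iff)

lemma fv_subst_tm: "fv_tm (subst_tm f t) = f ` fv_tm t"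
  by (induction t) auto

lemma val_subst_tm: "val M e (subst_tm f t) = val M (e \<circ> f) t"
proof (induction t)
  case (Fn g ts)
  then have "map (val M e \<circ> subst_tm f) ts = map (val M (e \<circ> f)) ts" by (intro map_cong) (simp_all only: comp_apply[of "val M e"])
  then show ?case by (simp only: subst_tm.simps val.simps map_map)
qed simp

lemma wf_subst_fm: "wf_fm L \<phi> \<Longrightarrow> wf_fm L (subst_fm \<phi> f)"
  by (induction \<phi> arbitrary: f) (auto simp: list_all_iff wf_subst_tm Let_def)

lemma fv_subst_fm: "fv (subst_fm \<phi> f) \<subseteq> f ` fv \<phi>"
proof (induction \<phi> arbitrary: f)
  case (Ex i \<phi>)
  define k where "k = (SOME k. k \<notin> f ` (fv \<phi> - {i}))"
  have "fv (subst_fm \<phi> (f(i := k))) \<subseteq> (f(i := k)) ` fv \<phi>" by (rule Ex.IH)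
  then show ?case by (auto simp: k_def[symmetric] Let_def split: if_splits)
qed (auto simp: fv_subst_tm Let_def; blast)+

lemma sat_subst_fm: "sat M e (subst_fm \<phi> f) \<longleftrightarrow> sat M (e \<circ> f) \<phi>"
proof (induction \<phi> arbitrary: e f)
  case (Rel r ts)
  have "map (val M e \<circ> subst_tm f) ts = map (val M (e \<circ> f)) ts"
    by (intro map_cong) (simp_all only: comp_apply[of "val M e"] val_subst_tm)
  then show ?case by (simp only: subst_fm.simps sat.simps map_map)
next
  case (Ex i \<phi>)
  define k where "k = (SOME k. k \<notin> f ` (fv \<phi> - {i}))"
  have k: "k \<notin> f ` (fv \<phi> - {i})"
    unfolding k_def by (rule some_fresh) (simp add: finite_fv)
  have "sat M (e(k := u)) (subst_fm \<phi> (f(i := k))) \<longleftrightarrow> sat M ((e \<circ> f)(i := u)) \<phi>" for u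
    unfolding Ex.IH by (rule sat_cong) (use k in auto)
  then show ?case by (simp only: subst_fm.simps Let_def k_def[symmetric] sat.simps)
qed (simp_all add: val_subst_tm)

text \<open>Definability without parameters, stated for predicates on tuples. With the closure
  properties below it is read off the shape of a predicate, and no formula has to be written
  down.\<close>

definition fdef :: "('f, 'r) lang \<Rightarrow> ('f, 'r, 'u) struct \<Rightarrow> nat \<Rightarrow> ('u list \<Rightarrow> bool) \<Rightarrow> bool" where
  "fdef L U k P \<longleftrightarrow> (\<exists>\<phi>\<in>fms L k. \<forall>b\<in>tuples (univ U) k. holds U \<phi> b \<longleftrightarrow> P b)"

lemma fdefE:
  assumes "fdef L U k P"
  obtains \<phi> where "\<phi> \<in> fms L k" "\<And>b. b \<in> tuples (univ U) k \<Longrightarrow> holds U \<phi> b \<longleftrightarrow> P b"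
  using assms by (auto simp: fdef_def)

lemma fdef_cong: "(\<And>b. b \<in> tuples (univ U) k \<Longrightarrow> P b \<longleftrightarrow> Q b) \<Longrightarrow> fdef L U k P \<Longrightarrow> fdef L U k Q"
  by (auto simp: fdef_def)

lemma fdef_holds: "\<phi> \<in> fms L k \<Longrightarrow> fdef L U k (holds U \<phi>)"
  by (auto simp: fdef_def)

text \<open>Substitution along \<open>js\<close>, which may permute, repeat or omit coordinates;
  this covers all changes of variables at once, dummy variables included.\<close>

lemma fdef_map:
  assumes "fdef L U (length js) P" "set js \<subseteq> {..<k}"
  shows "fdef L U k (\<lambda>b. P (map ((!) b) js))"
proof -
  obtain \<phi> where \<phi>: "\<phi> \<in> fms L (length js)"
    "\<And>b. b \<in> tuples (univ U) (length js) \<Longrightarrow> holds U \<phi> b \<longleftrightarrow> P b"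
    using assms(1) unfolding fdef_def by blast
  let ?\<psi> = "subst_fm \<phi> ((!) js)"
  have "?\<psi> \<in> fms L k"
    using \<phi>(1) fv_subst_fm[of \<phi> "(!) js"] assms(2) nth_mem[of _ js]
    by (force simp: fms_def wf_subst_fm)
  moreover have "holds U ?\<psi> b \<longleftrightarrow> P (map ((!) b) js)" if b: "b \<in> tuples (univ U) k" for b
  proof -
    have "holds U ?\<psi> b \<longleftrightarrow> sat U (\<lambda>i. b ! (js ! i)) \<phi>"
      by (simp add: holds_def sat_subst_fm comp_def)
    also have "\<dots> \<longleftrightarrow> holds U \<phi> (map ((!) b) js)"
      unfolding holds_def using \<phi>(1) by (intro sat_cong) (auto simp: fms_def)
    also have "\<dots> \<longleftrightarrow> P (map ((!) b) js)"
      using b assms(2) by (intro \<phi>(2)) (force simp: tuples_def)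
    finally show ?thesis .
  qed
  ultimately show ?thesis by (auto simp: fdef_def)
qed

lemma fdef_slices:
  assumes "\<phi> \<in> fms L (n + m)" "i + n \<le> k" "j + m \<le> k"
  shows "fdef L U k (\<lambda>b. holds U \<phi> (slice b i n @ slice b j m))"
proof (rule fdef_cong)
  show "fdef L U k (\<lambda>b. holds U \<phi> (map ((!) b) ([i..<i + n] @ [j..<j + m])))"
    using assms by (intro fdef_map fdef_holds) auto
  show "holds U \<phi> (map ((!) b) ([i..<i + n] @ [j..<j + m])) \<longleftrightarrow>
      holds U \<phi> (slice b i n @ slice b j m)" if "b \<in> tuples (univ U) k" for b
    using that assms by (simp add: slice_eq_map tuples_def)
qed

lemma fdef_not: "fdef L U k P \<Longrightarrow> fdef L U k (\<lambda>b. \<not> P b)"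
proof (erule fdefE)
  fix \<phi> assume "\<phi> \<in> fms L k" "\<And>b. b \<in> tuples (univ U) k \<Longrightarrow> holds U \<phi> b \<longleftrightarrow> P b"
  then show ?thesis unfolding fdef_def by (intro bexI[of _ "Neg \<phi>"]) (auto simp: fms_def holds_def)
qed

lemma fdef_conj: "fdef L U k P \<Longrightarrow> fdef L U k Q \<Longrightarrow> fdef L U k (\<lambda>b. P b \<and> Q b)"
proof (elim fdefE)
  fix \<phi> \<psi> assume "\<phi> \<in> fms L k" "\<And>b. b \<in> tuples (univ U) k \<Longrightarrow> holds U \<phi> b \<longleftrightarrow> P b"
    "\<psi> \<in> fms L k" "\<And>b. b \<in> tuples (univ U) k \<Longrightarrow> holds U \<psi> b \<longleftrightarrow> Q b"
  then show ?thesis unfolding fdef_def by (intro bexI[of _ "And \<phi> \<psi>"]) (auto simp: fms_def holds_def)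
qed

lemma fdef_disj: "fdef L U k P \<Longrightarrow> fdef L U k Q \<Longrightarrow> fdef L U k (\<lambda>b. P b \<or> Q b)"
  using fdef_not[OF fdef_conj[OF fdef_not fdef_not], of L U k P Q] by simp

lemma fdef_imp: "fdef L U k P \<Longrightarrow> fdef L U k Q \<Longrightarrow> fdef L U k (\<lambda>b. P b \<longrightarrow> Q b)"
  unfolding imp_conv_disj by (rule fdef_disj[OF fdef_not])

lemma fdef_iff: "fdef L U k P \<Longrightarrow> fdef L U k Q \<Longrightarrow> fdef L U k (\<lambda>b. P b \<longleftrightarrow> Q b)"
  unfolding iff_conv_conj_imp by (rule fdef_conj[OF fdef_imp fdef_imp])

text \<open>The case \<open>k = 0\<close> admits no free variable, hence a quantified equation; the
  nonempty universe makes it true.\<close>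

lemma fdef_True: "univ U \<noteq> {} \<Longrightarrow> fdef L U k (\<lambda>b. True)"
  unfolding fdef_def by (intro bexI[of _ "Ex 0 (Eq (Var 0) (Var 0))"]) (auto simp: fms_def holds_def)

lemma fdef_const: "univ U \<noteq> {} \<Longrightarrow> fdef L U k (\<lambda>b. c)"
  using fdef_True[of U L k] fdef_not[of L U k "\<lambda>b. True"] by (cases c) auto

lemma fdef_ball:
  assumes "univ U \<noteq> {}" "finite I" "\<And>i. i \<in> I \<Longrightarrow> fdef L U k (P i)"
  shows "fdef L U k (\<lambda>b. \<forall>i\<in>I. P i b)"
  using assms(2,3)
proof (induction I)
  case (insert i I)
  then show ?case using fdef_conj[of L U k "P i" "\<lambda>b. \<forall>i\<in>I. P i b"] by simp
qed (use fdef_True[OF assms(1)] in simp)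

lemma fdef_all_less:
  fixes l :: nat
  assumes "univ U \<noteq> {}" "\<And>i. i < l \<Longrightarrow> fdef L U k (P i)"
  shows "fdef L U k (\<lambda>b. \<forall>i<l. P i b)"
  using fdef_ball[OF assms(1) finite_lessThan[of l], of L k P] assms(2) by (simp add: Ball_def)

lemma fdef_ex1:
  assumes "fdef L U (Suc k) P"
  shows "fdef L U k (\<lambda>b. \<exists>u\<in>univ U. P (b @ [u]))"
proof -
  obtain \<phi> where \<phi>: "\<phi> \<in> fms L (Suc k)"
    "\<And>b. b \<in> tuples (univ U) (Suc k) \<Longrightarrow> holds U \<phi> b \<longleftrightarrow> P b"
    using assms unfolding fdef_def by blast
  have "Ex k \<phi> \<in> fms L k" using \<phi>(1) by (auto simp: fms_def less_Suc_eq)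
  moreover have "holds U (Ex k \<phi>) b \<longleftrightarrow> (\<exists>u\<in>univ U. P (b @ [u]))" if b: "b \<in> tuples (univ U) k" for b
  proof -
    have "sat U ((\<lambda>i. b ! i)(k := u)) \<phi> \<longleftrightarrow> P (b @ [u])" if "u \<in> univ U" for u
    proof -
      have "sat U ((\<lambda>i. b ! i)(k := u)) \<phi> \<longleftrightarrow> holds U \<phi> (b @ [u])"
        unfolding holds_def using \<phi>(1) b
        by (intro sat_cong) (auto simp: fms_def nth_append tuples_def less_Suc_eq)
      also have "\<dots> \<longleftrightarrow> P (b @ [u])" using b that by (intro \<phi>(2)) (simp add: tuples_def)
      finally show ?thesis .
    qed
    then show ?thesis by (simp add: holds_def)
  qed
  ultimately show ?thesis by (auto simp: fdef_def)
qed

lemma fdef_ex: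
  assumes "fdef L U (k + n) P"
  shows "fdef L U k (\<lambda>b. \<exists>c\<in>tuples (univ U) n. P (b @ c))"
  using assms
proof (induction n arbitrary: P)
  case 0
  then show ?case by (simp add: tuples_def)
next
  case (Suc n)
  have "fdef L U (k + n) (\<lambda>b. \<exists>u\<in>univ U. P (b @ [u]))" using Suc.prems by (intro fdef_ex1) simp
  then have "fdef L U k (\<lambda>b. \<exists>c\<in>tuples (univ U) n. \<exists>u\<in>univ U. P ((b @ c) @ [u]))" by (rule Suc.IH)
  moreover have "(\<exists>c\<in>tuples (univ U) n. \<exists>u\<in>univ U. P ((b @ c) @ [u])) \<longleftrightarrow>
      (\<exists>c\<in>tuples (univ U) (Suc n). P (b @ c))" for b
  proof
    assume "\<exists>c\<in>tuples (univ U) n. \<exists>u\<in>univ U. P ((b @ c) @ [u])"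
    then obtain c u where "c \<in> tuples (univ U) n" "u \<in> univ U" "P (b @ c @ [u])" by auto
    then show "\<exists>c\<in>tuples (univ U) (Suc n). P (b @ c)" by (intro bexI[of _ "c @ [u]"]) (auto simp: tuples_def)
  next
    assume "\<exists>c\<in>tuples (univ U) (Suc n). P (b @ c)"
    then obtain c where c: "c \<in> tuples (univ U) (Suc n)" "P (b @ c)" by auto
    then obtain c' u where "c = c' @ [u]" by (cases c rule: rev_cases) (auto simp: tuples_def)
    then show "\<exists>c\<in>tuples (univ U) n. \<exists>u\<in>univ U. P ((b @ c) @ [u])"
      using c by (intro bexI[of _ c'] bexI[of _ u]) (auto simp: tuples_def)
  qed
  ultimately show ?case by simp
qed

lemma fdef_all:
  assumes "fdef L U (k + n) P"
  shows "fdef L U k (\<lambda>b. \<forall>c\<in>tuples (univ U) n. P (b @ c))"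
  using fdef_not[OF fdef_ex[OF fdef_not[OF assms]]] by simp

lemma fms_conj:
  assumes "\<phi> \<in> fms L (n + k)" "\<psi> \<in> fms L (n + l)"
  shows "\<exists>\<chi>\<in>fms L (n + (k + l)). \<forall>b\<in>tuples (univ U) n. \<forall>a\<in>tuples (univ U) k. \<forall>c\<in>tuples (univ U) l.
       holds U \<chi> (b @ a @ c) \<longleftrightarrow> holds U \<phi> (b @ a) \<and> holds U \<psi> (b @ c)"
proof -
  have "fdef L U (n + (k + l)) (\<lambda>v. holds U \<phi> (slice v 0 n @ slice v n k) \<and>
      holds U \<psi> (slice v 0 n @ slice v (n + k) l))"
    using assms by (intro fdef_conj fdef_slices) auto
  from this[unfolded fdef_def] obtain \<chi> where \<chi>: "\<chi> \<in> fms L (n + (k + l))" "\<And>v. v \<in> tuples (univ U) (n + (k + l)) \<Longrightarrow>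
      holds U \<chi> v \<longleftrightarrow> holds U \<phi> (slice v 0 n @ slice v n k) \<and>
      holds U \<psi> (slice v 0 n @ slice v (n + k) l)" by blast
  show ?thesis
  proof (rule bexI[OF _ \<chi>(1)], intro ballI)
    fix b a c assume "b \<in> tuples (univ U) n" "a \<in> tuples (univ U) k" "c \<in> tuples (univ U) l"
    then show "holds U \<chi> (b @ a @ c) \<longleftrightarrow> holds U \<phi> (b @ a) \<and> holds U \<psi> (b @ c)"
      by (subst \<chi>(2)) (auto simp: tuples_def slice_append slice_all)
  qed
qed

section \<open>Types, saturation and compactness\<close>

definition finsat :: "('f, 'r, 'u) struct \<Rightarrow> nat \<Rightarrow> ('f, 'r, 'u) pfm set \<Rightarrow> bool" where
  "finsat M n \<Theta> \<longleftrightarrow> (\<forall>\<Theta>'. finite \<Theta>' \<and> \<Theta>' \<subseteq> \<Theta> \<longrightarrow> (\<exists>b\<in>tuples (univ M) n. realises M b \<Theta>'))"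

definition tp :: "('f, 'r) lang \<Rightarrow> ('f, 'r, 'u) struct \<Rightarrow> 'u set \<Rightarrow> 'u list \<Rightarrow> ('f, 'r, 'u) pfm set" where
  "tp L U A b = {(\<phi>, a) \<in> pfms L (length b) A. holds U \<phi> (b @ a)}"

lemma realises_mono: "realises M b \<Theta> \<Longrightarrow> \<Theta>' \<subseteq> \<Theta> \<Longrightarrow> realises M b \<Theta>'"
  by (auto simp: realises_def)

lemma realises_Un: "realises M b (\<Theta> \<union> \<Theta>') \<longleftrightarrow> realises M b \<Theta> \<and> realises M b \<Theta>'"
  by (auto simp: realises_def)

lemma realises_insert: "realises M b (insert (\<phi>, a) \<Theta>) \<longleftrightarrow> holds M \<phi> (b @ a) \<and> realises M b \<Theta>"
  by (auto simp: realises_def)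

lemma realises_empty: "realises M b {}"
  by (simp add: realises_def)

text \<open>Concatenating parameters turns a finite part of a type into one formula over the same
  set, the form needed for negating it and for applying elementarity or the failure of
  l-isolation.\<close>

lemma pfms_conj:
  assumes "univ U \<noteq> {}" "A \<subseteq> univ U" "finite \<Theta>" "\<Theta> \<subseteq> pfms L n A"
  shows "\<exists>\<chi> c. (\<chi>, c) \<in> pfms L n A \<and>
      (\<forall>b\<in>tuples (univ U) n. holds U \<chi> (b @ c) \<longleftrightarrow> realises U b \<Theta>)"
  using assms(3,4)
proof (induction \<Theta>)
    case empty
    obtain \<chi> where "\<chi> \<in> fms L n" "\<And>b. b \<in> tuples (univ U) n \<Longrightarrow> holds U \<chi> b"
      using fdef_True[OF assms(1), of L n] by (auto elim: fdefE)
    then show ?case by (intro exI[of _ \<chi>] exI[of _ "[]"]) (simp add: pfms_def realises_empty)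
  next
    case (insert \<theta> \<Theta>)
    obtain \<phi> a where \<theta>: "\<theta> = (\<phi>, a)" by (cases \<theta>)
    obtain \<chi> c where \<chi>: "(\<chi>, c) \<in> pfms L n A"
      "\<forall>b\<in>tuples (univ U) n. holds U \<chi> (b @ c) \<longleftrightarrow> realises U b \<Theta>"
      using insert by auto
    have mem: "\<phi> \<in> fms L (n + length a)" "\<chi> \<in> fms L (n + length c)" "set a \<subseteq> A" "set c \<subseteq> A"
      using insert.prems \<chi>(1) by (auto simp: pfms_def \<theta>)
    obtain \<eta> where \<eta>: "\<eta> \<in> fms L (n + (length a + length c))"
      "\<And>b a' c'. b \<in> tuples (univ U) n \<Longrightarrow> a' \<in> tuples (univ U) (length a) \<Longrightarrow>
        c' \<in> tuples (univ U) (length c) \<Longrightarrow>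
        holds U \<eta> (b @ a' @ c') \<longleftrightarrow> holds U \<phi> (b @ a') \<and> holds U \<chi> (b @ c')"
      using fms_conj[OF mem(1,2), of U] by blast
    show ?case
    proof (intro exI conjI ballI)
      show "(\<eta>, a @ c) \<in> pfms L n A" using \<eta>(1) mem by (simp add: pfms_def)
      fix b assume "b \<in> tuples (univ U) n"
      then show "holds U \<eta> (b @ a @ c) \<longleftrightarrow> realises U b (insert \<theta> \<Theta>)"
        using \<eta>(2)[of b a c] \<chi>(2) mem assms(2) by (simp add: \<theta> realises_insert tuples_def)
    qed
qed

lemma pfms_mono: "A \<subseteq> B \<Longrightarrow> pfms L n A \<subseteq> pfms L n B"
  by (auto simp: pfms_def)

lemma Neg_pfms: "(\<phi>, a) \<in> pfms L n A \<Longrightarrow> (Neg \<phi>, a) \<in> pfms L n A"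
  by (simp add: pfms_def fms_def)

lemma holds_Neg: "holds U (Neg \<phi>) a \<longleftrightarrow> \<not> holds U \<phi> a"
  by (simp add: holds_def)

text \<open>A maximal finitely satisfiable set is complete. If neither \<phi> nor
  \<open>Neg \<phi>\<close> could be added, each would be refuted by a finite part; a realisation of
  both parts together satisfies one of the two formulas after all.\<close>

lemma finsat_extends_to_type:
  assumes "\<Theta> \<subseteq> pfms L n A" "finsat M n \<Theta>"
  obtains p where "p \<in> types L M n A" "\<Theta> \<subseteq> p"
proof -
  let ?S = "{S. \<Theta> \<subseteq> S \<and> S \<subseteq> pfms L n A \<and> finsat M n S}"
  have "\<exists>p\<in>?S. \<forall>X\<in>?S. p \<subseteq> X \<longrightarrow> X = p"
  proof (rule subset_Zorn_nonempty)
    show "?S \<noteq> {}" using assms by auto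
    fix \<C> assume C: "\<C> \<noteq> {}" "subset.chain ?S \<C>"
    have "\<C> \<subseteq> ?S" using C(2) by (simp add: subset.chain_def)
    moreover have "finsat M n (\<Union>\<C>)"
      unfolding finsat_def
    proof (intro allI impI, elim conjE)
      fix \<Theta>' assume "finite \<Theta>'" "\<Theta>' \<subseteq> \<Union>\<C>"
      then obtain S where "S \<in> \<C>" "\<Theta>' \<subseteq> S"
        using finite_subset_Union_chain[OF _ _ C(1) C(2)] by blast
      then show "\<exists>b\<in>tuples (univ M) n. realises M b \<Theta>'"
        using \<open>\<C> \<subseteq> ?S\<close> \<open>finite \<Theta>'\<close> by (auto simp: finsat_def)
    qed
    ultimately show "\<Union>\<C> \<in> ?S" using C(1) by auto
  qed
  then obtain p where pS: "p \<in> ?S" and max: "\<forall>X\<in>?S. p \<subseteq> X \<longrightarrow> X = p" by (rule bexE)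
  then have p: "\<Theta> \<subseteq> p" "p \<subseteq> pfms L n A" "finsat M n p" by simp_all
  have "(\<phi>, a) \<in> p \<or> (Neg \<phi>, a) \<in> p" if mem: "(\<phi>, a) \<in> pfms L n A" for \<phi> a
  proof (rule ccontr)
    assume neg: "\<not> ?thesis"
    have "\<exists>\<Theta>'. finite \<Theta>' \<and> \<Theta>' \<subseteq> p \<and> \<not> (\<exists>b\<in>tuples (univ M) n. realises M b (insert (\<chi>, a) \<Theta>'))"
      if "(\<chi>, a) \<in> pfms L n A" "(\<chi>, a) \<notin> p" for \<chi>
    proof -
      have "\<not> finsat M n (insert (\<chi>, a) p)"
      proof
        assume "finsat M n (insert (\<chi>, a) p)"
        then have "insert (\<chi>, a) p \<in> ?S" using p(1,2) that(1) by auto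
        with max have "insert (\<chi>, a) p = p" by blast
        then show False using that(2) by blast
      qed
      then obtain \<Theta>' where "finite \<Theta>'" "\<Theta>' \<subseteq> insert (\<chi>, a) p"
        "\<not> (\<exists>b\<in>tuples (univ M) n. realises M b \<Theta>')" by (auto simp: finsat_def)
      then show ?thesis
        by (intro exI[of _ "\<Theta>' - {(\<chi>, a)}"]) (auto intro: realises_mono)
    qed
    note * = this
    from neg have "(\<phi>, a) \<notin> p" "(Neg \<phi>, a) \<notin> p" by simp_all
    obtain \<Theta>1 where 1: "finite \<Theta>1" "\<Theta>1 \<subseteq> p"
      "\<not> (\<exists>b\<in>tuples (univ M) n. realises M b (insert (\<phi>, a) \<Theta>1))"
      using *[OF mem \<open>(\<phi>, a) \<notin> p\<close>] by blast
    obtain \<Theta>2 where 2: "finite \<Theta>2" "\<Theta>2 \<subseteq> p"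
      "\<not> (\<exists>b\<in>tuples (univ M) n. realises M b (insert (Neg \<phi>, a) \<Theta>2))"
      using *[OF Neg_pfms[OF mem] \<open>(Neg \<phi>, a) \<notin> p\<close>] by blast
    have "finite (\<Theta>1 \<union> \<Theta>2) \<and> \<Theta>1 \<union> \<Theta>2 \<subseteq> p" using 1 2 by simp
    then obtain b where b: "b \<in> tuples (univ M) n" "realises M b (\<Theta>1 \<union> \<Theta>2)"
      using p(3) unfolding finsat_def by blast
    show False
    proof (cases "holds M \<phi> (b @ a)")
      case True
      then have "realises M b (insert (\<phi>, a) \<Theta>1)" using b(2) by (simp add: realises_insert realises_Un)
      then show ?thesis using 1(3) b(1) by blast
    next
      case False
      then have "realises M b (insert (Neg \<phi>, a) \<Theta>2)"
        using b(2) by (simp add: realises_insert realises_Un holds_Neg)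
      then show ?thesis using 2(3) b(1) by blast
    qed
  qed
  then have "p \<in> types L M n A" using p by (auto simp: types_def finsat_def)
  then show thesis using that p(1) by blast
qed

lemma types_finsat: "p \<in> types L M n A \<Longrightarrow> finsat M n p"
  by (simp add: types_def finsat_def)

lemma saturated_realises:
  assumes "saturated_card L K M" "A \<subseteq> univ M" "A \<prec> K" "\<Theta> \<subseteq> pfms L n A" "finsat M n \<Theta>"
  obtains b where "b \<in> tuples (univ M) n" "realises M b \<Theta>"
proof -
  obtain p where p: "p \<in> types L M n A" "\<Theta> \<subseteq> p" by (rule finsat_extends_to_type[OF assms(4,5)])
  obtain b where b: "b \<in> tuples (univ M) n" "realises M b p"
    using assms(1-3) p(1) unfolding saturated_card_def by blast
  show thesis by (rule that[OF b(1) realises_mono[OF b(2) p(2)]])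
qed

lemma realised_type_eq_tp:
  assumes "p \<in> types L U n A" "b \<in> tuples (univ U) n" "realises U b p"
  shows "p = tp L U A b"
proof
  have [simp]: "length b = n" using assms(2) by (simp add: tuples_def)
  show "p \<subseteq> tp L U A b" using assms by (auto simp: types_def tp_def realises_def)
  show "tp L U A b \<subseteq> p"
  proof
    fix \<theta> assume "\<theta> \<in> tp L U A b"
    then obtain \<phi> a where \<theta>: "\<theta> = (\<phi>, a)" "(\<phi>, a) \<in> pfms L n A" "holds U \<phi> (b @ a)"
      by (auto simp: tp_def)
    moreover have "(Neg \<phi>, a) \<notin> p" using assms(3) \<theta>(3) by (auto simp: realises_def holds_Neg)
    ultimately show "\<theta> \<in> p" using assms(1) by (auto simp: types_def)
  qed
qed

text \<open>Compactness for consequence in \<open>U\<close>. The finite conclusion is one formula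
  \<chi>; if no finite part implied it, \<open>Neg \<chi>\<close> would be finitely satisfiable
  together with the premises, and saturation would realise them.\<close>

lemma entails_finite:
  assumes "saturated L U" "small U A" "univ U \<noteq> {}" "\<Theta> \<subseteq> pfms L n A" "finite \<Psi>" "\<Psi> \<subseteq> pfms L n A"
    and ent: "entails U n \<Theta> \<Psi>"
  obtains \<Theta>' where "finite \<Theta>'" "\<Theta>' \<subseteq> \<Theta>" "entails U n \<Theta>' \<Psi>"
proof (rule ccontr)
  assume neg: "\<not> thesis"
  have A: "A \<subseteq> univ U" "A \<prec> univ U" using assms(2) by (auto simp: small_def)
  obtain \<chi> c where \<chi>: "(\<chi>, c) \<in> pfms L n A"
    "\<And>b. b \<in> tuples (univ U) n \<Longrightarrow> holds U \<chi> (b @ c) \<longleftrightarrow> realises U b \<Psi>"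
    using pfms_conj[OF assms(3) A(1) assms(5,6)] by blast
  have "finsat U n (insert (Neg \<chi>, c) \<Theta>)"
    unfolding finsat_def
  proof (intro allI impI, elim conjE)
    fix \<Theta>' assume fin: "finite \<Theta>'" and sub: "\<Theta>' \<subseteq> insert (Neg \<chi>, c) \<Theta>"
    have "\<not> entails U n (\<Theta>' - {(Neg \<chi>, c)}) \<Psi>"
      using that[of "\<Theta>' - {(Neg \<chi>, c)}"] neg fin sub by blast
    then obtain b where b: "b \<in> tuples (univ U) n" "realises U b (\<Theta>' - {(Neg \<chi>, c)})" "\<not> realises U b \<Psi>"
      by (auto simp: entails_def)
    then have *: "realises U b (insert (Neg \<chi>, c) (\<Theta>' - {(Neg \<chi>, c)}))"
      using \<chi>(2)[OF b(1)] by (simp only: realises_insert holds_Neg) simp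
    have "realises U b \<Theta>'" by (rule realises_mono[OF *]) blast
    then show "\<exists>b\<in>tuples (univ U) n. realises U b \<Theta>'" using b(1) by blast
  qed
  then obtain b where "b \<in> tuples (univ U) n" "realises U b (insert (Neg \<chi>, c) \<Theta>)"
    using saturated_realises[OF assms(1)[unfolded saturated_def] A, of "insert (Neg \<chi>, c) \<Theta>" n]
      assms(4) Neg_pfms[OF \<chi>(1)] by (metis insert_subset)
  then show False using ent \<chi>(2) by (auto simp: entails_def realises_insert holds_Neg)
qed

lemma small_type_realised:
  assumes "saturated L U" "small U A" "p \<in> types L U n A"
  obtains b where "b \<in> tuples (univ U) n" "p = tp L U A b"
proof -
  have "A \<subseteq> univ U" "A \<prec> univ U" "p \<subseteq> pfms L n A"
    using assms(2,3) by (auto simp: small_def types_def)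
  from saturated_realises[OF assms(1)[unfolded saturated_def] this types_finsat[OF assms(3)]]
  obtain b where b: "b \<in> tuples (univ U) n" "realises U b p" by metis
  then show thesis using that realised_type_eq_tp[OF assms(3)] by blast
qed

text \<open>\<open>restr\<close> contains instances of \<phi> and of its negation, so realising it
  means having the same truth values as \<open>b\<close>.\<close>

lemma realises_restr_tp:
  assumes "\<Delta> \<subseteq> part_fms L n" "A\<^sub>0 \<subseteq> A" "length b = n"
  shows "realises U e (restr (tp L U A b) \<Delta> A\<^sub>0) \<longleftrightarrow>
    (\<forall>(m, \<phi>)\<in>\<Delta>. \<forall>a\<in>tuples A\<^sub>0 m. holds U \<phi> (e @ a) \<longleftrightarrow> holds U \<phi> (b @ a))"
    (is "?l \<longleftrightarrow> ?r")
proof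
  assume l: ?l
  show ?r
  proof (clarify)
    fix m \<phi> a assume *: "(m, \<phi>) \<in> \<Delta>" "a \<in> tuples A\<^sub>0 m"
    then have mem: "(\<phi>, a) \<in> pfms L n A" "set a \<subseteq> A\<^sub>0" "length a = m"
      using assms by (auto simp: part_fms_def pfms_def tuples_def)
    show "holds U \<phi> (e @ a) \<longleftrightarrow> holds U \<phi> (b @ a)"
    proof (cases "holds U \<phi> (b @ a)")
      case True
      then have "(\<phi>, a) \<in> restr (tp L U A b) \<Delta> A\<^sub>0" using mem * assms(3) by (auto simp: restr_def tp_def)
      then show ?thesis using l True by (auto simp: realises_def)
    next
      case False
      then have "(Neg \<phi>, a) \<in> restr (tp L U A b) \<Delta> A\<^sub>0"
        using mem * assms(3) Neg_pfms[OF mem(1)] by (auto simp: restr_def tp_def holds_Neg)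
      then show ?thesis using l False by (auto simp: realises_def holds_Neg)
    qed
  qed
next
  assume r: ?r
  have "holds U \<chi> (e @ a)" if "(\<chi>, a) \<in> restr (tp L U A b) \<Delta> A\<^sub>0" for \<chi> a
  proof -
    from that have "\<exists>\<phi>. (\<chi> = \<phi> \<or> \<chi> = Neg \<phi>) \<and> (length a, \<phi>) \<in> \<Delta> \<and> set a \<subseteq> A\<^sub>0 \<and> holds U \<chi> (b @ a)"
      by (auto simp: restr_def tp_def)
    then obtain \<phi> where \<phi>: "\<chi> = \<phi> \<or> \<chi> = Neg \<phi>" "(length a, \<phi>) \<in> \<Delta>" "set a \<subseteq> A\<^sub>0"
      "holds U \<chi> (b @ a)" by blast
    then have "holds U \<phi> (e @ a) \<longleftrightarrow> holds U \<phi> (b @ a)" using r by (auto simp: tuples_def)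
    then show ?thesis using \<phi>(1,4) by (auto simp: holds_Neg)
  qed
  then show ?l by (auto simp: realises_def)
qed

section \<open>Ladders and non-definable extensions\<close>

lemma ball_pair: "(\<forall>(m, \<phi>)\<in>S. P m \<phi>) \<longleftrightarrow> (\<forall>m \<phi>. (m, \<phi>) \<in> S \<longrightarrow> P m \<phi>)"
  by auto

lemma bex_pair: "(\<exists>(m, \<phi>)\<in>S. P m \<phi>) \<longleftrightarrow> (\<exists>m \<phi>. (m, \<phi>) \<in> S \<and> P m \<phi>)"
  by auto

lemma types_consistent:
  assumes "p \<in> types L U n A" "(\<phi>, a) \<in> p" shows "(Neg \<phi>, a) \<notin> p"
proof
  assume "(Neg \<phi>, a) \<in> p"
  then have "finite {(\<phi>, a), (Neg \<phi>, a)} \<and> {(\<phi>, a), (Neg \<phi>, a)} \<subseteq> p" using assms(2) by simp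
  then obtain b where "realises U b {(\<phi>, a), (Neg \<phi>, a)}"
    using types_finsat[OF assms(1)] unfolding finsat_def by blast
  then show False unfolding realises_insert holds_Neg by blast
qed

text \<open>Dependent choice in which every step sees the whole list of earlier choices. Both
  constructions that use it relate a new element to all its predecessors, not only to the last
  one.\<close>

lemma history_choice:
  assumes "I []" "\<And>xs. I xs \<Longrightarrow> \<exists>x. I (xs @ [x]) \<and> R xs x"
  shows "\<exists>f. \<forall>n. I (map f [0..<n]) \<and> R (map f [0..<n]) (f n)"
proof -
  have "\<exists>g. \<forall>n. I (g n) \<and> (\<exists>x. g (Suc n) = g n @ [x] \<and> R (g n) x) \<and> (n = 0 \<longrightarrow> g n = [])"
    using dependent_nat_choice[of "\<lambda>n xs. I xs \<and> (n = 0 \<longrightarrow> xs = [])"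
      "\<lambda>n xs ys. \<exists>x. ys = xs @ [x] \<and> R xs x"] assms
    by (metis nat.distinct(1))
  then obtain g where g: "\<And>n. I (g n)" "\<And>n. \<exists>x. g (Suc n) = g n @ [x] \<and> R (g n) x" "g 0 = []"
    by blast
  define f where "f n = last (g (Suc n))" for n
  have step: "g (Suc n) = g n @ [f n]" "R (g n) (f n)" for n
    using g(2)[of n] by (auto simp: f_def)
  have "g n = map f [0..<n]" for n by (induction n) (simp_all add: g(3) step)
  then show ?thesis using g(1) step(2) by metis
qed

text \<open>A finite half graph between tuples \<open>e i\<close> and parameters \<open>c j\<close>,
  with the \<open>e i\<close> confined to \<open>S\<close>. The length is finite because only then
  is the existence of a ladder first order.\<close>

definition ladder :: "('f, 'r, 'u) struct \<Rightarrow> nat \<Rightarrow> nat \<Rightarrow> ('f, 'r) fm \<Rightarrow> nat \<Rightarrow> ('u list \<Rightarrow> bool) \<Rightarrow> bool" where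
  "ladder U n k \<psi> l S \<longleftrightarrow> (\<exists>e c.
     (\<forall>i<l. e i \<in> tuples (univ U) n \<and> c i \<in> tuples (univ U) k \<and> S (e i)) \<and>
     (\<forall>i<l. \<forall>j<l. holds U \<psi> (e i @ c j) \<longleftrightarrow> j \<le> i))"

lemma ladder_mono:
  assumes "ladder U n k \<psi> l S" "l' \<le> l" "\<And>x. x \<in> tuples (univ U) n \<Longrightarrow> S x \<Longrightarrow> S' x"
  shows "ladder U n k \<psi> l' S'"
proof -
  obtain e c where "\<forall>i<l. e i \<in> tuples (univ U) n \<and> c i \<in> tuples (univ U) k \<and> S (e i)"
    "\<forall>i<l. \<forall>j<l. holds U \<psi> (e i @ c j) \<longleftrightarrow> j \<le> i" using assms(1) by (auto simp: ladder_def)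
  then show ?thesis unfolding ladder_def using assms(2,3)
    by (intro exI[of _ e] exI[of _ c]) auto
qed

lemma ladder_iff_slices:
  "ladder U n k \<psi> l S \<longleftrightarrow> (\<exists>E\<in>tuples (univ U) (l * n). \<exists>C\<in>tuples (univ U) (l * k).
     (\<forall>i<l. S (slice E (i * n) n)) \<and>
     (\<forall>i<l. \<forall>j<l. holds U \<psi> (slice E (i * n) n @ slice C (j * k) k) \<longleftrightarrow> j \<le> i))" (is "_ \<longleftrightarrow> ?r")
proof
  assume "ladder U n k \<psi> l S"
  then obtain e c where ec: "\<forall>i<l. e i \<in> tuples (univ U) n \<and> c i \<in> tuples (univ U) k \<and> S (e i)"
    "\<forall>i<l. \<forall>j<l. holds U \<psi> (e i @ c j) \<longleftrightarrow> j \<le> i" by (auto simp: ladder_def)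
  have blocks: "concat (map f [0..<l]) \<in> tuples (univ U) (l * m) \<and>
      (\<forall>i<l. slice (concat (map f [0..<l])) (i * m) m = f i)"
    if "\<forall>i<l. f i \<in> tuples (univ U) m" for f :: "nat \<Rightarrow> 'c list" and m
  proof
    show "concat (map f [0..<l]) \<in> tuples (univ U) (l * m)"
      using concat_in_tuples[of "map f [0..<l]" "univ U" m] that by simp
    show "\<forall>i<l. slice (concat (map f [0..<l])) (i * m) m = f i"
      using slice_concat[of "map f [0..<l]" m] that by (simp add: tuples_def)
  qed
  have "\<forall>i<l. e i \<in> tuples (univ U) n" "\<forall>i<l. c i \<in> tuples (univ U) k" using ec(1) by auto
  from this[THEN blocks] show ?r
    using ec by (intro bexI[of _ "concat (map e [0..<l])"] bexI[of _ "concat (map c [0..<l])"]) auto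
next
  assume ?r
  then obtain E C where EC: "E \<in> tuples (univ U) (l * n)" "C \<in> tuples (univ U) (l * k)"
    "\<forall>i<l. S (slice E (i * n) n)"
    "\<forall>i<l. \<forall>j<l. holds U \<psi> (slice E (i * n) n @ slice C (j * k) k) \<longleftrightarrow> j \<le> i" by blast
  then show "ladder U n k \<psi> l S"
    unfolding ladder_def
    by (intro exI[of _ "\<lambda>i. slice E (i * n) n"] exI[of _ "\<lambda>i. slice C (i * k) k"])
       (auto intro!: slice_in_tuples block_le)
qed

lemma fdef_ladder:
  assumes "univ U \<noteq> {}" "\<chi> \<in> fms L (n + r)" "\<psi> \<in> fms L (n + k)"
  shows "fdef L U r (\<lambda>w. ladder U n k \<psi> l (\<lambda>x. holds U \<chi> (x @ w)))"
proof -
  \<comment> \<open>Layout of \<open>b\<close>: \<open>r\<close> places for the parameter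
    \<open>w\<close>, then \<open>l\<close> blocks of length \<open>n\<close> for the
    \<open>e i\<close>, then \<open>l\<close> blocks of length \<open>k\<close> for the
    \<open>c j\<close>.\<close>
  let ?P = "\<lambda>b. (\<forall>i<l. holds U \<chi> (slice b (r + i * n) n @ slice b 0 r)) \<and>
    (\<forall>i<l. \<forall>j<l. holds U \<psi> (slice b (r + i * n) n @ slice b (r + l * n + j * k) k) \<longleftrightarrow> j \<le> i)"
  have "fdef L U (r + l * n + l * k) ?P"
  proof (intro fdef_conj fdef_all_less fdef_iff fdef_const assms(1))
    fix i assume "i < l"
    then have "i * n + n \<le> l * n" by (rule block_le)
    then show "fdef L U (r + l * n + l * k) (\<lambda>b. holds U \<chi> (slice b (r + i * n) n @ slice b 0 r))"
      using assms(2) by (intro fdef_slices) auto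
  next
    fix i j assume "i < l" "j < l"
    then have "i * n + n \<le> l * n" "j * k + k \<le> l * k" by (auto intro: block_le)
    then show "fdef L U (r + l * n + l * k)
        (\<lambda>b. holds U \<psi> (slice b (r + i * n) n @ slice b (r + l * n + j * k) k))"
      using assms(3) by (intro fdef_slices) auto
  qed
  from fdef_ex[OF fdef_ex[OF this]]
  have "fdef L U r (\<lambda>w. \<exists>E\<in>tuples (univ U) (l * n). \<exists>C\<in>tuples (univ U) (l * k). ?P ((w @ E) @ C))" .
  then show ?thesis
  proof (rule fdef_cong[rotated])
    fix w assume w: "w \<in> tuples (univ U) r"
    have eqP: "?P ((w @ E) @ C) \<longleftrightarrow> (\<forall>i<l. holds U \<chi> (slice E (i * n) n @ w)) \<and>
        (\<forall>i<l. \<forall>j<l. holds U \<psi> (slice E (i * n) n @ slice C (j * k) k) \<longleftrightarrow> j \<le> i)"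
      if EC: "E \<in> tuples (univ U) (l * n)" "C \<in> tuples (univ U) (l * k)" for E C
    proof -
      have "slice ((w @ E) @ C) 0 r = w" using w by (simp add: tuples_def slice_def)
      moreover have "slice ((w @ E) @ C) (r + i * n) n = slice E (i * n) n" if "i < l" for i
        using block_le[OF that, of n] w EC by (simp add: tuples_def slice_append)
      moreover have "slice ((w @ E) @ C) (r + l * n + j * k) k = slice C (j * k) k" for j
        using w EC by (simp add: tuples_def slice_append)
      ultimately show ?thesis by simp
    qed
    show "(\<exists>E\<in>tuples (univ U) (l * n). \<exists>C\<in>tuples (univ U) (l * k). ?P ((w @ E) @ C)) \<longleftrightarrow>
        ladder U n k \<psi> l (\<lambda>x. holds U \<chi> (x @ w))"
      unfolding ladder_iff_slices by (rule bex_cong[OF refl], rule bex_cong[OF refl], rule eqP)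
  qed
qed

section \<open>Cardinalities and the standing assumptions on the monster model\<close>

lemma lepoll_iff_ordLeq: "A \<lesssim> B \<longleftrightarrow> (card_of A, card_of B) \<in> ordLeq"
  unfolding lepoll_def card_of_ordLeq[symmetric] by simp

lemma UN_lepoll_infinite:
  "infinite B \<Longrightarrow> I \<lesssim> B \<Longrightarrow> (\<And>i. i \<in> I \<Longrightarrow> A i \<lesssim> B) \<Longrightarrow> (\<Union>i\<in>I. A i) \<lesssim> B"
  using card_of_UNION_ordLeq_infinite[of B I A] by (simp add: lepoll_iff_ordLeq)

lemma Un_lepoll_infinite:
  assumes "infinite B" "A \<lesssim> B" "C \<lesssim> B" shows "A \<union> C \<lesssim> B"
proof -
  have "(\<Union>i\<in>{True, False}. if i then A else C) \<lesssim> B"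
    by (rule UN_lepoll_infinite[OF assms(1) finite_lepoll_infinite[OF assms(1)]])
       (use assms in \<open>auto split: if_splits\<close>)
  then show ?thesis by (simp add: Un_commute)
qed

text \<open>Uncountability allows countably many parameters to be adjoined to a small set, as the
  construction of a non-definable extension requires.\<close>

locale monster_model =
  fixes L :: "('f, 'r) lang" and U :: "('f, 'r, 'u) struct"
  assumes nonempty: "univ U \<noteq> {}" and saturated: "saturated L U" and uncountable: "uncountable (univ U)"
begin

lemma countable_lesspoll_univ: "countable X \<Longrightarrow> X \<prec> univ U"
proof -
  assume X: "countable X"
  then have "X \<lesssim> (UNIV :: nat set)" unfolding lepoll_def countable_def by auto
  also have "(UNIV :: nat set) \<lesssim> univ U"
    using uncountable countable_finite infinite_le_lepoll by blast
  finally have "X \<lesssim> univ U" .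
  moreover have "\<not> univ U \<lesssim> X" using countable_lepoll X uncountable by blast
  ultimately show ?thesis by (simp add: lesspoll_def eqpoll_imp_lepoll eqpoll_sym) (metis eqpoll_imp_lepoll eqpoll_sym)
qed

lemma small_Un_countable:
  assumes "small U A" "countable C" "C \<subseteq> univ U"
  shows "small U (A \<union> C)"
proof (cases "countable A")
  case True
  then show ?thesis using assms countable_lesspoll_univ[of "A \<union> C"] by (simp add: small_def)
next
  case False
  then have inf: "infinite A" using countable_finite by blast
  have "C \<lesssim> A" using assms(2) inf infinite_le_lepoll unfolding countable_def
    by (metis lepoll_def lepoll_trans top_greatest)
  then have "A \<union> C \<lesssim> A" by (rule Un_lepoll_infinite[OF inf lepoll_refl])
  then show ?thesis using assms lesspoll_trans1 by (auto simp: small_def)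
qed

text \<open>The invariant of the construction: it gives finite satisfiability (take
  \<open>l = 1\<close>), it consists of separate finitary conditions, and it survives the adjunction
  of a suitable pair \<psi>(x,c), \<not>\<psi>(x,c').\<close>

definition has_ladders :: "nat \<Rightarrow> nat \<Rightarrow> ('f, 'r) fm \<Rightarrow> ('f, 'r, 'u) pfm set \<Rightarrow> bool" where
  "has_ladders n k \<psi> \<Theta> \<longleftrightarrow>
     (\<forall>\<Theta>' l. finite \<Theta>' \<and> \<Theta>' \<subseteq> \<Theta> \<longrightarrow> ladder U n k \<psi> l (\<lambda>x. realises U x \<Theta>'))"

text \<open>A long ladder is cut into blocks of length \<open>Suc l\<close>. By the pigeonhole
  principle two block heads \<open>c\<close>, \<open>c'\<close> agree on the finite set
  \<open>T\<close>, and the rungs from the earlier head on satisfy \<psi>(x,c) but not yet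
  \<psi>(x,c').\<close>

lemma ladder_split_pair:
  assumes "ladder U n k \<psi> (Suc l * Suc (2 ^ card T)) S" "finite T"
  shows "\<exists>c\<in>tuples (univ U) k. \<exists>c'\<in>tuples (univ U) k.
    (\<forall>(\<theta>, d)\<in>T. holds U \<theta> (c @ d) \<longleftrightarrow> holds U \<theta> (c' @ d)) \<and>
    ladder U n k \<psi> l (\<lambda>x. S x \<and> holds U \<psi> (x @ c) \<and> \<not> holds U \<psi> (x @ c'))"
proof -
  let ?N = "Suc l * Suc (2 ^ card T)"
  obtain e c where ec: "\<forall>i<?N. e i \<in> tuples (univ U) n \<and> c i \<in> tuples (univ U) k \<and> S (e i)"
    "\<forall>i<?N. \<forall>j<?N. holds U \<psi> (e i @ c j) \<longleftrightarrow> j \<le> i" using assms(1) unfolding ladder_def by blast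
  \<comment> \<open>There are \<open>2 ^ card T\<close> truth patterns on \<open>T\<close> and one
    block head more. The \<open>Suc\<close> in the block length keeps blocks nonempty when
    \<open>l = 0\<close>.\<close>
  define f where "f s = {(\<theta>, d)\<in>T. holds U \<theta> (c (s * Suc l) @ d)}" for s
  have "f ` {..2 ^ card T} \<subseteq> Pow T" by (auto simp: f_def)
  then have "card (f ` {..2 ^ card T}) \<le> card (Pow T)" by (rule card_mono[rotated]) (simp add: assms(2))
  then have "card (f ` {..2 ^ card T}) < card {..(2::nat) ^ card T}" by (simp add: card_Pow assms(2))
  then have "\<not> inj_on f {..2 ^ card T}" by (rule pigeonhole)
  then have "\<exists>s s'. s < s' \<and> s' \<le> 2 ^ card T \<and> f s = f s'"
    unfolding inj_on_def by (metis atMost_iff linorder_neqE_nat)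
  then obtain s s' where s: "s < s'" "s' \<le> 2 ^ card T" "f s = f s'" by blast
  have lt: "s * Suc l + i < s' * Suc l" if "i < Suc l" for i
    using mult_le_mono1[of "Suc s" s' "Suc l"] s(1) that by simp
  have N: "s' * Suc l < ?N" using mult_le_mono1[OF s(2), of "Suc l"] by (simp add: algebra_simps)
  have N': "s * Suc l + i < ?N" if "i < Suc l" for i using lt[OF that] N by linarith
  have "c (s * Suc l) \<in> tuples (univ U) k" "c (s' * Suc l) \<in> tuples (univ U) k"
    using ec(1) N N'[of 0] by auto
  moreover have "\<forall>(\<theta>, d)\<in>T. holds U \<theta> (c (s * Suc l) @ d) \<longleftrightarrow> holds U \<theta> (c (s' * Suc l) @ d)"
    using s(3) unfolding f_def by blast
  moreover have "ladder U n k \<psi> l (\<lambda>x. S x \<and> holds U \<psi> (x @ c (s * Suc l)) \<and> \<not> holds U \<psi> (x @ c (s' * Suc l)))"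
    unfolding ladder_def
  proof (intro exI conjI allI impI)
    fix i assume "i < l"
    then have i: "s * Suc l + i < ?N" "s * Suc l + i < s' * Suc l" using N' lt by auto
    show "e (s * Suc l + i) \<in> tuples (univ U) n" "c (s * Suc l + i) \<in> tuples (univ U) k"
      "S (e (s * Suc l + i))" using ec(1) i by auto
    show "holds U \<psi> (e (s * Suc l + i) @ c (s * Suc l))" using ec(2) i N'[of 0] by simp
    show "\<not> holds U \<psi> (e (s * Suc l + i) @ c (s' * Suc l))" using ec(2) i N by (simp add: not_le)
    fix j assume "j < l"
    then show "holds U \<psi> (e (s * Suc l + i) @ c (s * Suc l + j)) \<longleftrightarrow> j \<le> i"
      using ec(2) i N'[of j] by simp
  qed
  ultimately show ?thesis by blast
qed

text \<open>Saturation is applied to a type in the \<open>k + k\<close> variables of the pair. It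
  asks for agreement on all formulas over \<open>B\<close> and for ladders of all lengths after the
  pair is adjoined; finitely many of these demands are met by a pair from a long ladder.\<close>

lemma exists_indiscernible_pair:
  assumes B: "small U B" and \<Theta>: "\<Theta> \<subseteq> pfms L n B" and \<psi>: "\<psi> \<in> fms L (n + k)"
    and lad: "has_ladders n k \<psi> \<Theta>"
  shows "\<exists>c\<in>tuples (univ U) k. \<exists>c'\<in>tuples (univ U) k.
    has_ladders n k \<psi> (\<Theta> \<union> {(\<psi>, c), (Neg \<psi>, c')}) \<and>
    (\<forall>(\<theta>, d)\<in>pfms L k B. holds U \<theta> (c @ d) \<longleftrightarrow> holds U \<theta> (c' @ d))"
proof -
  have BU: "B \<subseteq> univ U" "B \<prec> univ U" using B by (auto simp: small_def)
  define agree where "agree \<theta> d c c' \<longleftrightarrow> (holds U \<theta> (c @ d) \<longleftrightarrow> holds U \<theta> (c' @ d))" for \<theta> d c c'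
  define lad' where "lad' l S c c' \<longleftrightarrow>
    ladder U n k \<psi> l (\<lambda>x. S x \<and> holds U \<psi> (x @ c) \<and> \<not> holds U \<psi> (x @ c'))" for l S c c'
  \<comment> \<open>Both sets consist of all formulas over \<open>B\<close> equivalent to one of the
    wanted conditions. That each condition has such a formula is checked only after saturation has
    produced the pair.\<close>
  define \<Gamma>1 where "\<Gamma>1 = {(\<eta>, d)\<in>pfms L (k + k) B. \<exists>\<theta>. (\<theta>, d) \<in> pfms L k B \<and>
    (\<forall>c\<in>tuples (univ U) k. \<forall>c'\<in>tuples (univ U) k. holds U \<eta> ((c @ c') @ d) \<longleftrightarrow> agree \<theta> d c c')}"
  define \<Gamma>2 where "\<Gamma>2 = {(\<eta>, d)\<in>pfms L (k + k) B. \<exists>\<Theta>' l. finite \<Theta>' \<and> \<Theta>' \<subseteq> \<Theta> \<and>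
    (\<forall>c\<in>tuples (univ U) k. \<forall>c'\<in>tuples (univ U) k.
      holds U \<eta> ((c @ c') @ d) \<longleftrightarrow> lad' l (\<lambda>x. realises U x \<Theta>') c c')}"
  \<comment> \<open>Finitely many demands reduce to a standard form: agreement on a finite
    \<open>T\<close> and one ladder of one length inside one finite
    \<open>\<Theta>0\<close>.\<close>
  define suff where "suff \<Gamma> T \<Theta>0 l \<longleftrightarrow>
      (\<forall>c\<in>tuples (univ U) k. \<forall>c'\<in>tuples (univ U) k. (\<forall>(\<theta>, d)\<in>T. agree \<theta> d c c') \<and>
        lad' l (\<lambda>x. realises U x \<Theta>0) c c' \<longrightarrow> realises U (c @ c') \<Gamma>)" for \<Gamma> T \<Theta>0 l
  have fin: "\<exists>T \<Theta>0 l. finite T \<and> finite \<Theta>0 \<and> \<Theta>0 \<subseteq> \<Theta> \<and> suff \<Gamma> T \<Theta>0 l"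
    if "finite \<Gamma>" "\<Gamma> \<subseteq> \<Gamma>1 \<union> \<Gamma>2" for \<Gamma>
    using that
  proof (induction \<Gamma>)
    case empty
    show ?case by (intro exI[of _ "{}"]) (simp add: realises_empty suff_def)
  next
    case (insert \<gamma> \<Gamma>)
    obtain \<eta> d where \<gamma>: "\<gamma> = (\<eta>, d)" by (cases \<gamma>)
    obtain T \<Theta>0 l where T: "finite T" "finite \<Theta>0" "\<Theta>0 \<subseteq> \<Theta>" and suff: "suff \<Gamma> T \<Theta>0 l"
      using insert.IH insert.prems by blast
    from insert.prems \<gamma> have "(\<eta>, d) \<in> \<Gamma>1 \<or> (\<eta>, d) \<in> \<Gamma>2" by auto
    then show ?case
    proof
      assume "(\<eta>, d) \<in> \<Gamma>1"
      then obtain \<theta> where \<theta>: "\<forall>c\<in>tuples (univ U) k. \<forall>c'\<in>tuples (univ U) k.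
          holds U \<eta> ((c @ c') @ d) \<longleftrightarrow> agree \<theta> d c c'" unfolding \<Gamma>1_def by blast
      have "suff (insert \<gamma> \<Gamma>) (insert (\<theta>, d) T) \<Theta>0 l"
        unfolding suff_def
      proof (intro ballI impI)
        fix c c' assume cc: "c \<in> tuples (univ U) k" "c' \<in> tuples (univ U) k"
          and *: "(\<forall>(\<theta>, d)\<in>insert (\<theta>, d) T. agree \<theta> d c c') \<and> lad' l (\<lambda>x. realises U x \<Theta>0) c c'"
        then have "realises U (c @ c') \<Gamma>" using suff cc unfolding suff_def by simp
        moreover have "holds U \<eta> ((c @ c') @ d)" using \<theta> cc * by simp
        ultimately show "realises U (c @ c') (insert \<gamma> \<Gamma>)" by (simp add: \<gamma> realises_insert)
      qed
      moreover have "finite (insert (\<theta>, d) T)" using T by simp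
      ultimately show ?thesis using T by blast
    next
      assume "(\<eta>, d) \<in> \<Gamma>2"
      then obtain \<Theta>' l' where \<Theta>': "finite \<Theta>'" "\<Theta>' \<subseteq> \<Theta>"
        "\<forall>c\<in>tuples (univ U) k. \<forall>c'\<in>tuples (univ U) k.
          holds U \<eta> ((c @ c') @ d) \<longleftrightarrow> lad' l' (\<lambda>x. realises U x \<Theta>') c c'" unfolding \<Gamma>2_def by blast
      have "suff (insert \<gamma> \<Gamma>) T (\<Theta>0 \<union> \<Theta>') (max l l')"
        unfolding suff_def
      proof (intro ballI impI)
        fix c c' assume cc: "c \<in> tuples (univ U) k" "c' \<in> tuples (univ U) k"
          and *: "(\<forall>(\<theta>, d)\<in>T. agree \<theta> d c c') \<and> lad' (max l l') (\<lambda>x. realises U x (\<Theta>0 \<union> \<Theta>')) c c'"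
        then have "lad' l (\<lambda>x. realises U x \<Theta>0) c c'" "lad' l' (\<lambda>x. realises U x \<Theta>') c c'"
          unfolding lad'_def by (auto elim!: ladder_mono simp: realises_Un)
        then have "realises U (c @ c') \<Gamma>" "holds U \<eta> ((c @ c') @ d)"
          using suff \<Theta>'(3) cc * unfolding suff_def by simp_all
        then show "realises U (c @ c') (insert \<gamma> \<Gamma>)" by (simp add: \<gamma> realises_insert)
      qed
      moreover have "finite (\<Theta>0 \<union> \<Theta>')" "\<Theta>0 \<union> \<Theta>' \<subseteq> \<Theta>" using T \<Theta>' by auto
      ultimately show ?thesis using T(1) by blast
    qed
  qed
  have "finsat U (k + k) (\<Gamma>1 \<union> \<Gamma>2)"
    unfolding finsat_def
  proof (intro allI impI, elim conjE)
    fix \<Gamma> assume "finite \<Gamma>" "\<Gamma> \<subseteq> \<Gamma>1 \<union> \<Gamma>2"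
    then obtain T \<Theta>0 l where T: "finite T" "finite \<Theta>0" "\<Theta>0 \<subseteq> \<Theta>" "suff \<Gamma> T \<Theta>0 l"
      using fin[of \<Gamma>] by blast
    have "ladder U n k \<psi> (Suc l * Suc (2 ^ card T)) (\<lambda>x. realises U x \<Theta>0)"
      using lad T(2,3) unfolding has_ladders_def by blast
    from ladder_split_pair[OF this T(1)] obtain c c' where
      cc: "c \<in> tuples (univ U) k" "c' \<in> tuples (univ U) k" "\<forall>(\<theta>, d)\<in>T. agree \<theta> d c c'"
      "lad' l (\<lambda>x. realises U x \<Theta>0) c c'" unfolding agree_def lad'_def by blast
    then have "realises U (c @ c') \<Gamma>" using T(4) unfolding suff_def by simp
    then show "\<exists>b\<in>tuples (univ U) (k + k). realises U b \<Gamma>"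
      using tuples_append[OF cc(1,2)] by blast
  qed
  moreover have "\<Gamma>1 \<union> \<Gamma>2 \<subseteq> pfms L (k + k) B" by (auto simp: \<Gamma>1_def \<Gamma>2_def)
  ultimately obtain v where v: "v \<in> tuples (univ U) (k + k)" "realises U v (\<Gamma>1 \<union> \<Gamma>2)"
    using saturated_realises[OF saturated[unfolded saturated_def] BU, of "\<Gamma>1 \<union> \<Gamma>2" "k + k"] by metis
  define c c' where "c = take k v" and "c' = drop k v"
  have vc: "v = c @ c'" and cc: "c \<in> tuples (univ U) k" "c' \<in> tuples (univ U) k"
    using v(1) by (auto simp: c_def c'_def tuples_def dest: in_set_takeD in_set_dropD)
  have "agree \<theta> d c c'" if mem: "(\<theta>, d) \<in> pfms L k B" for \<theta> d
  proof -
    have \<theta>: "\<theta> \<in> fms L (k + length d)" and d: "set d \<subseteq> B" using mem by (auto simp: pfms_def)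
    have "fdef L U (k + k + length d) (\<lambda>b. holds U \<theta> (slice b 0 k @ slice b (k + k) (length d)) \<longleftrightarrow>
        holds U \<theta> (slice b k k @ slice b (k + k) (length d)))"
      using \<theta> by (intro fdef_iff fdef_slices) auto
    then obtain \<eta> where \<eta>: "\<eta> \<in> fms L (k + k + length d)"
      "\<forall>b\<in>tuples (univ U) (k + k + length d). holds U \<eta> b \<longleftrightarrow>
        (holds U \<theta> (slice b 0 k @ slice b (k + k) (length d)) \<longleftrightarrow>
        holds U \<theta> (slice b k k @ slice b (k + k) (length d)))" unfolding fdef_def by blast
    have eq: "holds U \<eta> ((c @ c') @ d) \<longleftrightarrow> agree \<theta> d c c'"
      if "c \<in> tuples (univ U) k" "c' \<in> tuples (univ U) k" for c c'
    proof -
      have "(c @ c') @ d \<in> tuples (univ U) (k + k + length d)" using that d BU(1) by (auto simp: tuples_def)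
      then have "holds U \<eta> ((c @ c') @ d) \<longleftrightarrow>
        (holds U \<theta> (slice ((c @ c') @ d) 0 k @ slice ((c @ c') @ d) (k + k) (length d)) \<longleftrightarrow>
        holds U \<theta> (slice ((c @ c') @ d) k k @ slice ((c @ c') @ d) (k + k) (length d)))"
        using \<eta>(2) by blast
      then show ?thesis using that by (simp add: tuples_def slice_def agree_def)
    qed
    have "(\<eta>, d) \<in> pfms L (k + k) B" using \<eta>(1) d by (simp add: pfms_def)
    then have "(\<eta>, d) \<in> \<Gamma>1" unfolding \<Gamma>1_def using mem eq by blast
    then have "holds U \<eta> ((c @ c') @ d)" using v(2) vc by (auto simp: realises_def)
    then show ?thesis using eq[OF cc] by simp
  qed
  moreover have "has_ladders n k \<psi> (\<Theta> \<union> {(\<psi>, c), (Neg \<psi>, c')})"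
    unfolding has_ladders_def
  proof (intro allI impI, elim conjE)
    fix \<Theta>' l assume fin': "finite \<Theta>'" and sub: "\<Theta>' \<subseteq> \<Theta> \<union> {(\<psi>, c), (Neg \<psi>, c')}"
    let ?\<Theta> = "\<Theta>' \<inter> \<Theta>"
    obtain \<chi> w where \<chi>: "(\<chi>, w) \<in> pfms L n B"
      "\<forall>b\<in>tuples (univ U) n. holds U \<chi> (b @ w) \<longleftrightarrow> realises U b ?\<Theta>"
      using pfms_conj[OF nonempty BU(1), of ?\<Theta> L n] fin' \<Theta> by blast
    then have w: "set w \<subseteq> B" and \<chi>m: "\<chi> \<in> fms L (n + length w)" by (auto simp: pfms_def)
    have "fdef L U (n + (k + k + length w)) (\<lambda>b. holds U \<chi> (slice b 0 n @ slice b (n + k + k) (length w)) \<and>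
       holds U \<psi> (slice b 0 n @ slice b n k) \<and> \<not> holds U \<psi> (slice b 0 n @ slice b (n + k) k))"
      using \<chi>m \<psi> by (intro fdef_conj fdef_not fdef_slices) auto
    then obtain \<xi> where \<xi>: "\<xi> \<in> fms L (n + (k + k + length w))"
      "\<forall>b\<in>tuples (univ U) (n + (k + k + length w)). holds U \<xi> b \<longleftrightarrow>
       (holds U \<chi> (slice b 0 n @ slice b (n + k + k) (length w)) \<and>
       holds U \<psi> (slice b 0 n @ slice b n k) \<and> \<not> holds U \<psi> (slice b 0 n @ slice b (n + k) k))"
      unfolding fdef_def by blast
    obtain \<eta> where \<eta>: "\<eta> \<in> fms L (k + k + length w)"
      "\<forall>b\<in>tuples (univ U) (k + k + length w). holds U \<eta> b \<longleftrightarrow> ladder U n k \<psi> l (\<lambda>x. holds U \<xi> (x @ b))"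
      using fdef_ladder[OF nonempty \<xi>(1) \<psi>, of l] unfolding fdef_def by blast
    have eq: "holds U \<eta> ((c @ c') @ w) \<longleftrightarrow> lad' l (\<lambda>x. realises U x ?\<Theta>) c c'"
      if "c \<in> tuples (univ U) k" "c' \<in> tuples (univ U) k" for c c'
    proof -
      have v: "(c @ c') @ w \<in> tuples (univ U) (k + k + length w)" using that w BU(1) by (auto simp: tuples_def)
      have "holds U \<xi> (x @ (c @ c') @ w) \<longleftrightarrow>
          realises U x ?\<Theta> \<and> holds U \<psi> (x @ c) \<and> \<not> holds U \<psi> (x @ c')" if x: "x \<in> tuples (univ U) n" for x
      proof -
        have len: "length x = n" "length c = k" "length c' = k" using x \<open>c \<in> _\<close> \<open>c' \<in> _\<close> by (auto simp: tuples_def)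
        have "slice (x @ (c @ c') @ w) 0 n = x" "slice (x @ (c @ c') @ w) (n + k + k) (length w) = w"
          "slice (x @ (c @ c') @ w) n k = c" "slice (x @ (c @ c') @ w) (n + k) k = c'"
          using len by (simp_all add: slice_def)
        then show ?thesis using \<xi>(2)[rule_format, OF tuples_append[OF x v]] \<chi>(2) x by simp
      qed
      then have "ladder U n k \<psi> l (\<lambda>x. holds U \<xi> (x @ (c @ c') @ w)) \<longleftrightarrow> lad' l (\<lambda>x. realises U x ?\<Theta>) c c'"
        unfolding lad'_def by (auto elim!: ladder_mono)
      then show ?thesis using \<eta>(2) v by blast
    qed
    have "(\<eta>, w) \<in> pfms L (k + k) B" using \<eta>(1) w by (simp add: pfms_def)
    moreover have "finite ?\<Theta> \<and> ?\<Theta> \<subseteq> \<Theta>" using fin' by simp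
    ultimately have "(\<eta>, w) \<in> \<Gamma>2" unfolding \<Gamma>2_def using eq by blast
    then have "holds U \<eta> ((c @ c') @ w)" using v(2) vc by (auto simp: realises_def)
    then have "lad' l (\<lambda>x. realises U x ?\<Theta>) c c'" using eq cc by blast
    then show "ladder U n k \<psi> l (\<lambda>x. realises U x \<Theta>')"
      unfolding lad'_def
    proof (rule ladder_mono)
      fix x assume "realises U x ?\<Theta> \<and> holds U \<psi> (x @ c) \<and> \<not> holds U \<psi> (x @ c')"
      then have "realises U x (insert (\<psi>, c) (insert (Neg \<psi>, c') ?\<Theta>))" by (simp add: realises_insert holds_Neg)
      then show "realises U x \<Theta>'" by (rule realises_mono) (use sub in blast)
    qed simp
  qed
  ultimately show ?thesis using cc unfolding agree_def by blast
qed

text \<open>Infinitely many pairs are adjoined, each having equal types over everything adjoined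
  before it. A definition of the extension uses finitely many parameters and so cannot separate a
  later pair, although \<psi> holds at one member and fails at the other.\<close>

lemma nondefinable_extension:
  assumes A: "small U A" and p: "p \<in> types L U n A" and \<psi>: "\<psi> \<in> fms L (n + k)"
    and lad: "has_ladders n k \<psi> p"
  shows "\<not> stable_type L U n A p"
proof -
  define par where "par xs = A \<union> (\<Union>x\<in>set xs. set (fst x) \<union> set (snd x))" for xs :: "('u list \<times> 'u list) list"
  define th where "th xs = p \<union> (\<Union>x\<in>set xs. {(\<psi>, fst x), (Neg \<psi>, snd x)})" for xs
  define I where "I xs \<longleftrightarrow> set xs \<subseteq> tuples (univ U) k \<times> tuples (univ U) k \<and>
    has_ladders n k \<psi> (th xs)" for xs
  define R where "R xs x \<longleftrightarrow> (\<forall>(\<theta>, d)\<in>pfms L k (par xs).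
    holds U \<theta> (fst x @ d) \<longleftrightarrow> holds U \<theta> (snd x @ d))" for xs x
  have pA: "p \<subseteq> pfms L n A" using p by (simp add: types_def)
  have th_sub: "th xs \<subseteq> pfms L n (par xs)" if "set xs \<subseteq> tuples (univ U) k \<times> tuples (univ U) k" for xs
  proof -
    have "p \<subseteq> pfms L n (par xs)" using pA pfms_mono[of A "par xs" L n] by (auto simp: par_def)
    moreover have "(\<psi>, fst x) \<in> pfms L n (par xs)" "(Neg \<psi>, snd x) \<in> pfms L n (par xs)"
      if "x \<in> set xs" for x
    proof -
      have "length (fst x) = k" "length (snd x) = k"
        using that \<open>set xs \<subseteq> _\<close> by (auto simp: tuples_def)
      moreover have "set (fst x) \<subseteq> par xs" "set (snd x) \<subseteq> par xs" using that by (auto simp: par_def)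
      ultimately show "(\<psi>, fst x) \<in> pfms L n (par xs)" "(Neg \<psi>, snd x) \<in> pfms L n (par xs)"
        using \<psi> by (auto simp: pfms_def fms_def)
    qed
    ultimately show ?thesis by (auto simp: th_def)
  qed
  have "\<exists>f. \<forall>i. I (map f [0..<i]) \<and> R (map f [0..<i]) (f i)"
  proof (rule history_choice)
    show "I []" using lad by (simp add: I_def th_def)
    fix xs assume xs: "I xs"
    have "(\<Union>x\<in>set xs. set (fst x) \<union> set (snd x)) \<subseteq> univ U"
    proof (rule UN_least)
      fix x assume "x \<in> set xs"
      then have "x \<in> tuples (univ U) k \<times> tuples (univ U) k" using xs unfolding I_def by blast
      then show "set (fst x) \<union> set (snd x) \<subseteq> univ U" by (auto simp: tuples_def)
    qed
    then have "small U (par xs)"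
      unfolding par_def by (intro small_Un_countable[OF A]) (simp_all add: countable_finite)
    moreover have "th xs \<subseteq> pfms L n (par xs)" using th_sub xs by (simp add: I_def)
    moreover have "has_ladders n k \<psi> (th xs)" using xs by (simp add: I_def)
    ultimately obtain c c' where c: "c \<in> tuples (univ U) k" "c' \<in> tuples (univ U) k"
      "has_ladders n k \<psi> (th xs \<union> {(\<psi>, c), (Neg \<psi>, c')})"
      "\<forall>(\<theta>, d)\<in>pfms L k (par xs). holds U \<theta> (c @ d) \<longleftrightarrow> holds U \<theta> (c' @ d)"
      using exists_indiscernible_pair[OF _ _ \<psi>] by blast
    have "th (xs @ [(c, c')]) = th xs \<union> {(\<psi>, c), (Neg \<psi>, c')}" by (auto simp: th_def)
    then show "\<exists>x. I (xs @ [x]) \<and> R xs x"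
      using c xs by (intro exI[of _ "(c, c')"]) (auto simp: I_def R_def)
  qed
  then obtain f where f: "\<And>i. I (map f [0..<i])" "\<And>i. R (map f [0..<i]) (f i)" by blast
  have f_tup: "f i \<in> tuples (univ U) k \<times> tuples (univ U) k" for i
    using f(1)[of "Suc i"] by (auto simp: I_def)
  define B where "B = A \<union> (\<Union>i. set (fst (f i)) \<union> set (snd (f i)))"
  define \<Theta> where "\<Theta> = (\<Union>i. th (map f [0..<i]))"
  have "(\<Union>i. set (fst (f i)) \<union> set (snd (f i))) \<subseteq> univ U"
    using f_tup by (simp add: mem_Times_iff tuples_def UN_subset_iff)
  then have B: "small U B"
    unfolding B_def by (intro small_Un_countable[OF A]) (auto intro: countable_finite)
  have par_B: "par (map f [0..<i]) \<subseteq> B" for i unfolding par_def B_def by auto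
  have prefix_mono: "set (map f [0..<i]) \<subseteq> set (map f [0..<j])" if "i \<le> j" for i j
    using that by auto
  have th_mono: "th (map f [0..<i]) \<subseteq> th (map f [0..<j])" if "i \<le> j" for i j
    unfolding th_def using prefix_mono[OF that] by blast
  have "\<Theta> \<subseteq> pfms L n B"
    using th_sub f(1) pfms_mono[OF par_B] unfolding \<Theta>_def I_def by blast
  moreover have "finsat U n \<Theta>"
    unfolding finsat_def
  proof (intro allI impI, elim conjE)
    fix \<Theta>' assume fin: "finite \<Theta>'" and sub: "\<Theta>' \<subseteq> \<Theta>"
    have "\<exists>i. \<Theta>' \<subseteq> th (map f [0..<i])"
      using fin sub
    proof (induction \<Theta>')
      case (insert \<theta> \<Theta>')
      then obtain i j where "\<Theta>' \<subseteq> th (map f [0..<i])" "\<theta> \<in> th (map f [0..<j])"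
        by (auto simp: \<Theta>_def)
      then show ?case using th_mono[of i "max i j"] th_mono[of j "max i j"]
        by (intro exI[of _ "max i j"]) auto
    qed simp
    then obtain i where "\<Theta>' \<subseteq> th (map f [0..<i])" by blast
    \<comment> \<open>Length 1 already yields a realisation.\<close>
    then have "ladder U n k \<psi> 1 (\<lambda>x. realises U x \<Theta>')"
      using f(1)[of i] fin unfolding I_def has_ladders_def by blast
    then show "\<exists>b\<in>tuples (univ U) n. realises U b \<Theta>'" by (auto simp: ladder_def)
  qed
  ultimately obtain q where q: "q \<in> types L U n B" "\<Theta> \<subseteq> q" by (rule finsat_extends_to_type)
  have "p \<subseteq> th (map f [0..<0])" by (simp add: th_def)
  then have "p \<subseteq> q" using q(2) unfolding \<Theta>_def by blast
  have "\<not> definable_type L U n B q"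
  proof
    assume "definable_type L U n B q"
    moreover have "(k, \<psi>) \<in> part_fms L n" using \<psi> by (simp add: part_fms_def)
    ultimately obtain \<theta> d where \<theta>: "(\<theta>, d) \<in> pfms L k B"
      "{b \<in> tuples B k. (\<psi>, b) \<in> q} = {b \<in> tuples B k. holds U \<theta> (b @ d)}"
      unfolding definable_type_def by fast
    have cover: "\<exists>i. set d' \<subseteq> par (map f [0..<i])" if "set d' \<subseteq> B" for d'
      using that
    proof (induction d')
      case (Cons u d')
      then obtain i where i: "set d' \<subseteq> par (map f [0..<i])" by auto
      obtain j where j: "u \<in> par (map f [0..<j])"
      proof -
        have "u \<in> A \<or> (\<exists>j. u \<in> set (fst (f j)) \<union> set (snd (f j)))" using Cons.prems by (auto simp: B_def)
        then show ?thesis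
        proof
          assume "u \<in> A" then show ?thesis using that[of 0] by (simp add: par_def)
        next
          assume "\<exists>j. u \<in> set (fst (f j)) \<union> set (snd (f j))"
          then obtain j where "u \<in> set (fst (f j)) \<union> set (snd (f j))" by blast
          moreover have "f j \<in> set (map f [0..<Suc j])" by simp
          ultimately show ?thesis using that[of "Suc j"] unfolding par_def by blast
        qed
      qed
      have par_mono: "par (map f [0..<i]) \<subseteq> par (map f [0..<j])" if "i \<le> j" for i j
        unfolding par_def using prefix_mono[OF that] by blast
      show ?case using i j par_mono[of i "max i j"] par_mono[of j "max i j"]
        by (intro exI[of _ "max i j"]) auto
    qed simp
    have "set d \<subseteq> B" using \<theta>(1) by (simp add: pfms_def)
    from cover[OF this] obtain i where i: "set d \<subseteq> par (map f [0..<i])" by (rule exE)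
    \<comment> \<open>Pair \<open>i\<close> was chosen after all of \<open>d\<close> had been
      covered, so its members agree on \<theta>(y,d).\<close>
    obtain c c' where cc: "f i = (c, c')" by (cases "f i")
    have "(\<theta>, d) \<in> pfms L k (par (map f [0..<i]))" using i \<theta>(1) by (simp add: pfms_def)
    then have eq: "holds U \<theta> (c @ d) \<longleftrightarrow> holds U \<theta> (c' @ d)" using f(2)[of i] cc unfolding R_def by auto
    have cB: "c \<in> tuples B k" "c' \<in> tuples B k"
    proof -
      have "set (fst (f i)) \<union> set (snd (f i)) \<subseteq> B" by (auto simp: B_def)
      then show "c \<in> tuples B k" "c' \<in> tuples B k" using f_tup[of i] cc by (auto simp: tuples_def)
    qed
    have "{(\<psi>, c), (Neg \<psi>, c')} \<subseteq> th (map f [0..<Suc i])" using cc by (simp add: th_def)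
    then have mem: "(\<psi>, c) \<in> q" "(Neg \<psi>, c') \<in> q" using q(2) unfolding \<Theta>_def by blast+
    have "(\<psi>, c') \<notin> q" using types_consistent[OF q(1)] mem(2) by blast
    have "c \<in> {b \<in> tuples B k. (\<psi>, b) \<in> q}" using cB mem(1) by simp
    then have "holds U \<theta> (c' @ d)" using \<theta>(2) eq by simp
    then have "c' \<in> {b \<in> tuples B k. (\<psi>, b) \<in> q}" using \<theta>(2) cB by simp
    then show False using \<open>(\<psi>, c') \<notin> q\<close> by simp
  qed
  then show ?thesis unfolding stable_type_def using B q(1) \<open>p \<subseteq> q\<close> B_def by blast
qed

end

section \<open>Compressible types that are not l-isolated\<close>

context monster_model
begin

text \<open>Both conclusions come from one construction relative to a finite part \<Theta> of
  \<open>p\<close>: with \<open>\<Theta> = {}\<close> it gives the order property in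
  \<open>A\<close>, and with arbitrary \<Theta> it gives ladders inside every finite part of
  \<open>p\<close>.\<close>

lemma compressible_not_l_isolated:
  assumes A: "small U A" and p: "p \<in> types L U n A"
    and comp: "compressible L U n A p" and not_iso: "\<not> l_isolated L U n A p"
  shows "\<exists>m k. \<exists>\<theta>\<in>fms L (m + k). order_in L U A m k \<theta>" and "\<not> stable_type L U n A p"
proof -
  have AU: "A \<subseteq> univ U" using A by (simp add: small_def)
  obtain b where b: "b \<in> tuples (univ U) n" "p = tp L U A b"
    by (rule small_type_realised[OF saturated A p])
  have lenb: "length b = n" using b(1) by (simp add: tuples_def)
  obtain m \<phi> where \<phi>: "(m, \<phi>) \<in> part_fms L n"
    "\<forall>\<zeta>\<in>p. \<not> entails U n {\<zeta>} (restr p {(m, \<phi>)} A)"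
    using not_iso unfolding l_isolated_def ball_pair by meson
  obtain k \<psi> where \<psi>: "(k, \<psi>) \<in> part_fms L n"
    "\<forall>A0\<subseteq>A. finite A0 \<longrightarrow> (\<exists>c\<in>tuples A k. (\<psi>, c) \<in> p \<and>
       entails U n {(\<psi>, c)} (restr p {(m, \<phi>)} A0))"
    using comp \<phi>(1) unfolding compressible_def ball_pair bex_pair by meson
  have \<phi>m: "\<phi> \<in> fms L (n + m)" and \<psi>m: "\<psi> \<in> fms L (n + k)" using \<phi>(1) \<psi>(1) by (auto simp: part_fms_def)
  have restr: "realises U e (restr p {(m, \<phi>)} A0) \<longleftrightarrow>
      (\<forall>a\<in>tuples A0 m. holds U \<phi> (e @ a) \<longleftrightarrow> holds U \<phi> (b @ a))" if "A0 \<subseteq> A" for e A0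
    using realises_restr_tp[of "{(m, \<phi>)}" L n A0 A b U e] \<phi>(1) that lenb b(2) by simp
  define seqs where "seqs \<Theta> c a e \<longleftrightarrow>
      (\<forall>i. c i \<in> tuples A k \<and> a i \<in> tuples A m \<and> e i \<in> tuples (univ U) n \<and>
        holds U \<psi> (b @ c i) \<and> realises U (e i) \<Theta> \<and> holds U \<phi> (e i @ a i) \<noteq> holds U \<phi> (b @ a i)) \<and>
      (\<forall>i j. j \<le> i \<longrightarrow> holds U \<psi> (e i @ c j)) \<and>
      (\<forall>i j. i < j \<longrightarrow> (\<forall>x\<in>tuples (univ U) n. holds U \<psi> (x @ c j) \<longrightarrow>
        (holds U \<phi> (x @ a i) \<longleftrightarrow> holds U \<phi> (b @ a i))))"
    for \<Theta> and c a e :: "nat \<Rightarrow> 'u list"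
  have ex: "\<exists>c a e. seqs \<Theta> c a e"
    if \<Theta>: "finite \<Theta>" "\<Theta> \<subseteq> p" for \<Theta>
  proof -
    define I where "I xs \<longleftrightarrow> (\<forall>(c, a, e)\<in>set xs. c \<in> tuples A k \<and> (\<psi>, c) \<in> p \<and> a \<in> tuples A m)"
      for xs :: "('u list \<times> 'u list \<times> 'u list) list"
    define R where "R xs = (\<lambda>(c, a, e). e \<in> tuples (univ U) n \<and> realises U e \<Theta> \<and> holds U \<psi> (e @ c) \<and>
      (\<forall>(c', a', e')\<in>set xs. holds U \<psi> (e @ c')) \<and> holds U \<phi> (e @ a) \<noteq> holds U \<phi> (b @ a) \<and>
      (\<forall>(c', a', e')\<in>set xs. \<forall>x\<in>tuples (univ U) n. holds U \<psi> (x @ c) \<longrightarrow>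
        (holds U \<phi> (x @ a') \<longleftrightarrow> holds U \<phi> (b @ a'))))"
      for xs :: "('u list \<times> 'u list \<times> 'u list) list"
    have "\<exists>f. \<forall>i. I (map f [0..<i]) \<and> R (map f [0..<i]) (f i)"
    proof (rule history_choice)
      show "I []" by (simp add: I_def)
      fix xs assume xs: "I xs"
      define A0 where "A0 = (\<Union>(c, a, e)\<in>set xs. set a)"
      have A0: "A0 \<subseteq> A" "finite A0" using xs by (fastforce simp: A0_def I_def tuples_def)+
      obtain c where c: "c \<in> tuples A k" "(\<psi>, c) \<in> p" "entails U n {(\<psi>, c)} (restr p {(m, \<phi>)} A0)"
        using \<psi>(2) A0 by meson
      \<comment> \<open>All conditions on the new \<open>e\<close> are formulas of \<open>p\<close>.
        Their conjunction lies in \<open>p\<close> too and so fails to imply the restriction of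
        \<open>p\<close> to \<phi>; a counterexample is \<open>e\<close>, and \<open>a\<close> is an
        instance where it disagrees with \<open>b\<close>.\<close>
      define \<Xi> where "\<Xi> = insert (\<psi>, c) (\<Theta> \<union> (\<lambda>(c, a, e). (\<psi>, c)) ` set xs)"
      have "\<Xi> \<subseteq> p" using xs c(2) \<Theta>(2) by (auto simp: \<Xi>_def I_def)
      moreover have "finite \<Xi>" using \<Theta>(1) by (simp add: \<Xi>_def)
      moreover have "p \<subseteq> pfms L n A" using p by (simp add: types_def)
      ultimately obtain \<chi> w where \<chi>: "(\<chi>, w) \<in> pfms L n A"
        "\<forall>x\<in>tuples (univ U) n. holds U \<chi> (x @ w) \<longleftrightarrow> realises U x \<Xi>"
        using pfms_conj[OF nonempty AU, of \<Xi> L n] by blast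
      have "realises U b p" using b(2) by (auto simp: realises_def tp_def)
      then have "holds U \<chi> (b @ w)" using \<chi>(2) b(1) realises_mono[OF _ \<open>\<Xi> \<subseteq> p\<close>] by blast
      then have "(\<chi>, w) \<in> p" using \<chi>(1) b(2) lenb by (simp add: tp_def)
      with \<phi>(2) have "\<not> entails U n {(\<chi>, w)} (restr p {(m, \<phi>)} A)" by (rule bspec)
      then obtain e where e: "e \<in> tuples (univ U) n" "holds U \<chi> (e @ w)"
        "\<not> realises U e (restr p {(m, \<phi>)} A)" by (auto simp: entails_def realises_def)
      then obtain a where a: "a \<in> tuples A m" "holds U \<phi> (e @ a) \<noteq> holds U \<phi> (b @ a)"
        using restr[OF order_refl, of e] by blast
      have "realises U e \<Xi>" using e \<chi>(2) by blast
      then have "realises U e \<Theta>" "holds U \<psi> (e @ c)"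
        unfolding \<Xi>_def realises_insert realises_Un by blast+
      moreover have "holds U \<psi> (e @ c')" if "(c', a', e') \<in> set xs" for c' a' e'
      proof -
        have "(\<psi>, c') \<in> \<Xi>" using that unfolding \<Xi>_def by force
        then show ?thesis using \<open>realises U e \<Xi>\<close> by (auto simp: realises_def)
      qed
      ultimately have e': "realises U e \<Theta>" "holds U \<psi> (e @ c)" "\<forall>(c', a', e')\<in>set xs. holds U \<psi> (e @ c')"
        by auto
      have "holds U \<phi> (x @ a') \<longleftrightarrow> holds U \<phi> (b @ a')"
        if "(c', a', e') \<in> set xs" "x \<in> tuples (univ U) n" "holds U \<psi> (x @ c)" for c' a' e' x
      proof -
        have "realises U x (restr p {(m, \<phi>)} A0)"
          using c(3) that(2,3) unfolding entails_def by (simp add: realises_insert realises_empty)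
        moreover have "a' \<in> tuples A0 m"
          using that(1) xs by (auto simp: tuples_def A0_def I_def)
        ultimately show ?thesis using restr[OF A0(1)] by blast
      qed
      then have "R xs (c, a, e)" unfolding R_def using e(1) e' a(2) by auto
      moreover have "I (xs @ [(c, a, e)])" using xs c(1,2) a(1) by (auto simp: I_def)
      ultimately show "\<exists>x. I (xs @ [x]) \<and> R xs x" by blast
    qed
    then obtain f where f: "\<And>i. I (map f [0..<i])" "\<And>i. R (map f [0..<i]) (f i)" by blast
    define c a e where "c i = fst (f i)" and "a i = fst (snd (f i))" and "e i = snd (snd (f i))" for i
    have fi: "f i = (c i, a i, e i)" for i by (simp add: c_def a_def e_def)
    have 1: "c i \<in> tuples A k \<and> (\<psi>, c i) \<in> p \<and> a i \<in> tuples A m" for i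
      using f(1)[of "Suc i"] fi[of i] by (auto simp: I_def)
    have 2: "holds U \<psi> (b @ c i)" for i using 1[of i] b(2) by (auto simp: tp_def)
    have mem: "(c j, a j, e j) \<in> set (map f [0..<i])" if "j < i" for i j
      using that fi[of j] by (metis atLeastLessThan_iff imageI list.set_map le0 set_upt)
    have 3: "e i \<in> tuples (univ U) n \<and> realises U (e i) \<Theta> \<and> holds U \<psi> (e i @ c i) \<and>
        holds U \<phi> (e i @ a i) \<noteq> holds U \<phi> (b @ a i)" for i
      using f(2)[of i] unfolding R_def fi by auto
    have 4: "holds U \<psi> (e i @ c j)" if "j < i" for i j
      using f(2)[of i] mem[OF that] unfolding R_def fi[of i] by blast
    have 5: "holds U \<phi> (x @ a i) \<longleftrightarrow> holds U \<phi> (b @ a i)"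
      if "i < j" "x \<in> tuples (univ U) n" "holds U \<psi> (x @ c j)" for i j x
      using f(2)[of j] mem[OF that(1)] that(2,3) unfolding R_def fi[of j] by blast
    have 6: "holds U \<psi> (e i @ c j)" if "j \<le> i" for i j
      using 3[of i] 4[of j i] that by (cases "j = i") auto
    have "seqs \<Theta> c a e" unfolding seqs_def using 1 2 3 5 6 by simp
    then show ?thesis by blast
  qed
  \<comment> \<open>A decision in either direction counts, so \<theta> need not know the truth value
    of \<phi>(x,a_i) at \<open>b\<close>, which may vary with \<open>i\<close>.\<close>
  have "fdef L U (m + k) (\<lambda>v.
      (\<forall>x\<in>tuples (univ U) n. holds U \<psi> (x @ slice v m k) \<longrightarrow> holds U \<phi> (x @ slice v 0 m)) \<or>
      (\<forall>x\<in>tuples (univ U) n. holds U \<psi> (x @ slice v m k) \<longrightarrow> \<not> holds U \<phi> (x @ slice v 0 m)))" (is "fdef L U _ ?D")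
  proof (rule fdef_cong)
    let ?x = "\<lambda>v. slice v (m + k) n"
    show "fdef L U (m + k) (\<lambda>v.
      (\<forall>x\<in>tuples (univ U) n. (\<lambda>v. holds U \<psi> (?x v @ slice v m k) \<longrightarrow> holds U \<phi> (?x v @ slice v 0 m)) (v @ x)) \<or>
      (\<forall>x\<in>tuples (univ U) n. (\<lambda>v. holds U \<psi> (?x v @ slice v m k) \<longrightarrow> \<not> holds U \<phi> (?x v @ slice v 0 m)) (v @ x)))"
      using \<phi>m \<psi>m by (intro fdef_disj fdef_all fdef_imp fdef_not fdef_slices) auto
    fix v assume v: "v \<in> tuples (univ U) (m + k)"
    have "slice (v @ x) (m + k) n = x" "slice (v @ x) m k = slice v m k" "slice (v @ x) 0 m = slice v 0 m"
      if "x \<in> tuples (univ U) n" for x using v that by (simp_all add: tuples_def slice_def)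
    then show "((\<forall>x\<in>tuples (univ U) n. (\<lambda>v. holds U \<psi> (?x v @ slice v m k) \<longrightarrow> holds U \<phi> (?x v @ slice v 0 m)) (v @ x)) \<or>
      (\<forall>x\<in>tuples (univ U) n. (\<lambda>v. holds U \<psi> (?x v @ slice v m k) \<longrightarrow> \<not> holds U \<phi> (?x v @ slice v 0 m)) (v @ x))) \<longleftrightarrow> ?D v"
      by simp
  qed
  then obtain \<theta> where \<theta>: "\<theta> \<in> fms L (m + k)" "\<forall>v\<in>tuples (univ U) (m + k). holds U \<theta> v \<longleftrightarrow> ?D v"
    unfolding fdef_def by blast
  have seqD: "c i \<in> tuples A k" "a i \<in> tuples A m" "e i \<in> tuples (univ U) n"
      "holds U \<psi> (b @ c i)" "realises U (e i) X" "holds U \<phi> (e i @ a i) \<noteq> holds U \<phi> (b @ a i)"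
      "\<And>j. j \<le> i \<Longrightarrow> holds U \<psi> (e i @ c j)"
      "\<And>j x. i < j \<Longrightarrow> x \<in> tuples (univ U) n \<Longrightarrow> holds U \<psi> (x @ c j) \<Longrightarrow>
        (holds U \<phi> (x @ a i) \<longleftrightarrow> holds U \<phi> (b @ a i))"
    if "seqs X c a e" for X c a e i
    using that unfolding seqs_def by simp_all
  obtain c a e where ce: "seqs {} c a e" using ex[of "{}"] by blast
  have "holds U \<theta> (a i @ c j) \<longleftrightarrow> i < j" for i j
  proof -
    have ac: "a i \<in> tuples A m" "c j \<in> tuples A k" using seqD(1,2)[OF ce] by auto
    then have "a i @ c j \<in> tuples (univ U) (m + k)" using AU tuples_append tuples_mono by blast
    moreover have "slice (a i @ c j) 0 m = a i" "slice (a i @ c j) m k = c j"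
      using ac by (simp_all add: slice_def tuples_def)
    ultimately have iff: "holds U \<theta> (a i @ c j) \<longleftrightarrow>
      (\<forall>x\<in>tuples (univ U) n. holds U \<psi> (x @ c j) \<longrightarrow> holds U \<phi> (x @ a i)) \<or>
      (\<forall>x\<in>tuples (univ U) n. holds U \<psi> (x @ c j) \<longrightarrow> \<not> holds U \<phi> (x @ a i))"
      using \<theta>(2) by auto
    show ?thesis
    proof (cases "i < j")
      case True
      then show ?thesis unfolding iff using seqD(8)[OF ce True] by blast
    next
      case False
      then have "holds U \<psi> (e i @ c j)" "holds U \<psi> (b @ c j)" using seqD(4,7)[OF ce] by auto
      then show ?thesis unfolding iff using seqD(3,6)[OF ce, of i] b(1) False by blast
    qed
  qed
  then have "order_in L U A m k \<theta>" unfolding order_in_def using seqD(1,2)[OF ce] by blast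
  then show "\<exists>m k. \<exists>\<theta>\<in>fms L (m + k). order_in L U A m k \<theta>" using \<theta>(1) by blast
  have "has_ladders n k \<psi> p"
    unfolding has_ladders_def
  proof (intro allI impI, elim conjE)
    fix \<Theta>' l assume "finite \<Theta>'" "\<Theta>' \<subseteq> p"
    from ex[OF this] obtain c a e where ce: "seqs \<Theta>' c a e" by blast
    \<comment> \<open>For \<open>i < j\<close> every solution of \<psi>(x,c_j) agrees with
      \<open>b\<close> at \<open>a i\<close>, which \<open>e i\<close> does not.\<close>
    have "holds U \<psi> (e i @ c j) \<longleftrightarrow> j \<le> i" for i j
      using seqD(3,6)[OF ce, of i] seqD(7)[OF ce, of j i] seqD(8)[OF ce, of i j "e i"] by (cases "j \<le> i") auto
    then show "ladder U n k \<psi> l (\<lambda>x. realises U x \<Theta>')"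
      unfolding ladder_def using seqD(1,3,5)[OF ce] tuples_mono[OF AU, of k]
      by (intro exI[of _ e] exI[of _ c]) auto
  qed
  then show "\<not> stable_type L U n A p" by (rule nondefinable_extension[OF A p \<psi>m])
qed

end

section \<open>Compressible members of set systems without large shattered sets\<close>

text \<open>The traces on \<open>Y\<close> that are not negligible for \<open>F\<close>. For finite
  \<open>Y\<close> almost every member has one of them as its trace, so they can be counted like the
  traces of a set system.\<close>

definition filter_patterns :: "'a set filter \<Rightarrow> 'a set \<Rightarrow> 'a set set" where
  "filter_patterns F Y = {Q. \<exists>\<^sub>F c in F. c \<inter> Y = Q}"

definition pattern_bound :: "'a set filter \<Rightarrow> nat \<Rightarrow> nat \<Rightarrow> bool" where
  "pattern_bound F x y \<longleftrightarrow> (\<forall>Y. finite Y \<and> card Y = x \<longrightarrow> card (filter_patterns F Y) \<le> y)"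

text \<open>Every \<open>F\<close>-large property is forced, over \<open>F0\<close>, by prescribing
  the trace on at most \<open>k\<close> points, the prescription itself being
  \<open>F\<close>-large. The number \<open>k\<close> does not depend on the property; in the end it
  bounds the teaching sets.\<close>

definition approximates :: "nat \<Rightarrow> 'a set filter \<Rightarrow> 'a set filter \<Rightarrow> bool" where
  "approximates k F0 F \<longleftrightarrow> F \<le> F0 \<and> F \<noteq> bot \<and>
     (\<forall>P. eventually P F \<longrightarrow> (\<exists>A B. finite A \<and> card A \<le> k \<and>
        (\<forall>\<^sub>F c in F. c \<inter> A = B) \<and> (\<forall>\<^sub>F c in F0. c \<inter> A = B \<longrightarrow> P c)))"

lemma frequently_filter_mono: "F \<le> G \<Longrightarrow> frequently P F \<Longrightarrow> frequently P G"
  unfolding frequently_def by (auto dest: filter_leD)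

lemma filter_patterns_subset: "filter_patterns F Y \<subseteq> Pow Y"
  unfolding filter_patterns_def by (auto dest!: frequently_ex)

lemma finite_filter_patterns: "finite Y \<Longrightarrow> finite (filter_patterns F Y)"
  using filter_patterns_subset[of F Y] finite_subset by blast

lemma filter_patterns_mono: "F \<le> G \<Longrightarrow> filter_patterns F Y \<subseteq> filter_patterns G Y"
  unfolding filter_patterns_def by (auto intro: frequently_filter_mono)

lemma eventually_in_filter_patterns:
  assumes "finite Y" shows "\<forall>\<^sub>F c in F. c \<inter> Y \<in> filter_patterns F Y"
proof -
  have "\<forall>\<^sub>F c in F. \<forall>Q\<in>Pow Y - filter_patterns F Y. c \<inter> Y \<noteq> Q"
    using assms by (intro eventually_ball_finite) (auto simp: filter_patterns_def frequently_def)
  then show ?thesis by eventually_elim auto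
qed

lemma filter_patterns_nonempty:
  assumes "F \<noteq> bot" "finite Y" shows "filter_patterns F Y \<noteq> {}"
  using eventually_in_filter_patterns[OF assms(2), of F] assms(1)
  by (auto simp: trivial_limit_def)

lemma filter_patterns_inter:
  assumes "finite Y" "Y' \<subseteq> Y"
  shows "filter_patterns F Y' = (\<lambda>Q. Q \<inter> Y') ` filter_patterns F Y"
proof
  have eq: "c \<inter> Y \<inter> Y' = c \<inter> Y'" for c using assms(2) by auto
  show "(\<lambda>Q. Q \<inter> Y') ` filter_patterns F Y \<subseteq> filter_patterns F Y'"
    unfolding filter_patterns_def using eq by (auto elim!: frequently_elim1)
  show "filter_patterns F Y' \<subseteq> (\<lambda>Q. Q \<inter> Y') ` filter_patterns F Y"
  proof
    fix Q assume "Q \<in> filter_patterns F Y'"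
    then have "\<exists>\<^sub>F c in F. c \<inter> Y' = Q" by (simp add: filter_patterns_def)
    then have "\<exists>\<^sub>F c in F. c \<inter> Y' = Q \<and> c \<inter> Y \<in> filter_patterns F Y"
      using eventually_in_filter_patterns[OF assms(1), of F]
      by (rule frequently_eventually_frequently)
    then obtain c where "c \<inter> Y' = Q" "c \<inter> Y \<in> filter_patterns F Y"
      by (auto dest: frequently_ex)
    then show "Q \<in> (\<lambda>Q. Q \<inter> Y') ` filter_patterns F Y" using eq by (metis imageI)
  qed
qed

lemma approximates_refl: "F \<noteq> bot \<Longrightarrow> approximates k F F"
  unfolding approximates_def by (auto intro!: exI[of _ "{}"])

lemma approximatesE:
  assumes "approximates k F0 F" "eventually P F"
  obtains A B where "finite A" "card A \<le> k" "\<forall>\<^sub>F c in F. c \<inter> A = B"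
    "\<forall>\<^sub>F c in F0. c \<inter> A = B \<longrightarrow> P c"
  using assms by (auto simp: approximates_def)

text \<open>A property large for \<open>F2\<close> is forced over \<open>F1\<close> by
  \<open>l\<close> points; that they force it is a property large for \<open>F1\<close>, hence
  itself forced over \<open>F0\<close> by \<open>k\<close> points. The union of the two sets of
  points does both.\<close>

lemma approximates_trans:
  assumes "approximates k F0 F1" "approximates l F1 F2"
  shows "approximates (k + l) F0 F2"
  unfolding approximates_def
proof (intro conjI allI impI)
  show "F2 \<le> F0" "F2 \<noteq> bot" using assms unfolding approximates_def by auto
  fix P assume "eventually P F2"
  then obtain A' B' where 1: "finite A'" "card A' \<le> l" "\<forall>\<^sub>F c in F2. c \<inter> A' = B'"
    "\<forall>\<^sub>F c in F1. c \<inter> A' = B' \<longrightarrow> P c"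
    by (rule approximatesE[OF assms(2)])
  obtain A B where 2: "finite A" "card A \<le> k" "\<forall>\<^sub>F c in F1. c \<inter> A = B"
    "\<forall>\<^sub>F c in F0. c \<inter> A = B \<longrightarrow> c \<inter> A' = B' \<longrightarrow> P c"
    by (rule approximatesE[OF assms(1) 1(4)])
  have "F2 \<le> F1" using assms(2) by (simp add: approximates_def)
  then have ev: "\<forall>\<^sub>F c in F2. c \<inter> A = B \<and> c \<inter> A' = B'"
    using filter_leD[OF _ 2(3)] 1(3) by (simp add: eventually_conj_iff)
  \<comment> \<open>A common member shows that \<open>B\<close> and \<open>B'\<close> agree where
    \<open>A\<close> and \<open>A'\<close> overlap, so the trace \<open>B \<union> B'\<close> on the
    union gives back both.\<close>
  then obtain c0 where c0: "c0 \<inter> A = B" "c0 \<inter> A' = B'"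
    using \<open>F2 \<noteq> bot\<close> eventually_happens' by blast
  show "\<exists>A B. finite A \<and> card A \<le> k + l \<and> (\<forall>\<^sub>F c in F2. c \<inter> A = B) \<and>
      (\<forall>\<^sub>F c in F0. c \<inter> A = B \<longrightarrow> P c)"
  proof (intro exI conjI)
    show "finite (A \<union> A')" using 1 2 by simp
    show "card (A \<union> A') \<le> k + l" using 1(2) 2(2) card_Un_le[of A A'] by linarith
    show "\<forall>\<^sub>F c in F2. c \<inter> (A \<union> A') = B \<union> B'" using ev by eventually_elim auto
    have eq: "c \<inter> A = B \<and> c \<inter> A' = B'" if "c \<inter> (A \<union> A') = B \<union> B'" for c
      using that c0 by auto
    show "\<forall>\<^sub>F c in F0. c \<inter> (A \<union> A') = B \<union> B' \<longrightarrow> P c"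
      using 2(4) by eventually_elim (use eq in auto)
  qed
qed

text \<open>The same \<open>k\<close> serves along a descending chain: a property large for the
  infimum is large for some member of the chain.\<close>

lemma approximates_minimal:
  assumes "F0 \<noteq> bot"
  shows "\<exists>F. approximates k F0 F \<and> (\<forall>G. approximates k F0 G \<and> G \<le> F \<longrightarrow> G = F)"
proof -
  let ?S = "{F. approximates k F0 F}"
  have po: "partial_order_on ?S (relation_of (\<ge>) ?S)"
    by (auto simp: relation_of_def partial_order_on_def preorder_on_def refl_on_def trans_def antisym_def)
  have "\<exists>m\<in>?S. \<forall>a\<in>?S. m \<ge> a \<longrightarrow> a = m"
  proof (rule predicate_Zorn[OF po])
    fix C assume C: "C \<in> Chains (relation_of (\<ge>) ?S)"
    show "\<exists>u\<in>?S. \<forall>a\<in>C. a \<ge> u"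
    proof (cases "C = {}")
      case True then show ?thesis using approximates_refl[OF assms] by auto
    next
      case False
      have CS: "C \<subseteq> ?S" using C unfolding Chains_def relation_of_def by auto
      have ev: "eventually P (Inf C) \<longleftrightarrow> (\<exists>b\<in>C. eventually P b)" for P
        by (rule eventually_Inf_base[OF False])
           (use C in \<open>force simp: Chains_def relation_of_def\<close>)
      have "approximates k F0 (Inf C)"
        unfolding approximates_def
      proof (intro conjI allI impI)
        obtain b where "b \<in> C" using False by auto
        then have "Inf C \<le> b" "b \<le> F0" using CS by (auto intro: Inf_lower simp: approximates_def)
        then show "Inf C \<le> F0" by (rule order_trans)
        show "Inf C \<noteq> bot" using CS unfolding trivial_limit_def ev approximates_def by auto
        fix P assume "eventually P (Inf C)"
        then obtain b where b: "b \<in> C" "eventually P b" using ev by auto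
        then obtain A B where "finite A" "card A \<le> k" "\<forall>\<^sub>F c in b. c \<inter> A = B"
          "\<forall>\<^sub>F c in F0. c \<inter> A = B \<longrightarrow> P c" using approximatesE[of k F0 b P] CS by auto
        then show "\<exists>A B. finite A \<and> card A \<le> k \<and> (\<forall>\<^sub>F c in Inf C. c \<inter> A = B) \<and>
            (\<forall>\<^sub>F c in F0. c \<inter> A = B \<longrightarrow> P c)" using ev b by blast
      qed
      then show ?thesis by (auto intro: Inf_lower)
    qed
  qed
  then show ?thesis by auto
qed

text \<open>Toggling away all points of \<open>Y\<close> gives the empty set, and toggling points
  back in gives every subset.\<close>

lemma flip_closed_eq_Pow:
  assumes "finite Y" "P \<subseteq> Pow Y" "P \<noteq> {}"
    and flip: "\<And>v Q. v \<in> Y \<Longrightarrow> Q \<in> P \<Longrightarrow> (if v \<in> Q then Q - {v} else insert v Q) \<in> P"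
  shows "P = Pow Y"
proof -
  obtain Q0 where "Q0 \<in> P" using assms(3) by auto
  have down: "Q - D \<in> P" if "Q \<in> P" "finite D" "D \<subseteq> Y" for Q D
    using that(2,3)
  proof (induction D)
    case (insert v D)
    then have "Q - D \<in> P" "v \<in> Y" by auto
    from flip[OF this(2,1)] show ?case using insert.hyps \<open>Q - D \<in> P\<close>
      by (cases "v \<in> Q") (auto simp: Diff_insert[symmetric])
  qed (use that in auto)
  have "Q0 - Y = {}" using \<open>Q0 \<in> P\<close> assms(2) by auto
  moreover have "Q0 - Y \<in> P" using down[OF \<open>Q0 \<in> P\<close> \<open>finite Y\<close>] by simp
  ultimately have "{} \<in> P" by (simp only:)
  have "D \<in> P" if "finite D" "D \<subseteq> Y" for D using that
  proof (induction D)
    case (insert v D)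
    then have "D \<in> P" "v \<in> Y" by auto
    from flip[OF this(2,1)] show ?case using insert.hyps by simp
  qed (use \<open>{} \<in> P\<close> in simp)
  then have "Pow Y \<subseteq> P" using finite_subset[OF _ assms(1)] by auto
  with assms(2) show ?thesis by (rule subset_antisym)
qed

text \<open>If forgetting any point at least halved the number of traces, every trace would occur
  both with and without that point. The family would be closed under toggling and hence be all of
  \<open>Pow Y\<close>.\<close>

lemma exists_large_projection:
  assumes "finite Y" "P \<subseteq> Pow Y" "P \<noteq> {}" "P \<noteq> Pow Y"
  shows "\<exists>v\<in>Y. card P < 2 * card ((\<lambda>Q. Q \<inter> (Y - {v})) ` P)"
proof (rule ccontr)
  assume neg: "\<not> (\<exists>v\<in>Y. card P < 2 * card ((\<lambda>Q. Q \<inter> (Y - {v})) ` P))"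
  have le: "2 * card ((\<lambda>Q. Q - {v}) ` P) \<le> card P" if "v \<in> Y" for v
  proof -
    have "(\<lambda>Q. Q \<inter> (Y - {v})) ` P = (\<lambda>Q. Q - {v}) ` P"
      using assms(2) by (intro image_cong) auto
    moreover have "2 * card ((\<lambda>Q. Q \<inter> (Y - {v})) ` P) \<le> card P" using neg that by (simp add: not_less)
    ultimately show ?thesis by simp
  qed
  have finP: "finite P" using assms finite_subset by blast
  have "(if v \<in> Q then Q - {v} else insert v Q) \<in> P" if v: "v \<in> Y" and Q: "Q \<in> P" for v Q
  proof (rule ccontr)
    assume nin: "(if v \<in> Q then Q - {v} else insert v Q) \<notin> P"
    let ?R = "(\<lambda>Q. Q - {v}) ` P"
    have inj1: "P \<subseteq> (?R) \<union> insert v ` ?R"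
    proof
      fix Q assume "Q \<in> P"
      show "Q \<in> ?R \<union> insert v ` ?R"
      proof (cases "v \<in> Q")
        case True
        then have "Q = insert v (Q - {v})" by auto
        then show ?thesis using \<open>Q \<in> P\<close> by blast
      next
        case False
        then have "Q = Q - {v}" by auto
        then show ?thesis using \<open>Q \<in> P\<close> by blast
      qed
    qed
    have "P \<subseteq> (?R \<union> insert v ` ?R) - {if v \<in> Q then Q - {v} else insert v Q}"
      using inj1 nin by auto
    moreover have "(if v \<in> Q then Q - {v} else insert v Q) \<in> ?R \<union> insert v ` ?R"
    proof (cases "v \<in> Q")
      case False
      then have "Q = Q - {v}" by auto
      then have "insert v Q \<in> insert v ` ?R" using Q by blast
      then show ?thesis using False by simp
    qed (use Q in auto)
    ultimately have "P \<subset> ?R \<union> insert v ` ?R" by blast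
    then have "card P < card (?R \<union> insert v ` ?R)"
      using finP by (intro psubset_card_mono) auto
    also have "\<dots> \<le> card ?R + card (insert v ` ?R)" by (rule card_Un_le)
    also have "card (insert v ` ?R) \<le> card ?R" by (rule card_image_le) (simp add: finP)
    finally show False using le[OF v] by linarith
  qed
  then have "P = Pow Y" by (intro flip_closed_eq_Pow[OF assms(1-3)]) auto
  then show False using assms(4) by simp
qed

text \<open>If \<open>F\<close> still had \<open>Suc y\<close> traces on \<open>Y\<close>, dropping
  a suitable \<open>v\<close> would leave a set \<open>P'\<close> of traces on \<open>Y'\<close>
  with \<open>2 * card P' > Suc y\<close>. Minimality of \<open>F\<close> yields a point
  \<open>w\<close> such that each trace in \<open>P'\<close> occurs over \<open>F0\<close> both with
  and without \<open>w\<close>: too many traces for a set of \<open>x\<close> points. The lower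
  bound on \<open>k\<close> pays \<open>x\<close> points for each of at most \<open>Suc y\<close>
  traces and \<open>x\<close> more for adding \<open>Y'\<close>.\<close>

lemma pattern_bound_step:
  assumes min: "approximates k F0 F" "\<And>G. approximates k F0 G \<Longrightarrow> G \<le> F \<Longrightarrow> G = F"
    and bd: "pattern_bound F0 x (Suc y)" and y: "1 \<le> y" "Suc y < 2 ^ x"
    and k: "(Suc y + 1) * x \<le> k"
  shows "pattern_bound F x y"
  unfolding pattern_bound_def
proof (intro allI impI, rule ccontr, elim conjE)
  fix Y assume finY: "finite Y" and cardY: "card Y = x" and "\<not> card (filter_patterns F Y) \<le> y"
  have FF0: "F \<le> F0" and Fbot: "F \<noteq> bot" using min(1) by (auto simp: approximates_def)
  define P where "P = filter_patterns F0 Y"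
  have cP: "card P \<le> Suc y" using bd finY cardY by (simp add: pattern_bound_def P_def)
  have "finite P" by (simp add: P_def finY finite_filter_patterns)
  \<comment> \<open>Traces of \<open>F\<close> are traces of \<open>F0\<close>, and there are at
    most \<open>Suc y\<close> of the latter, so the two sets coincide.\<close>
  then have pF: "filter_patterns F Y = P"
    using filter_patterns_mono[OF FF0, of Y] cP \<open>\<not> card (filter_patterns F Y) \<le> y\<close>
    unfolding P_def by (intro card_subset_eq) (auto intro: le_antisym card_mono dest: card_mono)
  then have cPeq: "card P = Suc y" using cP \<open>\<not> card (filter_patterns F Y) \<le> y\<close> by simp
  have "P \<noteq> Pow Y" using cPeq y(2) cardY finY card_Pow by fastforce
  then obtain v where v: "v \<in> Y" "Suc y < 2 * card ((\<lambda>Q. Q \<inter> (Y - {v})) ` P)"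
    using exists_large_projection[OF finY, of P] cPeq filter_patterns_subset[of F0 Y]
    unfolding P_def by fastforce
  define Y' where "Y' = Y - {v}"
  define P' where "P' = filter_patterns F Y'"
  have finY': "finite Y'" and cardY': "card Y' = x - 1" "x \<ge> 1"
    using finY cardY v(1) by (auto simp: Y'_def) (metis card_gt_0_iff empty_iff Suc_leI)
  have P'0: "filter_patterns F0 Y' = P'"
    unfolding P'_def using filter_patterns_inter[OF finY, of Y'] pF by (auto simp: Y'_def P_def)
  have P'P: "P' = (\<lambda>Q. Q \<inter> Y') ` P"
    unfolding P'_def using filter_patterns_inter[OF finY, of Y' F] pF by (auto simp: Y'_def)
  have cP': "Suc y < 2 * card P'" using v(2) P'P by (simp add: Y'_def)
  have finP': "finite P'" unfolding P'_def by (rule finite_filter_patterns[OF finY'])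
  have "card P' \<le> Suc y" using P'P cPeq card_image_le[OF \<open>finite P\<close>] by metis
  \<comment> \<open>A second trace makes the refinement of \<open>F\<close> by the condition
    \<open>c \<inter> Y' = q\<close> a proper one.\<close>
  have two: "\<exists>q'\<in>P'. q' \<noteq> q" if "q \<in> P'" for q
  proof (rule ccontr)
    assume "\<not> ?thesis" then have "P' \<subseteq> {q}" by auto
    then have "card P' \<le> card {q}" by (rule card_mono[rotated]) simp
    then have "card P' \<le> 1" by simp
    then show False using cP' y(1) by linarith
  qed
  \<comment> \<open>\<open>W q R\<close>: once \<open>R\<close> is forced by a prescription on
    \<open>A\<close>, trading \<open>Z\<close> for the trace \<open>q\<close> on \<open>Y'\<close>
    does not recover that prescription. \<open>Z\<close> is left free because two choices are
    needed: \<open>Z = {}\<close> shows that \<open>A\<close> is large, and \<open>x - 1\<close>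
    points show that \<open>bad q\<close> is small.\<close>
  define W where "W q R \<longleftrightarrow> eventually R F \<and> (\<forall>A B Z. finite A \<and> card A \<le> k \<and>
      (\<forall>\<^sub>F c in F. c \<inter> A = B) \<and> (\<forall>\<^sub>F c in F0. c \<inter> A = B \<longrightarrow> R c) \<and>
      Z \<subseteq> A \<and> card ((A - Z) \<union> Y') \<le> k \<longrightarrow>
      (\<exists>\<^sub>F c in F0. c \<inter> (A - Z) = B - Z \<and> c \<inter> Y' = q \<and> c \<inter> A \<noteq> B))" for q R
  \<comment> \<open>If the exchange of \<open>Z \<subseteq> A\<close> for \<open>Y'\<close> were possible arbitrarily deep in \<open>F\<close>, then \<open>F\<close> with the
    extra condition \<open>c \<inter> Y' = q\<close> would be a smaller approximating filter.\<close>
  have "\<exists>R. W q R" if q: "q \<in> P'" for q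
  proof (rule ccontr)
    assume neg: "\<not> ?thesis"
    define G where "G = inf F (principal {c. c \<inter> Y' = q})"
    have evG: "eventually Q G \<longleftrightarrow> (\<forall>\<^sub>F c in F. c \<inter> Y' = q \<longrightarrow> Q c)" for Q
      by (simp add: G_def eventually_inf_principal)
    have "G \<noteq> bot" using q unfolding P'_def trivial_limit_def evG by (simp add: filter_patterns_def frequently_def)
    have "approximates k F0 G"
      unfolding approximates_def
    proof (intro conjI allI impI)
      show "G \<le> F0" using FF0 G_def inf.coboundedI1 by blast
      show "G \<noteq> bot" by fact
      fix Q assume "eventually Q G"
      then have R: "\<forall>\<^sub>F c in F. c \<inter> Y' = q \<longrightarrow> Q c" using evG by blast
      obtain A B Z where *: "finite A" "card A \<le> k" "\<forall>\<^sub>F c in F. c \<inter> A = B"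
        "\<forall>\<^sub>F c in F0. c \<inter> A = B \<longrightarrow> c \<inter> Y' = q \<longrightarrow> Q c" "Z \<subseteq> A" "card ((A - Z) \<union> Y') \<le> k"
        "\<not> (\<exists>\<^sub>F c in F0. c \<inter> (A - Z) = B - Z \<and> c \<inter> Y' = q \<and> c \<inter> A \<noteq> B)"
        using neg R unfolding W_def by blast
      have "\<forall>\<^sub>F c in G. c \<inter> (A - Z) = B - Z \<and> c \<inter> Y' = q"
        unfolding evG using *(3) by eventually_elim auto
      then obtain c0 where c0: "c0 \<inter> (A - Z) = B - Z" "c0 \<inter> Y' = q"
        using \<open>G \<noteq> bot\<close> eventually_happens' by blast
      have eq: "c \<inter> (A - Z) = B - Z \<and> c \<inter> Y' = q" if "c \<inter> ((A - Z) \<union> Y') = (B - Z) \<union> q" for c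
        using that c0 by auto
      show "\<exists>A B. finite A \<and> card A \<le> k \<and> (\<forall>\<^sub>F c in G. c \<inter> A = B) \<and>
          (\<forall>\<^sub>F c in F0. c \<inter> A = B \<longrightarrow> Q c)"
      proof (intro exI conjI)
        show "finite ((A - Z) \<union> Y')" "card ((A - Z) \<union> Y') \<le> k" using * finY' by auto
        show "\<forall>\<^sub>F c in G. c \<inter> ((A - Z) \<union> Y') = (B - Z) \<union> q"
          unfolding evG using *(3) by eventually_elim auto
        show "\<forall>\<^sub>F c in F0. c \<inter> ((A - Z) \<union> Y') = (B - Z) \<union> q \<longrightarrow> Q c"
          using *(4) *(7)[unfolded not_frequently] by eventually_elim (use eq in blast)
      qed
    qed
    then have "G = F" using min(2) by (simp add: G_def)
    \<comment> \<open>\<open>q'\<close> is frequent for \<open>F\<close> but excluded by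
      \<open>G\<close>.\<close>
    obtain q' where q': "q' \<in> P'" "q' \<noteq> q" using two[OF q] by auto
    have "\<forall>\<^sub>F c in F. c \<inter> Y' \<noteq> q'" using evG[of "\<lambda>c. c \<inter> Y' \<noteq> q'"] \<open>G = F\<close> q' by auto
    then show False using q'(1) by (simp add: P'_def filter_patterns_def frequently_def)
  qed
  then have "\<forall>q\<in>P'. \<exists>R. W q R" by blast
  from bchoice[OF this] obtain R where R: "\<And>q. q \<in> P' \<Longrightarrow> W q (R q)" by blast
  have "\<forall>\<^sub>F c in F. \<forall>q\<in>P'. R q c"
    using R finP' by (intro eventually_ball_finite) (auto simp: W_def)
  then obtain A B where AB: "finite A" "card A \<le> k" "\<forall>\<^sub>F c in F. c \<inter> A = B"
    "\<forall>\<^sub>F c in F0. c \<inter> A = B \<longrightarrow> (\<forall>q\<in>P'. R q c)"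
    by (rule approximatesE[OF min(1)])
  have exch: "\<exists>\<^sub>F c in F0. c \<inter> (A - Z) = B - Z \<and> c \<inter> Y' = q \<and> c \<inter> A \<noteq> B"
    if "q \<in> P'" "Z \<subseteq> A" "card ((A - Z) \<union> Y') \<le> k" for q Z
  proof -
    have "\<forall>\<^sub>F c in F0. c \<inter> A = B \<longrightarrow> R q c" using AB(4) by eventually_elim (use that in auto)
    then show ?thesis using R[OF that(1)] that(2,3) AB(1-3) unfolding W_def by blast
  qed
  obtain c1 where c1: "c1 \<inter> A = B" using AB(3) Fbot eventually_happens' by blast
  \<comment> \<open>A point of \<open>A\<close> that is bad for no \<open>q\<close> doubles the patterns on \<open>Y'\<close>, hence exceeds the bound
    on a set of \<open>x\<close> points.\<close>
  define bad where "bad q = {w \<in> A. \<forall>\<^sub>F c in F0. c \<inter> Y' = q \<longrightarrow> (w \<in> c \<longleftrightarrow> w \<in> B)}" for q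
  \<comment> \<open>\<open>x - 1 + (1 - (x - 1))\<close> is the maximum of \<open>x - 1\<close> and
    1; the strict bound thus makes sense also for \<open>x = 1\<close>, where \<open>Y'\<close> is
    empty.\<close>
  have bad: "card (bad q) < x - 1 + (1 - (x - 1)) \<and> card A > k - (x - 1)" if q: "q \<in> P'" for q
  proof -
    \<comment> \<open>Points of \<open>bad q\<close> may be dropped from \<open>A\<close>, as the
      trace \<open>q\<close> determines the answer there; the exchange would then recover the
      prescription \<open>B\<close>.\<close>
    have no: False if Z: "Z \<subseteq> bad q" "card ((A - Z) \<union> Y') \<le> k" for Z
    proof -
      have ZA: "Z \<subseteq> A" using Z by (auto simp: bad_def)
      then have "finite Z" using AB(1) finite_subset by blast
      have "\<forall>\<^sub>F c in F0. \<forall>w\<in>Z. c \<inter> Y' = q \<longrightarrow> (w \<in> c \<longleftrightarrow> w \<in> B)"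
        using Z \<open>finite Z\<close> by (intro eventually_ball_finite) (auto simp: bad_def)
      from frequently_eventually_conj[OF exch[OF q ZA Z(2)] this]
      obtain c where "c \<inter> (A - Z) = B - Z" "c \<inter> Y' = q" "c \<inter> A \<noteq> B"
        "\<forall>w\<in>Z. w \<in> c \<longleftrightarrow> w \<in> B" by (auto dest!: frequently_ex)
      then show False using c1 ZA by auto
    qed
    have "card A > k - (x - 1)"
    proof (rule ccontr)
      assume "\<not> ?thesis"
      then have "card A + (x - 1) \<le> k" using k y(1) cardY' by (cases x) auto
      then have "card ((A - {}) \<union> Y') \<le> k" using card_Un_le[of A Y'] cardY' by simp
      then show False using no[of "{}"] by simp
    qed
    moreover have "card (bad q) < x - 1 + (1 - (x - 1))"
    proof (rule ccontr)
      assume "\<not> ?thesis"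
      then have "x - 1 \<le> card (bad q)" by linarith
      then obtain Z where Z: "Z \<subseteq> bad q" "card Z = x - 1"
        using obtain_subset_with_card_n[of "x - 1" "bad q"] by metis
      then have ZA: "Z \<subseteq> A" by (auto simp: bad_def)
      have "card (A - Z) = card A - (x - 1)"
        using card_Diff_subset[of Z A] ZA Z(2) AB(1) finite_subset by metis
      then have "card ((A - Z) \<union> Y') \<le> card A - (x - 1) + (x - 1)"
        using card_Un_le[of "A - Z" Y'] cardY' by simp
      also have "\<dots> \<le> k" using AB(2) Z ZA card_mono[OF AB(1) ZA] by linarith
      finally show False using no Z by blast
    qed
    ultimately show ?thesis by blast
  qed
  obtain q0 where "q0 \<in> P'" using filter_patterns_nonempty[OF Fbot finY'] by (auto simp: P'_def)
  have "card (\<Union>q\<in>P'. bad q) \<le> (\<Sum>q\<in>P'. card (bad q))" by (rule card_UN_le[OF finP'])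
  also have "\<dots> \<le> (\<Sum>q\<in>P'. x)"
  proof (rule sum_mono)
    fix q assume "q \<in> P'"
    then show "card (bad q) \<le> x" using bad[of q] cardY' by linarith
  qed
  also have "\<dots> \<le> Suc y * x" using mult_le_mono1[OF \<open>card P' \<le> Suc y\<close>, of x] by simp
  also have "\<dots> < card A"
  proof -
    have "Suc y * x + x \<le> k" using k by (simp add: algebra_simps)
    then show ?thesis using bad[OF \<open>q0 \<in> P'\<close>] cardY' by linarith
  qed
  finally have less: "card (\<Union>q\<in>P'. bad q) < card A" .
  have "\<not> A \<subseteq> (\<Union>q\<in>P'. bad q)"
  proof
    assume "A \<subseteq> (\<Union>q\<in>P'. bad q)"
    moreover have "finite (\<Union>q\<in>P'. bad q)" using finP' AB(1) by (auto simp: bad_def)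
    ultimately show False using card_mono less by (metis not_less)
  qed
  then obtain w where w: "w \<in> A" "\<And>q. q \<in> P' \<Longrightarrow> w \<notin> bad q" by blast
  \<comment> \<open>Outside \<open>bad q\<close> both answers at \<open>w\<close> occur: the one
    opposite to \<open>B\<close> by the choice of \<open>w\<close>, the other because almost all
    members for \<open>F\<close> have trace \<open>B\<close> on \<open>A\<close>.\<close>
  have wdiff: "\<exists>\<^sub>F c in F0. c \<inter> Y' = q \<and> (w \<in> c) \<noteq> (w \<in> B)" if "q \<in> P'" for q
    using w(1) w(2)[OF that] by (auto simp: bad_def not_eventually)
  have wsame: "\<exists>\<^sub>F c in F. c \<inter> Y' = q \<and> (w \<in> c) = (w \<in> B)" if "q \<in> P'" for q
  proof -
    have "\<forall>\<^sub>F c in F. (w \<in> c) = (w \<in> B)" using AB(3) by eventually_elim (use w(1) in auto)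
    moreover have "\<exists>\<^sub>F c in F. c \<inter> Y' = q" using that by (simp add: P'_def filter_patterns_def)
    ultimately show ?thesis by (rule frequently_eventually_frequently[rotated])
  qed
  have wY: "w \<notin> Y'"
  proof
    assume "w \<in> Y'"
    obtain c c' where "c \<inter> Y' = q0" "(w \<in> c) \<noteq> (w \<in> B)" "c' \<inter> Y' = q0" "(w \<in> c') = (w \<in> B)"
      using frequently_ex[OF wdiff[OF \<open>q0 \<in> P'\<close>]] frequently_ex[OF wsame[OF \<open>q0 \<in> P'\<close>]] by blast
    then show False using \<open>w \<in> Y'\<close> by auto
  qed
  have "q \<in> filter_patterns F0 (insert w Y') \<and> insert w q \<in> filter_patterns F0 (insert w Y')"
    if q: "q \<in> P'" for q
  proof -
    have same: "\<exists>\<^sub>F c in F0. c \<inter> Y' = q \<and> (w \<in> c) = (w \<in> B)"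
      by (rule frequently_filter_mono[OF FF0 wsame[OF q]])
    have "\<exists>\<^sub>F c in F0. c \<inter> Y' = q \<and> w \<notin> c" "\<exists>\<^sub>F c in F0. c \<inter> Y' = q \<and> w \<in> c"
      using same wdiff[OF q] by (cases "w \<in> B"; simp)+
    then show ?thesis unfolding filter_patterns_def by (auto elim: frequently_elim1)
  qed
  then have sub: "P' \<union> insert w ` P' \<subseteq> filter_patterns F0 (insert w Y')" by auto
  have wq: "w \<notin> q" if "q \<in> P'" for q using that filter_patterns_subset[of F Y'] wY by (auto simp: P'_def)
  have "inj_on (insert w) P'"
  proof (rule inj_onI)
    fix q q' assume "q \<in> P'" "q' \<in> P'" "insert w q = insert w q'"
    then show "q = q'" using insert_ident[OF wq[of q] wq[of q']] by simp
  qed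
  then have "card (P' \<union> insert w ` P') = 2 * card P'"
    using wq finP' by (subst card_Un_disjoint) (auto simp: card_image)
  then have "2 * card P' \<le> card (filter_patterns F0 (insert w Y'))"
    using card_mono[OF finite_filter_patterns[of "insert w Y'"] sub] finY' by simp
  also have "\<dots> \<le> Suc y" using bd finY' wY cardY' by (auto simp: pattern_bound_def)
  finally show False using cP' by simp
qed

lemma pattern_bound_one_exists:
  assumes "F0 \<noteq> bot" "pattern_bound F0 x y" "1 \<le> y" "y < 2 ^ x"
  shows "\<exists>k F. approximates k F0 F \<and> pattern_bound F x 1"
  using assms
proof (induction y arbitrary: F0)
  case (Suc y)
  show ?case
  proof (cases "y = 0")
    case True
    then show ?thesis using Suc.prems approximates_refl[of F0 0] by auto
  next
    case False
    obtain F where F: "approximates ((Suc y + 1) * x) F0 F"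
      "\<And>G. approximates ((Suc y + 1) * x) F0 G \<Longrightarrow> G \<le> F \<Longrightarrow> G = F"
      using approximates_minimal[OF Suc.prems(1)] by blast
    have "pattern_bound F x y"
      by (rule pattern_bound_step[OF F Suc.prems(2)]) (use False Suc.prems in auto)
    then obtain k G where "approximates k F G" "pattern_bound G x 1"
      using Suc.IH[of F] Suc.prems False F(1) by (auto simp: approximates_def)
    then show ?thesis using approximates_trans[OF F(1)] by blast
  qed
qed simp

text \<open>From the principal filter of \<open>C\<close>, the iteration reaches a filter with one
  trace on each set of \<open>x\<close> points. It decides every point, and \<open>r\<close> is its
  limit; \<open>r\<close> agrees with members of \<open>C\<close> on finite sets but need not belong
  to \<open>C\<close>.\<close>

theorem compressible_concept_exists:
  fixes C :: "'a set set"
  assumes "C \<noteq> {}" and inf: "infinite (UNIV :: 'a set)"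
    and vc: "\<And>X. finite X \<Longrightarrow> card X = x \<Longrightarrow> \<exists>Y\<subseteq>X. \<forall>c\<in>C. c \<inter> X \<noteq> Y"
  shows "\<exists>r k. \<forall>A0. finite A0 \<longrightarrow> (\<exists>c\<in>C. c \<inter> A0 = r \<inter> A0) \<and>
    (\<exists>A. finite A \<and> card A \<le> k \<and> (\<forall>c\<in>C. c \<inter> A = r \<inter> A \<longrightarrow> c \<inter> A0 = r \<inter> A0))"
proof -
  have "x \<noteq> 0" using vc[of "{}"] \<open>C \<noteq> {}\<close> by auto
  have bd: "pattern_bound (principal C) x (2 ^ x - 1)"
    unfolding pattern_bound_def
  proof (intro allI impI)
    fix X :: "'a set" assume X: "finite X \<and> card X = x"
    then obtain Y where "Y \<subseteq> X" "\<forall>c\<in>C. c \<inter> X \<noteq> Y" using vc by blast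
    then have "filter_patterns (principal C) X \<subseteq> Pow X - {Y}"
      using filter_patterns_subset[of "principal C" X]
      by (auto simp: filter_patterns_def frequently_def eventually_principal)
    then have "card (filter_patterns (principal C) X) \<le> card (Pow X - {Y})"
      using X by (intro card_mono) auto
    also have "\<dots> = 2 ^ x - 1" using X \<open>Y \<subseteq> X\<close> by (simp add: card_Pow card_Diff_singleton)
    finally show "card (filter_patterns (principal C) X) \<le> 2 ^ x - 1" .
  qed
  have "2 ^ 1 \<le> (2::nat) ^ x" using \<open>x \<noteq> 0\<close> by (intro power_increasing) auto
  then have "\<exists>k F. approximates k (principal C) F \<and> pattern_bound F x 1"
    using \<open>C \<noteq> {}\<close> by (intro pattern_bound_one_exists[OF _ bd]) (auto simp: principal_eq_bot_iff)
  then obtain k F where kF: "approximates k (principal C) F" "pattern_bound F x 1" by blast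
  then have "F \<noteq> bot" and FC: "F \<le> principal C" by (auto simp: approximates_def)
  define r where "r = {a. \<forall>\<^sub>F c in F. a \<in> c}"
  have r: "\<forall>\<^sub>F c in F. (a \<in> c \<longleftrightarrow> a \<in> r)" for a
  proof -
    \<comment> \<open>The bound concerns sets of exactly \<open>x\<close> points, so the single
      point is enlarged to such a set.\<close>
    obtain Y where Y: "a \<in> Y" "finite Y" "card Y = x"
    proof -
      obtain Z where "finite Z" "card Z = x - 1" "Z \<subseteq> UNIV - {a}"
        using infinite_arbitrarily_large[of "UNIV - {a}" "x - 1"] inf by auto
      then show ?thesis using that[of "insert a Z"] \<open>x \<noteq> 0\<close> by (auto simp: subset_Diff_insert)
    qed
    then have "card (filter_patterns F Y) \<le> Suc 0" using kF(2) by (simp add: pattern_bound_def)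
    then have "\<forall>Q\<in>filter_patterns F Y. \<forall>Q'\<in>filter_patterns F Y. Q = Q'"
      using card_le_Suc0_iff_eq[OF finite_filter_patterns[OF Y(2)]] by blast
    then obtain Q where "filter_patterns F Y \<subseteq> {Q}" by blast
    then have ev: "\<forall>\<^sub>F c in F. c \<inter> Y = Q"
      using eventually_in_filter_patterns[OF Y(2), of F] by (auto elim: eventually_mono)
    then have ev': "\<forall>\<^sub>F c in F. a \<in> c \<longleftrightarrow> a \<in> Q" by eventually_elim (use Y in auto)
    have "a \<in> r \<longleftrightarrow> a \<in> Q"
    proof
      assume "a \<in> r"
      then have "\<forall>\<^sub>F c in F. a \<in> c" by (simp add: r_def)
      with ev' have "\<forall>\<^sub>F c in F. a \<in> Q" by eventually_elim simp
      then show "a \<in> Q" using \<open>F \<noteq> bot\<close> by simp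
    next
      assume "a \<in> Q" then show "a \<in> r" using ev' by (simp add: r_def)
    qed
    then show ?thesis using ev' by simp
  qed
  have rA: "\<forall>\<^sub>F c in F. c \<inter> A0 = r \<inter> A0" if "finite A0" for A0
  proof -
    have "\<forall>\<^sub>F c in F. \<forall>a\<in>A0. a \<in> c \<longleftrightarrow> a \<in> r" using r that by (intro eventually_ball_finite) auto
    then show ?thesis by eventually_elim auto
  qed
  show ?thesis
  proof (rule exI[of _ r], rule exI[of _ k], intro allI impI conjI)
    fix A0 :: "'a set" assume fin: "finite A0"
    obtain A B where AB: "finite A" "card A \<le> k" "\<forall>\<^sub>F c in F. c \<inter> A = B"
      "\<forall>c\<in>C. c \<inter> A = B \<longrightarrow> c \<inter> A0 = r \<inter> A0"
      by (rule approximatesE[OF kF(1) rA[OF fin]]) (simp add: eventually_principal)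
    have "\<forall>\<^sub>F c in F. B = r \<inter> A" using AB(3) rA[OF AB(1)] by eventually_elim auto
    then have "B = r \<inter> A" using \<open>F \<noteq> bot\<close> by simp
    then show "\<exists>A. finite A \<and> card A \<le> k \<and> (\<forall>c\<in>C. c \<inter> A = r \<inter> A \<longrightarrow> c \<inter> A0 = r \<inter> A0)"
      using AB by blast
    have "\<forall>\<^sub>F c in F. c \<in> C" using FC by (simp add: le_principal)
    then have "\<forall>\<^sub>F c in F. c \<in> C \<and> c \<inter> A0 = r \<inter> A0" using rA[OF fin] by (rule eventually_conj)
    then show "\<exists>c\<in>C. c \<inter> A0 = r \<inter> A0"
      using eventually_happens'[OF \<open>F \<noteq> bot\<close>] by blast
  qed
qed

section \<open>Strongly compressible extensions\<close>

text \<open>A list of instances with prescribed signs as one formula: \<open>s\<close> is part of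
  the formula and only the instances are parameters. It serves the teaching sets and, later, the
  chains of definable sets.\<close>

lemma fms_signs:
  assumes "univ U \<noteq> {}" "\<phi> \<in> fms L (n + m)"
  shows "\<exists>\<chi>\<in>fms L (n + length s * m). \<forall>x\<in>tuples (univ U) n. \<forall>as.
    length as = length s \<and> set as \<subseteq> tuples (univ U) m \<longrightarrow>
    (holds U \<chi> (x @ concat as) \<longleftrightarrow> list_all2 (\<lambda>a t. holds U \<phi> (x @ a) \<longleftrightarrow> t) as s)"
proof (induction s)
  case Nil
  obtain \<chi> where "\<chi> \<in> fms L n" "\<forall>x\<in>tuples (univ U) n. holds U \<chi> x"
    using fdef_True[OF assms(1), of L n] unfolding fdef_def by blast
  then show ?case by (intro bexI[of _ \<chi>]) auto
next
  case (Cons t s)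
  then obtain \<chi> where \<chi>: "\<chi> \<in> fms L (n + length s * m)"
    "\<forall>x\<in>tuples (univ U) n. \<forall>as. length as = length s \<and> set as \<subseteq> tuples (univ U) m \<longrightarrow>
    (holds U \<chi> (x @ concat as) \<longleftrightarrow> list_all2 (\<lambda>a t. holds U \<phi> (x @ a) \<longleftrightarrow> t) as s)" by blast
  let ?\<phi> = "if t then \<phi> else Neg \<phi>"
  have \<phi>: "?\<phi> \<in> fms L (n + m)" using assms(2) by (simp add: fms_def)
  obtain \<xi> where \<xi>: "\<xi> \<in> fms L (n + (m + length s * m))"
    "\<forall>x\<in>tuples (univ U) n. \<forall>a\<in>tuples (univ U) m. \<forall>c\<in>tuples (univ U) (length s * m).
       holds U \<xi> (x @ a @ c) \<longleftrightarrow> holds U ?\<phi> (x @ a) \<and> holds U \<chi> (x @ c)"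
    using fms_conj[OF \<phi> \<chi>(1), of U] by blast
  show ?case
  proof (intro bexI ballI allI impI)
    show "\<xi> \<in> fms L (n + length (t # s) * m)" using \<xi>(1) by (simp add: add.assoc)
    fix x as assume x: "x \<in> tuples (univ U) n"
      and as: "length as = length (t # s) \<and> set as \<subseteq> tuples (univ U) m"
    then obtain a as' where as': "as = a # as'" "a \<in> tuples (univ U) m" "length as' = length s"
      "set as' \<subseteq> tuples (univ U) m" by (cases as) auto
    have "concat as' \<in> tuples (univ U) (length s * m)"
      using concat_in_tuples[of as' "univ U" m] as' by auto
    then have "holds U \<xi> (x @ concat as) \<longleftrightarrow> holds U ?\<phi> (x @ a) \<and> holds U \<chi> (x @ concat as')"
      using \<xi>(2) x as' by simp
    also have "\<dots> \<longleftrightarrow> (holds U \<phi> (x @ a) \<longleftrightarrow> t) \<and>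
        list_all2 (\<lambda>a t. holds U \<phi> (x @ a) \<longleftrightarrow> t) as' s"
      using \<chi>(2) x as' by (auto simp: holds_Neg)
    finally show "holds U \<xi> (x @ concat as) \<longleftrightarrow>
        list_all2 (\<lambda>a t. holds U \<phi> (x @ a) \<longleftrightarrow> t) as (t # s)" by (simp add: as'(1))
  qed
qed

text \<open>If no \<open>s\<close> worked for all finite sets, the union of one counterexample per
  \<open>s\<close> would be a finite set for which no \<open>s\<close> works.\<close>

lemma directed_pigeonhole:
  assumes "finite S" "\<And>F. finite F \<Longrightarrow> F \<subseteq> X \<Longrightarrow> \<exists>s\<in>S. P s F"
    and anti: "\<And>s F F'. P s F \<Longrightarrow> F' \<subseteq> F \<Longrightarrow> P s F'"
  shows "\<exists>s\<in>S. \<forall>F. finite F \<and> F \<subseteq> X \<longrightarrow> P s F"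
proof (rule ccontr)
  assume "\<not> ?thesis"
  then have "\<forall>s\<in>S. \<exists>F. finite F \<and> F \<subseteq> X \<and> \<not> P s F" by blast
  from bchoice[OF this] obtain F where F: "\<forall>s\<in>S. finite (F s) \<and> F s \<subseteq> X \<and> \<not> P s (F s)" by blast
  then have "finite (\<Union>s\<in>S. F s)" "(\<Union>s\<in>S. F s) \<subseteq> X" using assms(1) by auto
  then obtain s where "s \<in> S" "P s (\<Union>s\<in>S. F s)" using assms(2) by blast
  then show False using anti[of s "\<Union>s\<in>S. F s" "F s"] F by blast
qed

text \<open>Points and sets change roles: the parameters are the points and each \<open>x\<close>
  gives a set. NIP covers every formula, in particular the one with the two groups of variables
  exchanged.\<close>

lemma NIP_swapped:
  assumes "NIP L U" "\<phi> \<in> fms L (n + m)"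
  shows "\<exists>d. \<forall>X. finite X \<and> X \<subseteq> tuples (univ U) m \<and>
    (\<forall>Y\<subseteq>X. \<exists>x\<in>tuples (univ U) n. \<forall>a\<in>X. holds U \<phi> (x @ a) \<longleftrightarrow> a \<in> Y) \<longrightarrow> card X \<le> d"
proof -
  have "fdef L U (m + n) (\<lambda>v. holds U \<phi> (slice v m n @ slice v 0 m))"
    using assms(2) by (intro fdef_slices) auto
  then obtain \<psi> where \<psi>: "\<psi> \<in> fms L (m + n)"
    "\<forall>v\<in>tuples (univ U) (m + n). holds U \<psi> v \<longleftrightarrow> holds U \<phi> (slice v m n @ slice v 0 m)"
    unfolding fdef_def by blast
  have eq: "holds U \<psi> (a @ x) \<longleftrightarrow> holds U \<phi> (x @ a)"
    if "a \<in> tuples (univ U) m" "x \<in> tuples (univ U) n" for a x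
    using \<psi>(2)[rule_format, OF tuples_append[OF that]] that by (simp add: slice_def tuples_def)
  let ?F = "(\<lambda>b. {a \<in> tuples (univ U) m. holds U \<psi> (a @ b)}) ` tuples (univ U) n"
  have "finite_VC_dim ?F" using assms(1) \<psi>(1) unfolding NIP_def by blast
  then obtain d where d: "\<forall>X. finite X \<and> shatters ?F X \<longrightarrow> card X \<le> d"
    unfolding finite_VC_dim_def by blast
  show ?thesis
  proof (intro exI[of _ d] allI impI, elim conjE)
    fix X assume X: "finite X" "X \<subseteq> tuples (univ U) m"
      and sh: "\<forall>Y\<subseteq>X. \<exists>x\<in>tuples (univ U) n. \<forall>a\<in>X. holds U \<phi> (x @ a) \<longleftrightarrow> a \<in> Y"
    have "shatters ?F X"
      unfolding shatters_def
    proof (intro allI impI)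
      fix Y assume "Y \<subseteq> X"
      then obtain x where x: "x \<in> tuples (univ U) n" "\<forall>a\<in>X. holds U \<phi> (x @ a) \<longleftrightarrow> a \<in> Y"
        using sh by blast
      then have "{a \<in> tuples (univ U) m. holds U \<psi> (a @ x)} \<inter> X = Y"
        using X(2) eq \<open>Y \<subseteq> X\<close> by blast
      then show "\<exists>S\<in>?F. S \<inter> X = Y" using x(1) by blast
    qed
    then show "card X \<le> d" using d X(1) by blast
  qed
qed

section \<open>Compressible partial types and their completion\<close>

context monster_model
begin

text \<open>Strong compressibility of a partial type as a whole; restrictions of the type built
  later to suitable finite \<Delta> have this property.\<close>

definition compressible_partial :: "nat \<Rightarrow> 'u set \<Rightarrow> ('f, 'r, 'u) pfm set \<Rightarrow> bool" where
  "compressible_partial n A \<Phi> \<longleftrightarrow> (\<exists>k. \<exists>\<zeta>\<in>fms L (n + k). \<forall>\<Phi>0. finite \<Phi>0 \<and> \<Phi>0 \<subseteq> \<Phi> \<longrightarrow>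
     (\<exists>c\<in>tuples A k. entails U n \<Phi> {(\<zeta>, c)} \<and> entails U n {(\<zeta>, c)} \<Phi>0))"

text \<open>A directed family of instances of one formula is compressed by that formula itself.
  Directedness concerns nonempty finite sets only, so \<open>S\<close> may be empty, as can happen
  for the upper half of a cut.\<close>

lemma compressible_partial_directed:
  assumes "\<gamma> \<in> fms L (n + m)" "S \<subseteq> tuples A m"
    and dir: "\<And>F. finite F \<Longrightarrow> F \<subseteq> S \<Longrightarrow> F \<noteq> {} \<Longrightarrow>
      \<exists>c\<in>S. \<forall>x\<in>tuples (univ U) n. holds U \<gamma> (x @ c) \<longrightarrow> (\<forall>c'\<in>F. holds U \<gamma> (x @ c'))"
  shows "compressible_partial n A ((\<lambda>c. (\<gamma>, c)) ` S)"
proof (cases "S = {}")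
  case True
  obtain \<chi> where "\<chi> \<in> fms L n" "\<forall>x\<in>tuples (univ U) n. holds U \<chi> x"
    using fdef_True[OF nonempty, of L n] unfolding fdef_def by blast
  then show ?thesis
    unfolding compressible_partial_def True
    by (intro exI[of _ 0] bexI[of _ \<chi>])
       (auto simp: entails_def realises_insert realises_empty tuples_def)
next
  case False
  show ?thesis
    unfolding compressible_partial_def
  proof (intro exI[of _ m] bexI[of _ \<gamma>] allI impI, elim conjE)
    fix \<Phi>0 assume fin: "finite \<Phi>0" and sub: "\<Phi>0 \<subseteq> (\<lambda>c. (\<gamma>, c)) ` S"
    obtain s where s: "s \<in> S" using False by blast
    let ?F = "insert s (snd ` \<Phi>0)"
    have "?F \<subseteq> S" using sub s by auto
    then obtain c where c: "c \<in> S"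
      "\<forall>x\<in>tuples (univ U) n. holds U \<gamma> (x @ c) \<longrightarrow> (\<forall>c'\<in>?F. holds U \<gamma> (x @ c'))"
      using dir[of ?F] fin by auto
    have "entails U n ((\<lambda>c. (\<gamma>, c)) ` S) {(\<gamma>, c)}"
      using c(1) by (auto simp: entails_def realises_def)
    moreover have "entails U n {(\<gamma>, c)} \<Phi>0"
      unfolding entails_def realises_def using c(2) sub by fastforce
    ultimately show "\<exists>c\<in>tuples A m. entails U n ((\<lambda>c. (\<gamma>, c)) ` S) {(\<gamma>, c)} \<and> entails U n {(\<gamma>, c)} \<Phi>0"
      using c(1) assms(2) by blast
  qed (rule assms(1))
qed

lemma compressible_partial_Un:
  assumes A: "A \<subseteq> univ U" and "compressible_partial n A \<Phi>" "compressible_partial n A \<Phi>'"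
  shows "compressible_partial n A (\<Phi> \<union> \<Phi>')"
proof -
  obtain k \<zeta> where \<zeta>: "\<zeta> \<in> fms L (n + k)" "\<forall>\<Phi>0. finite \<Phi>0 \<and> \<Phi>0 \<subseteq> \<Phi> \<longrightarrow>
     (\<exists>c\<in>tuples A k. entails U n \<Phi> {(\<zeta>, c)} \<and> entails U n {(\<zeta>, c)} \<Phi>0)"
    using assms(2) unfolding compressible_partial_def by blast
  obtain l \<eta> where \<eta>: "\<eta> \<in> fms L (n + l)" "\<forall>\<Phi>0. finite \<Phi>0 \<and> \<Phi>0 \<subseteq> \<Phi>' \<longrightarrow>
     (\<exists>c\<in>tuples A l. entails U n \<Phi>' {(\<eta>, c)} \<and> entails U n {(\<eta>, c)} \<Phi>0)"
    using assms(3) unfolding compressible_partial_def by blast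
  obtain \<xi> where \<xi>: "\<xi> \<in> fms L (n + (k + l))"
    "\<forall>x\<in>tuples (univ U) n. \<forall>a\<in>tuples (univ U) k. \<forall>c\<in>tuples (univ U) l.
       holds U \<xi> (x @ a @ c) \<longleftrightarrow> holds U \<zeta> (x @ a) \<and> holds U \<eta> (x @ c)"
    using fms_conj[OF \<zeta>(1) \<eta>(1), of U] by blast
  show ?thesis
    unfolding compressible_partial_def
  proof (intro exI[of _ "k + l"] bexI[of _ \<xi>] allI impI, elim conjE)
    fix \<Phi>0 assume fin: "finite \<Phi>0" and sub: "\<Phi>0 \<subseteq> \<Phi> \<union> \<Phi>'"
    obtain c where c: "c \<in> tuples A k" "entails U n \<Phi> {(\<zeta>, c)}" "entails U n {(\<zeta>, c)} (\<Phi>0 \<inter> \<Phi>)"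
      using \<zeta>(2) fin by (meson finite_Int inf_le2)
    obtain d where d: "d \<in> tuples A l" "entails U n \<Phi>' {(\<eta>, d)}" "entails U n {(\<eta>, d)} (\<Phi>0 \<inter> \<Phi>')"
      using \<eta>(2) fin by (meson finite_Int inf_le2)
    have iff: "realises U x {(\<xi>, c @ d)} \<longleftrightarrow> realises U x {(\<zeta>, c)} \<and> realises U x {(\<eta>, d)}"
      if "x \<in> tuples (univ U) n" for x
    proof -
      have "c \<in> tuples (univ U) k" "d \<in> tuples (univ U) l" using c(1) d(1) tuples_mono[OF A] by blast+
      then show ?thesis using \<xi>(2) that by (simp add: realises_insert realises_empty)
    qed
    have "entails U n (\<Phi> \<union> \<Phi>') {(\<xi>, c @ d)}"
      using c(2) d(2) iff unfolding entails_def realises_Un by blast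
    moreover have "entails U n {(\<xi>, c @ d)} \<Phi>0"
      unfolding entails_def
    proof (intro ballI impI)
      fix x assume x: "x \<in> tuples (univ U) n" "realises U x {(\<xi>, c @ d)}"
      then have "realises U x (\<Phi>0 \<inter> \<Phi> \<union> \<Phi>0 \<inter> \<Phi>')"
        using c(3) d(3) iff unfolding entails_def realises_Un by blast
      then show "realises U x \<Phi>0" by (rule realises_mono) (use sub in blast)
    qed
    ultimately show "\<exists>c\<in>tuples A (k + l). entails U n (\<Phi> \<union> \<Phi>') {(\<xi>, c)} \<and> entails U n {(\<xi>, c)} \<Phi>0"
      using tuples_append[OF c(1) d(1)] by blast
  qed (rule \<xi>(1))
qed

definition decide :: "nat \<Rightarrow> 'u set \<Rightarrow> ('f, 'r) fm \<Rightarrow> 'u list set \<Rightarrow> ('f, 'r, 'u) pfm set" where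
  "decide m A \<phi> r = (\<lambda>a. (if a \<in> r then \<phi> else Neg \<phi>, a)) ` tuples A m"

lemma realises_decide:
  "realises U x (decide m A \<phi> r) \<longleftrightarrow> (\<forall>a\<in>tuples A m. holds U \<phi> (x @ a) \<longleftrightarrow> a \<in> r)"
  unfolding decide_def realises_def by (auto simp: holds_Neg)

lemma decide_pfms: "\<phi> \<in> fms L (n + m) \<Longrightarrow> decide m A \<phi> r \<subseteq> pfms L n A"
  by (auto simp: decide_def pfms_def tuples_def fms_def split: if_splits)

text \<open>The traces on \<open>A\<close> of the realisations of \<Phi> form a system without large
  shattered sets, and its limit concept \<open>r\<close> is the required \<phi>-type. Finite
  satisfiability holds as traces approximate \<open>r\<close> on finite sets; compression combines a
  formula compressing \<Phi> with the teaching sets of \<open>r\<close>.\<close>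

lemma compressible_partial_decide:
  assumes A: "small U A" and nip: "NIP L U" and \<Phi>: "\<Phi> \<subseteq> pfms L n A" "finsat U n \<Phi>"
    and comp: "compressible_partial n A \<Phi>" and \<phi>: "\<phi> \<in> fms L (n + m)"
  shows "\<exists>r. finsat U n (\<Phi> \<union> decide m A \<phi> r) \<and> compressible_partial n A (\<Phi> \<union> decide m A \<phi> r)"
proof -
  have AU: "A \<subseteq> univ U" "A \<prec> univ U" using A by (auto simp: small_def)
  have tupU: "a \<in> tuples (univ U) m" if "a \<in> tuples A m" for a using that tuples_mono[OF AU(1)] by blast
  define tr where "tr x = {a \<in> tuples A m. holds U \<phi> (x @ a)}" for x
  define C where "C = tr ` {x \<in> tuples (univ U) n. realises U x \<Phi>}"
  obtain b0 where "b0 \<in> tuples (univ U) n" "realises U b0 \<Phi>"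
    by (rule saturated_realises[OF saturated[unfolded saturated_def] AU \<Phi>])
  then have "C \<noteq> {}" by (auto simp: C_def)
  have inf: "infinite (UNIV :: 'u list set)" by (rule infinite_UNIV_listI)
  obtain d where d: "\<forall>X. finite X \<and> X \<subseteq> tuples (univ U) m \<and>
    (\<forall>Y\<subseteq>X. \<exists>x\<in>tuples (univ U) n. \<forall>a\<in>X. holds U \<phi> (x @ a) \<longleftrightarrow> a \<in> Y) \<longrightarrow> card X \<le> d"
    using NIP_swapped[OF nip \<phi>] by blast
  have vc: "\<exists>Y\<subseteq>X. \<forall>c\<in>C. c \<inter> X \<noteq> Y" if X: "finite X" "card X = Suc d" for X
  proof (rule ccontr)
    assume "\<not> ?thesis"
    then have sh: "\<forall>Y\<subseteq>X. \<exists>c\<in>C. c \<inter> X = Y" by blast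
    \<comment> \<open>\<open>X\<close> itself is cut out by some trace, so it lies in
      \<open>tuples A m\<close>.\<close>
    then obtain c where "c \<in> C" "c \<inter> X = X" by blast
    then have XA: "X \<subseteq> tuples A m" by (auto simp: C_def tr_def)
    have "\<exists>x\<in>tuples (univ U) n. \<forall>a\<in>X. holds U \<phi> (x @ a) \<longleftrightarrow> a \<in> Y" if Y: "Y \<subseteq> X" for Y
    proof -
      obtain x where x: "x \<in> tuples (univ U) n" "tr x \<inter> X = Y"
        using sh[rule_format, OF Y] by (auto simp: C_def)
      then have "\<forall>a\<in>X. holds U \<phi> (x @ a) \<longleftrightarrow> a \<in> Y" using XA by (auto simp: tr_def)
      then show ?thesis using x(1) by blast
    qed
    moreover have "X \<subseteq> tuples (univ U) m" using XA tupU by blast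
    ultimately have "card X \<le> d" using d X(1) by blast
    then show False using X(2) by simp
  qed
  have "\<exists>r k. \<forall>A0. finite A0 \<longrightarrow> (\<exists>c\<in>C. c \<inter> A0 = r \<inter> A0) \<and>
    (\<exists>A. finite A \<and> card A \<le> k \<and> (\<forall>c\<in>C. c \<inter> A = r \<inter> A \<longrightarrow> c \<inter> A0 = r \<inter> A0))"
    by (rule compressible_concept_exists[OF \<open>C \<noteq> {}\<close> inf, where x = "Suc d"]) (rule vc)
  then obtain r k where rk: "\<forall>A0. finite A0 \<longrightarrow> (\<exists>c\<in>C. c \<inter> A0 = r \<inter> A0) \<and>
    (\<exists>A. finite A \<and> card A \<le> k \<and> (\<forall>c\<in>C. c \<inter> A = r \<inter> A \<longrightarrow> c \<inter> A0 = r \<inter> A0))" by (elim exE)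
  have r: "\<exists>A1. finite A1 \<and> card A1 \<le> k \<and> (\<forall>c\<in>C. c \<inter> A1 = r \<inter> A1 \<longrightarrow> c \<inter> A0 = r \<inter> A0)"
    "\<exists>c\<in>C. c \<inter> A0 = r \<inter> A0" if "finite A0" for A0
    using rk that by simp_all
  have rA: "r \<subseteq> tuples A m"
  proof
    fix a assume "a \<in> r"
    obtain c where "c \<in> C" "c \<inter> {a} = r \<inter> {a}" using r(2)[of "{a}"] by auto
    then show "a \<in> tuples A m" using \<open>a \<in> r\<close> by (auto simp: C_def tr_def)
  qed
  let ?\<Phi> = "\<Phi> \<union> decide m A \<phi> r"
  have real: "realises U x \<Phi>0" if asm: "x \<in> tuples (univ U) n" "realises U x (\<Phi>0 \<inter> \<Phi>)"
    "tr x \<inter> snd ` \<Phi>0 = r \<inter> snd ` \<Phi>0" "\<Phi>0 \<subseteq> ?\<Phi>" for x \<Phi>0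
    unfolding realises_def
  proof (rule ballI)
    fix \<theta> assume \<theta>: "\<theta> \<in> \<Phi>0"
    show "case \<theta> of (\<phi>, a) \<Rightarrow> holds U \<phi> (x @ a)"
    proof (cases "\<theta> \<in> \<Phi>")
      case True
      then show ?thesis using asm(2) \<theta> unfolding realises_def by blast
    next
      case False
      then obtain a where a: "\<theta> = (if a \<in> r then \<phi> else Neg \<phi>, a)" "a \<in> tuples A m"
        using \<theta> asm(4) by (auto simp: decide_def)
      then have "a \<in> snd ` \<Phi>0" using \<theta> by force
      then have "a \<in> tr x \<longleftrightarrow> a \<in> r" using asm(3) by blast
      then show ?thesis using a by (auto simp: tr_def holds_Neg)
    qed
  qed
  have "finsat U n ?\<Phi>"
    unfolding finsat_def
  proof (intro allI impI, elim conjE)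
    fix \<Phi>0 assume fin: "finite \<Phi>0" and sub: "\<Phi>0 \<subseteq> ?\<Phi>"
    obtain c where "c \<in> C" "c \<inter> snd ` \<Phi>0 = r \<inter> snd ` \<Phi>0" using r(2)[of "snd ` \<Phi>0"] fin by auto
    then obtain x where x: "x \<in> tuples (univ U) n" "realises U x \<Phi>" "tr x \<inter> snd ` \<Phi>0 = r \<inter> snd ` \<Phi>0"
      by (auto simp: C_def)
    then show "\<exists>b\<in>tuples (univ U) n. realises U b \<Phi>0"
      using real[OF x(1) _ x(3) sub] realises_mono[OF x(2)] by blast
  qed
  moreover have "compressible_partial n A ?\<Phi>"
  proof -
    obtain k0 \<zeta>0 where \<zeta>0: "\<zeta>0 \<in> fms L (n + k0)" "\<forall>\<Phi>0. finite \<Phi>0 \<and> \<Phi>0 \<subseteq> \<Phi> \<longrightarrow>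
       (\<exists>c\<in>tuples A k0. entails U n \<Phi> {(\<zeta>0, c)} \<and> entails U n {(\<zeta>0, c)} \<Phi>0)"
      using comp unfolding compressible_partial_def by blast
    \<comment> \<open>The signs \<open>s\<close> of the teaching set depend on \<open>\<Phi>0\<close>; a single \<open>\<zeta>\<close> exists because there are
      only finitely many of them.\<close>
    define W where "W s \<Phi>0 \<longleftrightarrow> (\<exists>c\<in>tuples A k0. \<exists>as. s = map (\<lambda>a. a \<in> r) as \<and> set as \<subseteq> tuples A m \<and>
      entails U n \<Phi> {(\<zeta>0, c)} \<and> (\<forall>x\<in>tuples (univ U) n. holds U \<zeta>0 (x @ c) \<and>
        (\<forall>a\<in>set as. holds U \<phi> (x @ a) \<longleftrightarrow> a \<in> r) \<longrightarrow> realises U x \<Phi>0))" for s \<Phi>0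
    have "\<exists>s\<in>{s. set s \<subseteq> UNIV \<and> length s \<le> k}. \<forall>\<Phi>0. finite \<Phi>0 \<and> \<Phi>0 \<subseteq> ?\<Phi> \<longrightarrow> W s \<Phi>0"
    proof (rule directed_pigeonhole)
      show "finite {s. set s \<subseteq> (UNIV :: bool set) \<and> length s \<le> k}" by (rule finite_lists_length_le) simp
      show "W s F'" if "W s F" "F' \<subseteq> F" for s F F'
        using that realises_mono[OF _ that(2)] unfolding W_def by meson
      fix \<Phi>0 assume fin: "finite \<Phi>0" and sub: "\<Phi>0 \<subseteq> ?\<Phi>"
      obtain A1 where A1: "finite A1" "card A1 \<le> k"
        "\<forall>c\<in>C. c \<inter> A1 = r \<inter> A1 \<longrightarrow> c \<inter> snd ` \<Phi>0 = r \<inter> snd ` \<Phi>0"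
        using r(1)[of "snd ` \<Phi>0"] fin by auto
      \<comment> \<open>\<open>r\<close> and all traces are contained in \<open>tuples A m\<close>,
        so the points of \<open>A1\<close> outside distinguish nothing and are dropped.\<close>
      obtain as where as: "set as = A1 \<inter> tuples A m" "distinct as"
        using finite_distinct_list[of "A1 \<inter> tuples A m"] A1(1) by auto
      have "length as \<le> k"
        using A1(1,2) card_mono[of A1 "A1 \<inter> tuples A m"] distinct_card[OF as(2)] as(1) by auto
      define \<Omega> where "\<Omega> = (\<lambda>a. (if a \<in> r then \<phi> else Neg \<phi>, a)) ` set as"
      have real\<Omega>: "realises U x \<Omega> \<longleftrightarrow> (\<forall>a\<in>set as. holds U \<phi> (x @ a) \<longleftrightarrow> a \<in> r)" for x
        unfolding \<Omega>_def realises_def by (auto simp: holds_Neg)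
      have "\<Omega> \<subseteq> decide m A \<phi> r" unfolding \<Omega>_def decide_def using as(1) by auto
      then have \<Omega>: "\<Phi> \<union> \<Omega> \<subseteq> pfms L n A" using \<Phi>(1) decide_pfms[OF \<phi>] by blast
      have \<Phi>0: "\<Phi>0 \<subseteq> pfms L n A" using sub \<Phi>(1) decide_pfms[OF \<phi>] by blast
      have "entails U n (\<Phi> \<union> \<Omega>) \<Phi>0"
        unfolding entails_def realises_Un
      proof (intro ballI impI, elim conjE)
        fix x assume x: "x \<in> tuples (univ U) n" "realises U x \<Phi>" "realises U x \<Omega>"
        have "tr x \<inter> A1 = r \<inter> A1" using x(3) as(1) rA unfolding real\<Omega> tr_def by blast
        moreover have "tr x \<in> C" using x(1,2) by (auto simp: C_def)
        ultimately have "tr x \<inter> snd ` \<Phi>0 = r \<inter> snd ` \<Phi>0" using A1(3) by blast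
        then show "realises U x \<Phi>0" using real[OF x(1) realises_mono[OF x(2)] _ sub] by blast
      qed
      \<comment> \<open>\<open>\<zeta>0\<close> implies only finite parts of \<Phi>, so compactness
        has to select the finite part that is used.\<close>
      then obtain \<Theta> where \<Theta>: "finite \<Theta>" "\<Theta> \<subseteq> \<Phi> \<union> \<Omega>" "entails U n \<Theta> \<Phi>0"
        by (rule entails_finite[OF saturated A nonempty \<Omega> fin \<Phi>0])
      have "finite (\<Theta> \<inter> \<Phi>) \<and> \<Theta> \<inter> \<Phi> \<subseteq> \<Phi>" using \<Theta>(1) by simp
      then obtain c where c: "c \<in> tuples A k0" "entails U n \<Phi> {(\<zeta>0, c)}" "entails U n {(\<zeta>0, c)} (\<Theta> \<inter> \<Phi>)"
        using \<zeta>0(2) by blast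
      have "realises U x \<Phi>0" if x: "x \<in> tuples (univ U) n" "holds U \<zeta>0 (x @ c)"
        "\<forall>a\<in>set as. holds U \<phi> (x @ a) \<longleftrightarrow> a \<in> r" for x
      proof -
        have "realises U x (\<Theta> \<inter> \<Phi>)"
          using c(3) x(1,2) unfolding entails_def by (simp add: realises_insert realises_empty)
        then have "realises U x (\<Theta> \<inter> \<Phi> \<union> \<Omega>)" using x(3) real\<Omega> by (simp add: realises_Un)
        then have "realises U x \<Theta>" by (rule realises_mono) (use \<Theta>(2) in blast)
        then show ?thesis using \<Theta>(3) x(1) unfolding entails_def by blast
      qed
      then have "W (map (\<lambda>a. a \<in> r) as) \<Phi>0"
        unfolding W_def using c(1,2) as(1) by (intro bexI[of _ c] exI[of _ as]) auto
      then show "\<exists>s\<in>{s. set s \<subseteq> UNIV \<and> length s \<le> k}. W s \<Phi>0"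
        using \<open>length as \<le> k\<close> by (intro bexI[of _ "map (\<lambda>a. a \<in> r) as"]) auto
    qed
    then obtain s where s: "\<forall>\<Phi>0. finite \<Phi>0 \<and> \<Phi>0 \<subseteq> ?\<Phi> \<longrightarrow> W s \<Phi>0" by blast
    obtain \<chi> where \<chi>: "\<chi> \<in> fms L (n + length s * m)" "\<forall>x\<in>tuples (univ U) n. \<forall>as.
      length as = length s \<and> set as \<subseteq> tuples (univ U) m \<longrightarrow>
      (holds U \<chi> (x @ concat as) \<longleftrightarrow> list_all2 (\<lambda>a t. holds U \<phi> (x @ a) \<longleftrightarrow> t) as s)"
      using fms_signs[OF nonempty \<phi>, of s] by blast
    obtain \<xi> where \<xi>: "\<xi> \<in> fms L (n + (k0 + length s * m))"
      "\<forall>x\<in>tuples (univ U) n. \<forall>a\<in>tuples (univ U) k0. \<forall>c\<in>tuples (univ U) (length s * m).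
         holds U \<xi> (x @ a @ c) \<longleftrightarrow> holds U \<zeta>0 (x @ a) \<and> holds U \<chi> (x @ c)"
      using fms_conj[OF \<zeta>0(1) \<chi>(1), of U] by blast
    show ?thesis
      unfolding compressible_partial_def
    proof (intro exI[of _ "k0 + length s * m"] bexI[of _ \<xi>] allI impI)
      fix \<Phi>0 assume "finite \<Phi>0 \<and> \<Phi>0 \<subseteq> ?\<Phi>"
      then have "W s \<Phi>0" using s by blast
      then obtain c as where cas: "c \<in> tuples A k0" "s = map (\<lambda>a. a \<in> r) as" "set as \<subseteq> tuples A m"
        "entails U n \<Phi> {(\<zeta>0, c)}" "\<forall>x\<in>tuples (univ U) n. holds U \<zeta>0 (x @ c) \<and>
        (\<forall>a\<in>set as. holds U \<phi> (x @ a) \<longleftrightarrow> a \<in> r) \<longrightarrow> realises U x \<Phi>0"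
        unfolding W_def by blast
      have cat: "concat as \<in> tuples A (length s * m)"
        using concat_in_tuples[of as A m] cas(2,3) by auto
      have iff: "holds U \<xi> (x @ c @ concat as) \<longleftrightarrow> holds U \<zeta>0 (x @ c) \<and>
          (\<forall>a\<in>set as. holds U \<phi> (x @ a) \<longleftrightarrow> a \<in> r)" if x: "x \<in> tuples (univ U) n" for x
      proof -
        have "set as \<subseteq> tuples (univ U) m" using cas(3) tupU by blast
        then have "holds U \<chi> (x @ concat as) \<longleftrightarrow> (\<forall>a\<in>set as. holds U \<phi> (x @ a) \<longleftrightarrow> a \<in> r)"
          using \<chi>(2) x cas(2) by (simp add: list_all2_map2 list_all2_same)
        moreover have "c \<in> tuples (univ U) k0" "concat as \<in> tuples (univ U) (length s * m)"
          using cas(1) cat tuples_mono[OF AU(1)] by blast+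
        ultimately show ?thesis using \<xi>(2) x by simp
      qed
      have "entails U n ?\<Phi> {(\<xi>, c @ concat as)}"
        unfolding entails_def realises_Un realises_decide
      proof (intro ballI impI, elim conjE)
        fix x assume x: "x \<in> tuples (univ U) n" "realises U x \<Phi>" "\<forall>a\<in>tuples A m. holds U \<phi> (x @ a) \<longleftrightarrow> a \<in> r"
        then have "holds U \<zeta>0 (x @ c)" using cas(4) unfolding entails_def by (simp add: realises_insert)
        then show "realises U x {(\<xi>, c @ concat as)}"
          using iff[OF x(1)] x(3) cas(3) by (auto simp: realises_insert realises_empty)
      qed
      moreover have "entails U n {(\<xi>, c @ concat as)} \<Phi>0"
        unfolding entails_def using iff cas(5) by (auto simp: realises_insert)
      ultimately show "\<exists>c\<in>tuples A (k0 + length s * m).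
          entails U n ?\<Phi> {(\<xi>, c)} \<and> entails U n {(\<xi>, c)} \<Phi>0"
        using tuples_append[OF cas(1) cat] by blast
    qed (rule \<xi>(1))
  qed
  ultimately show ?thesis by blast
qed

text \<open>All partitioned formulas are enumerated and decided one per stage. The hypothesis on
  \<open>\<Delta>0\<close> says that \<Phi> uses finitely many formulas, so that it too lies in the
  restriction of the type to a finite set.\<close>

lemma exists_strongly_compressible:
  assumes A: "small U A" and nip: "NIP L U" and ctbl: "countable (part_fms L n)"
    and \<Phi>: "\<Phi> \<subseteq> pfms L n A" "finsat U n \<Phi>" "compressible_partial n A \<Phi>"
    and \<Delta>0: "finite \<Delta>0" "\<Delta>0 \<subseteq> part_fms L n" "\<And>\<phi> a. (\<phi>, a) \<in> \<Phi> \<Longrightarrow> (length a, \<phi>) \<in> \<Delta>0"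
  shows "\<exists>p\<in>types L U n A. \<Phi> \<subseteq> p \<and> strongly_compressible L U n A p"
proof -
  have "\<exists>\<phi>. \<phi> \<in> fms L n" using fdef_True[OF nonempty, of L n] by (auto simp: fdef_def)
  then have "part_fms L n \<noteq> {}" by (auto simp: part_fms_def intro: exI[of _ 0])
  define en where "en = from_nat_into (part_fms L n)"
  have en: "range en = part_fms L n"
    unfolding en_def using range_from_nat_into[OF \<open>part_fms L n \<noteq> {}\<close> ctbl] .
  have en_fms: "snd (en i) \<in> fms L (n + fst (en i))" for i
    using en by (auto simp: part_fms_def)
  define step where "step i \<Psi> r = \<Psi> \<union> decide (fst (en i)) A (snd (en i)) r" for i \<Psi> r
  have "\<exists>f. \<forall>i. ((f i \<subseteq> pfms L n A \<and> finsat U n (f i) \<and> compressible_partial n A (f i)) \<and>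
      (i = 0 \<longrightarrow> f i = \<Phi>)) \<and> (\<exists>r. f (Suc i) = step i (f i) r)"
  proof (rule dependent_nat_choice)
    show "\<exists>x. (x \<subseteq> pfms L n A \<and> finsat U n x \<and> compressible_partial n A x) \<and> (0 = 0 \<longrightarrow> x = \<Phi>)"
      using \<Phi> by blast
    fix x and i :: nat assume x: "(x \<subseteq> pfms L n A \<and> finsat U n x \<and> compressible_partial n A x) \<and> (i = 0 \<longrightarrow> x = \<Phi>)"
    then obtain r where "finsat U n (step i x r)" "compressible_partial n A (step i x r)"
      using compressible_partial_decide[OF A nip _ _ _ en_fms] unfolding step_def by blast
    moreover have "step i x r \<subseteq> pfms L n A" using x decide_pfms[OF en_fms] by (simp add: step_def)
    ultimately show "\<exists>y. ((y \<subseteq> pfms L n A \<and> finsat U n y \<and> compressible_partial n A y) \<and>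
        (Suc i = 0 \<longrightarrow> y = \<Phi>)) \<and> (\<exists>r. y = step i x r)" by blast
  qed
  then obtain f :: "nat \<Rightarrow> ('f, 'r, 'u) pfm set" where
    f0: "\<forall>i. ((f i \<subseteq> pfms L n A \<and> finsat U n (f i) \<and> compressible_partial n A (f i)) \<and>
      (i = 0 \<longrightarrow> f i = \<Phi>)) \<and> (\<exists>r. f (Suc i) = step i (f i) r)" by (elim exE)
  then have f: "f i \<subseteq> pfms L n A" "finsat U n (f i)" "compressible_partial n A (f i)" "f 0 = \<Phi>"
    for i by simp_all
  from f0 have "\<forall>i. \<exists>r. f (Suc i) = step i (f i) r" by simp
  from choice[OF this] obtain r where r: "\<And>i. f (Suc i) = step i (f i) (r i)" by blast
  have mono: "f i \<subseteq> f j" if "i \<le> j" for i j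
    using that by (rule lift_Suc_mono_le[rotated]) (auto simp: r step_def)
  define p where "p = (\<Union>i. f i)"
  have dec: "(\<phi>, a) \<in> f (Suc i) \<or> (Neg \<phi>, a) \<in> f (Suc i)" if "en i = (m, \<phi>)" "a \<in> tuples A m" for i m \<phi> a
  proof -
    have "(if a \<in> r i then \<phi> else Neg \<phi>, a) \<in> decide (fst (en i)) A (snd (en i)) (r i)"
      using that by (auto simp: decide_def)
    then show ?thesis unfolding r step_def by (cases "a \<in> r i") auto
  qed
  have "finsat U n p"
    unfolding finsat_def
  proof (intro allI impI, elim conjE)
    fix \<Theta> assume fin: "finite \<Theta>" and sub: "\<Theta> \<subseteq> p"
    have "\<exists>i. \<Theta> \<subseteq> f i"
      using fin sub
    proof (induction \<Theta>)
      case (insert \<theta> \<Theta>)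
      then obtain i j where "\<Theta> \<subseteq> f i" "\<theta> \<in> f j" by (auto simp: p_def)
      then show ?case using mono[of i "max i j"] mono[of j "max i j"]
        by (intro exI[of _ "max i j"]) auto
    qed simp
    then show "\<exists>b\<in>tuples (univ U) n. realises U b \<Theta>" using f(2) fin unfolding finsat_def by blast
  qed
  moreover have "p \<subseteq> pfms L n A" using f(1) by (auto simp: p_def)
  moreover have "(\<phi>, a) \<in> p \<or> (Neg \<phi>, a) \<in> p" if "(\<phi>, a) \<in> pfms L n A" for \<phi> a
  proof -
    have "(length a, \<phi>) \<in> range en" using that en by (simp add: pfms_def part_fms_def)
    then obtain i where "en i = (length a, \<phi>)" by (metis rangeE)
    then have "(\<phi>, a) \<in> f (Suc i) \<or> (Neg \<phi>, a) \<in> f (Suc i)"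
      using dec that by (simp add: pfms_def tuples_def)
    then show ?thesis unfolding p_def by blast
  qed
  ultimately have p: "p \<in> types L U n A" by (auto simp: types_def finsat_def)
  have shape: "\<theta> \<in> \<Phi> \<or> (\<exists>j<i. \<exists>a\<in>tuples A (fst (en j)). \<theta> = (snd (en j), a) \<or> \<theta> = (Neg (snd (en j)), a))"
    if "\<theta> \<in> f i" for \<theta> i
    using that
  proof (induction i)
    case (Suc i)
    then have "\<theta> \<in> f i \<or> \<theta> \<in> decide (fst (en i)) A (snd (en i)) (r i)" by (simp add: r step_def)
    then show ?case
    proof
      assume "\<theta> \<in> f i" then show ?thesis using Suc.IH less_SucI by blast
    next
      assume "\<theta> \<in> decide (fst (en i)) A (snd (en i)) (r i)"
      then have "\<exists>a\<in>tuples A (fst (en i)). \<theta> = (snd (en i), a) \<or> \<theta> = (Neg (snd (en i)), a)"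
        by (auto simp: decide_def)
      then show ?thesis by blast
    qed
  qed (simp add: f(4))
  have "strongly_compressible L U n A p"
    unfolding strongly_compressible_def ball_pair bex_pair
  proof (intro allI impI)
    fix m \<phi> assume m\<phi>: "(m, \<phi>) \<in> part_fms L n"
    have "\<exists>N. F \<subseteq> en ` {..<N}" if "finite F" "F \<subseteq> range en" for F
      using that
    proof (induction F)
      case (insert x F)
      then obtain N i where "F \<subseteq> en ` {..<N}" "x = en i" by auto
      then show ?case by (intro exI[of _ "max N (Suc i)"]) fastforce
    qed simp
    from this[of "insert (m, \<phi>) \<Delta>0"] obtain N where N: "insert (m, \<phi>) \<Delta>0 \<subseteq> en ` {..<N}"
      using \<Delta>0 m\<phi> en by auto
    \<comment> \<open>For the first \<open>N\<close> formulas, the restriction of \<open>p\<close>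
      over \<open>A\<close> is exactly stage \<open>N\<close>, which is a compressible partial
      type.\<close>
    let ?\<Delta> = "en ` {..<N}"
    obtain k \<zeta> where \<zeta>: "\<zeta> \<in> fms L (n + k)" "\<forall>\<Phi>0. finite \<Phi>0 \<and> \<Phi>0 \<subseteq> f N \<longrightarrow>
       (\<exists>c\<in>tuples A k. entails U n (f N) {(\<zeta>, c)} \<and> entails U n {(\<zeta>, c)} \<Phi>0)"
      using f(3)[of N] unfolding compressible_partial_def by blast
    have fN: "f N \<subseteq> restr p ?\<Delta> A"
    proof
      fix \<theta> assume \<theta>: "\<theta> \<in> f N"
      then have \<theta>p: "\<theta> \<in> p" unfolding p_def by blast
      obtain \<chi> a where \<chi>: "\<theta> = (\<chi>, a)" "set a \<subseteq> A" using f(1)[of N] \<theta> by (auto simp: pfms_def)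
      from shape[OF \<theta>] show "\<theta> \<in> restr p ?\<Delta> A"
      proof
        assume "\<theta> \<in> \<Phi>"
        then have "(length a, \<chi>) \<in> ?\<Delta>" using \<Delta>0(3) \<chi>(1) N by blast
        then show ?thesis using \<theta>p \<chi> by (auto simp: restr_def)
      next
        assume "\<exists>j<N. \<exists>a\<in>tuples A (fst (en j)). \<theta> = (snd (en j), a) \<or> \<theta> = (Neg (snd (en j)), a)"
        then obtain j a where j: "j < N" "a \<in> tuples A (fst (en j))"
          "\<theta> = (snd (en j), a) \<or> \<theta> = (Neg (snd (en j)), a)" by blast
        then have "(length a, snd (en j)) = en j" by (simp add: tuples_def)
        then have "(length a, snd (en j)) \<in> ?\<Delta>" using j(1) by (metis imageI lessThan_iff)
        moreover have "set a \<subseteq> A" using j(2) by (simp add: tuples_def)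
        ultimately show ?thesis using j(3) \<theta>p unfolding restr_def by auto
      qed
    qed
    have restr_fN: "restr p ?\<Delta> A \<subseteq> f N"
    proof
      fix \<theta> assume "\<theta> \<in> restr p ?\<Delta> A"
      then obtain \<chi> a where \<chi>: "(length a, \<chi>) \<in> ?\<Delta>" "set a \<subseteq> A" "\<theta> \<in> p" "\<theta> = (\<chi>, a) \<or> \<theta> = (Neg \<chi>, a)"
        unfolding restr_def by blast
      then obtain i where i: "i < N" "en i = (length a, \<chi>)" by auto
      then have d: "(\<chi>, a) \<in> f (Suc i) \<or> (Neg \<chi>, a) \<in> f (Suc i)" using dec \<chi>(2) by (simp add: tuples_def)
      have sub: "f (Suc i) \<subseteq> f N" using i(1) by (intro mono) simp
      have subp: "f (Suc i) \<subseteq> p" unfolding p_def by blast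
      from d show "\<theta> \<in> f N"
      proof
        assume 1: "(\<chi>, a) \<in> f (Suc i)"
        then have "(Neg \<chi>, a) \<notin> p" using types_consistent[OF p] subp by blast
        then show ?thesis using 1 \<chi>(3,4) sub by blast
      next
        assume 1: "(Neg \<chi>, a) \<in> f (Suc i)"
        then have "(\<chi>, a) \<notin> p" using types_consistent[OF p] subp by blast
        then show ?thesis using 1 \<chi>(3,4) sub by blast
      qed
    qed
    have main: "\<exists>c\<in>tuples A k. entails U n (restr p ?\<Delta> A) {(\<zeta>, c)} \<and>
        entails U n {(\<zeta>, c)} (restr p ?\<Delta> A\<^sub>0)" if A0: "A\<^sub>0 \<subseteq> A" "finite A\<^sub>0" for A\<^sub>0
    proof -
      have "restr p ?\<Delta> A\<^sub>0 \<subseteq> restr p ?\<Delta> A" using A0(1) unfolding restr_def by blast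
      then have "restr p ?\<Delta> A\<^sub>0 \<subseteq> f N" using restr_fN by blast
      moreover have "finite (restr p ?\<Delta> A\<^sub>0)"
      proof (rule finite_subset)
        show "restr p ?\<Delta> A\<^sub>0 \<subseteq> (\<Union>i\<in>{..<N}. (\<lambda>a. (snd (en i), a)) ` tuples A\<^sub>0 (fst (en i)) \<union>
            (\<lambda>a. (Neg (snd (en i)), a)) ` tuples A\<^sub>0 (fst (en i)))"
        proof
          fix \<theta> assume "\<theta> \<in> restr p ?\<Delta> A\<^sub>0"
          then obtain \<chi> a where \<chi>: "(length a, \<chi>) \<in> ?\<Delta>" "set a \<subseteq> A\<^sub>0" "\<theta> = (\<chi>, a) \<or> \<theta> = (Neg \<chi>, a)"
            unfolding restr_def by blast
          then obtain i where i: "i < N" "en i = (length a, \<chi>)" by auto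
          then have "a \<in> tuples A\<^sub>0 (fst (en i))" "\<chi> = snd (en i)" using \<chi>(2) by (simp_all add: tuples_def)
          then show "\<theta> \<in> (\<Union>i\<in>{..<N}. (\<lambda>a. (snd (en i), a)) ` tuples A\<^sub>0 (fst (en i)) \<union>
            (\<lambda>a. (Neg (snd (en i)), a)) ` tuples A\<^sub>0 (fst (en i)))" using i(1) \<chi>(3) by blast
        qed
        show "finite (\<Union>i\<in>{..<N}. (\<lambda>a. (snd (en i), a)) ` tuples A\<^sub>0 (fst (en i)) \<union>
            (\<lambda>a. (Neg (snd (en i)), a)) ` tuples A\<^sub>0 (fst (en i)))"
          using finite_tuples[OF A0(2)] by auto
      qed
      ultimately obtain c where c: "c \<in> tuples A k" "entails U n (f N) {(\<zeta>, c)}"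
        "entails U n {(\<zeta>, c)} (restr p ?\<Delta> A\<^sub>0)" using \<zeta>(2) by blast
      have "entails U n (restr p ?\<Delta> A) {(\<zeta>, c)}"
        using c(2) realises_mono[OF _ fN] unfolding entails_def by blast
      then show ?thesis using c by blast
    qed
    have "?\<Delta> \<subseteq> part_fms L n" using en by blast
    moreover have "(m, \<phi>) \<in> ?\<Delta>" using N by blast
    moreover have "(k, \<zeta>) \<in> part_fms L n" using \<zeta>(1) by (simp add: part_fms_def)
    ultimately show "\<exists>\<Delta>\<subseteq>part_fms L n. finite \<Delta> \<and> (m, \<phi>) \<in> \<Delta> \<and>
        (\<exists>k \<zeta>. (k, \<zeta>) \<in> part_fms L n \<and> (\<forall>A\<^sub>0\<subseteq>A. finite A\<^sub>0 \<longrightarrow>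
          (\<exists>c\<in>tuples A k. entails U n (restr p \<Delta> A) {(\<zeta>, c)} \<and>
            entails U n {(\<zeta>, c)} (restr p \<Delta> A\<^sub>0))))"
      using main by (intro exI[of _ ?\<Delta>] conjI exI[of _ k] exI[of _ \<zeta>]) auto
  qed
  moreover have "\<Phi> \<subseteq> p" using f(4) unfolding p_def by blast
  ultimately show ?thesis using p by blast
qed

end

section \<open>Chains of definable sets in unstable NIP theories\<close>

text \<open>Every subset of \<open>{..<N}\<close> reaches a final segment by moving single elements
  up one place. If \<open>P\<close> were closed under the reverse moves, it would contain all
  subsets.\<close>

lemma adjacent_swap_exists:
  fixes P :: "nat set set"
  assumes "P \<subseteq> Pow {..<N}" "\<And>t. t \<le> N \<Longrightarrow> {t..<N} \<in> P" "P \<noteq> Pow {..<N}"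
  shows "\<exists>\<eta> l. \<eta> \<in> P \<and> Suc l < N \<and> l \<notin> \<eta> \<and> Suc l \<in> \<eta> \<and> insert l (\<eta> - {Suc l}) \<notin> P"
proof (rule ccontr)
  assume neg: "\<not> ?thesis"
  have "\<eta> \<in> P" if "\<eta> \<subseteq> {..<N}" for \<eta>
    using that
  \<comment> \<open>Moving an element up raises the sum of the set, which is at most
    \<open>N * N\<close>.\<close>
  proof (induction "N * N - \<Sum>\<eta>" arbitrary: \<eta> rule: less_induct)
    case less
    show ?case
    proof (cases "\<exists>l\<in>\<eta>. Suc l < N \<and> Suc l \<notin> \<eta>")
      case False
      have "\<eta> = {t..<N}" if t: "t = (if \<eta> = {} then N else Min \<eta>)" for t
      proof (cases "\<eta> = {}")
        case ne: False
        have fin: "finite \<eta>" using less.prems finite_subset by blast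
        have "t + i \<in> \<eta>" if "t + i < N" for i
          using that
        proof (induction i)
          case 0 then show ?case using Min_in[OF fin ne] t ne by simp
        next
          case (Suc i) then show ?case using \<open>\<not> (\<exists>l\<in>\<eta>. Suc l < N \<and> Suc l \<notin> \<eta>)\<close> by auto
        qed
        then have "{t..<N} \<subseteq> \<eta>" by (metis atLeastLessThan_iff le_add_diff_inverse subsetI)
        moreover have "\<eta> \<subseteq> {t..<N}" using less.prems Min_le[OF fin] t ne by auto
        ultimately show ?thesis by blast
      qed (use t in simp)
      moreover have "(if \<eta> = {} then N else Min \<eta>) \<le> N"
      proof (cases "\<eta> = {}")
        case ne: False
        have "Min \<eta> \<in> \<eta>" using less.prems finite_subset ne by (intro Min_in) auto
        then show ?thesis using less.prems by auto
      qed simp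
      ultimately show ?thesis using assms(2) by metis
    next
      case True
      then obtain l where l: "l \<in> \<eta>" "Suc l < N" "Suc l \<notin> \<eta>" by blast
      let ?\<eta> = "insert (Suc l) (\<eta> - {l})"
      have fin: "finite \<eta>" using less.prems finite_subset by blast
      have "\<Sum>?\<eta> = Suc l + \<Sum>(\<eta> - {l})" using fin l(3) by (subst sum.insert) auto
      moreover have "\<Sum>\<eta> = l + \<Sum>(\<eta> - {l})" using fin l(1) by (rule sum.remove)
      ultimately have s: "\<Sum>?\<eta> = Suc (\<Sum>\<eta>)" by simp
      have sub: "?\<eta> \<subseteq> {..<N}" using less.prems l(2) by auto
      have "\<Sum>?\<eta> \<le> \<Sum>{..<N}" using sub by (intro sum_mono2) auto
      also have "\<dots> \<le> (\<Sum>i<N. N)" by (intro sum_mono) auto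
      finally have "\<Sum>?\<eta> \<le> N * N" by simp
      then have "N * N - \<Sum>?\<eta> < N * N - \<Sum>\<eta>" using s by linarith
      then have "?\<eta> \<in> P" using less.hyps sub by blast
      moreover have "insert l (?\<eta> - {Suc l}) = \<eta>" using l by auto
      moreover have "l \<notin> ?\<eta>" "Suc l \<in> ?\<eta>" by auto
      ultimately show ?thesis using neg l(2) by metis
    qed
  qed
  then show False using assms(1,3) by blast
qed

definition fibre :: "('f, 'r, 'u) struct \<Rightarrow> nat \<Rightarrow> ('f, 'r) fm \<Rightarrow> 'u list \<Rightarrow> 'u list set" where
  "fibre U m \<gamma> x = {a \<in> tuples (univ U) m. holds U \<gamma> (a @ x)}"

definition realised_patterns :: "'a set \<Rightarrow> ('a \<Rightarrow> nat \<Rightarrow> bool) \<Rightarrow> nat \<Rightarrow> (nat \<Rightarrow> nat) \<Rightarrow> nat set set" where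
  "realised_patterns S R N j = {\<eta> \<in> Pow {..<N}. \<exists>a\<in>S. \<forall>l<N. R a (j l) \<longleftrightarrow> l \<in> \<eta>}"

text \<open>Ramsey's theorem, the colour of an increasing \<open>N\<close>-tuple of indices being
  its set of realised patterns. This takes the place of an indiscernible sequence, since only
  patterns of length \<open>N\<close> matter.\<close>

lemma homogeneous_subsequence:
  "\<exists>H :: nat \<Rightarrow> nat. strict_mono H \<and> (\<forall>i. 0 < H i) \<and>
    (\<exists>P. \<forall>j. (\<forall>l l'. l < l' \<and> l' < N \<longrightarrow> j l < j l') \<longrightarrow> realised_patterns S R N (\<lambda>l. H (j l)) = P)"
proof -
  let ?pat = "realised_patterns S R N"
  have fin: "finite (Pow (Pow {..<N}))" by simp
  obtain g where g: "bij_betw g (Pow (Pow {..<N})) {0..<card (Pow (Pow {..<N}))}"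
    using ex_bij_betw_finite_nat[OF fin] by blast
  \<comment> \<open>Colours have to be numbers, so the finitely many sets of patterns are numbered
    by \<open>g\<close>.\<close>
  define f where "f X = g (?pat (\<lambda>l. sorted_list_of_set X ! l))" for X
  have pat_in: "?pat j \<in> Pow (Pow {..<N})" for j by (auto simp: realised_patterns_def)
  \<comment> \<open>Index 0 is kept out of the subsequence: it will provide an index below all
    chosen ones.\<close>
  have "infinite {1::nat..}" by (rule infinite_Ici)
  moreover have "\<forall>X. X \<subseteq> {1..} \<and> finite X \<and> card X = N \<longrightarrow> f X < card (Pow (Pow {..<N}))"
    using bij_betwE[OF g] pat_in by (auto simp: f_def)
  ultimately obtain Y t where Y: "Y \<subseteq> {1..}" "infinite Y"
    "\<forall>X. X \<subseteq> Y \<and> finite X \<and> card X = N \<longrightarrow> f X = t"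
    using Ramsey[of "{1..}" N f "card (Pow (Pow {..<N}))"] by blast
  define H where "H = enumerate Y"
  have H: "strict_mono H" unfolding H_def using Y(2) by (rule strict_mono_enumerate)
  have HY: "H i \<in> Y" for i unfolding H_def using Y(2) by (rule enumerate_in_set)
  have key: "g (?pat (\<lambda>l. H (j l))) = t" if j: "\<forall>l l'. l < l' \<and> l' < N \<longrightarrow> j l < j l'" for j
  proof -
    let ?xs = "map (\<lambda>l. H (j l)) [0..<N]"
    have mono: "H (j l) < H (j l')" if "l < l'" "l' < N" for l l'
      using j that strict_mono_less[OF H] by blast
    have "sorted_wrt (<) ?xs" by (auto simp: sorted_wrt_iff_nth_less mono)
    then have xs: "sorted_list_of_set (set ?xs) = ?xs" and "distinct ?xs"
      using strict_sorted_iff[of ?xs] sorted_list_of_set.idem_if_sorted_distinct[of ?xs] by auto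
    then have "card (set ?xs) = N" using distinct_card by fastforce
    moreover have "set ?xs \<subseteq> Y" using HY by auto
    ultimately have "f (set ?xs) = t" using Y(3) by blast
    moreover have "?pat (\<lambda>l. sorted_list_of_set (set ?xs) ! l) = ?pat (\<lambda>l. H (j l))"
      unfolding xs realised_patterns_def by simp
    ultimately show ?thesis by (simp add: f_def)
  qed
  have "\<exists>P. \<forall>j. (\<forall>l l'. l < l' \<and> l' < N \<longrightarrow> j l < j l') \<longrightarrow> ?pat (\<lambda>l. H (j l)) = P"
    using key inj_onD[OF bij_betw_imp_inj_on[OF g]] pat_in by metis
  moreover have "0 < H i" for i using HY[of i] Y(1) by auto
  ultimately show ?thesis using H by blast
qed

text \<open>Shelah's passage from instability and NIP to the strict order property, in the form of
  arbitrarily long finite chains of definable sets.\<close>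

lemma unstable_NIP_chains:
  assumes ne: "univ U \<noteq> {}" and nip: "NIP L U" and unst: "\<not> stable_theory L U"
  shows "\<exists>m n \<gamma>. \<gamma> \<in> fms L (m + n) \<and> (\<forall>q. \<exists>x :: nat \<Rightarrow> 'u list.
    (\<forall>i<q. x i \<in> tuples (univ U) n) \<and>
    (\<forall>i j. i < j \<and> j < q \<longrightarrow> fibre U m \<gamma> (x i) \<subset> fibre U m \<gamma> (x j)))"
proof -
  obtain m k \<theta> where \<theta>: "\<theta> \<in> fms L (m + k)" "order_in L U (univ U) m k \<theta>"
    using unst unfolding stable_theory_def by blast
  from \<theta>(2) obtain a b :: "nat \<Rightarrow> 'u list" where
    ab0: "(\<forall>i. a i \<in> tuples (univ U) m \<and> b i \<in> tuples (univ U) k) \<and>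
      (\<forall>i j. holds U \<theta> (a i @ b j) \<longleftrightarrow> i < j)" unfolding order_in_def by (elim exE)
  then have ab: "a i \<in> tuples (univ U) m" "b i \<in> tuples (univ U) k"
    "holds U \<theta> (a i @ b j) \<longleftrightarrow> i < j" for i j by simp_all
  obtain d where d: "\<forall>X. finite X \<and> X \<subseteq> tuples (univ U) k \<and>
    (\<forall>Y\<subseteq>X. \<exists>x\<in>tuples (univ U) m. \<forall>c\<in>X. holds U \<theta> (x @ c) \<longleftrightarrow> c \<in> Y) \<longrightarrow> card X \<le> d"
    using NIP_swapped[OF nip \<theta>(1)] by blast
  define N where "N = Suc d"
  define pat where "pat = realised_patterns (tuples (univ U) m) (\<lambda>x i. holds U \<theta> (x @ b i)) N"
  have pat_eq: "pat j = {\<eta> \<in> Pow {..<N}. \<exists>x\<in>tuples (univ U) m. \<forall>l<N. holds U \<theta> (x @ b (j l)) \<longleftrightarrow> l \<in> \<eta>}"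
    for j by (simp add: pat_def realised_patterns_def)
  obtain H :: "nat \<Rightarrow> nat" and P where H: "strict_mono H" "\<forall>i. 0 < H i" and
    P: "\<forall>j. (\<forall>l l'. l < l' \<and> l' < N \<longrightarrow> j l < j l') \<longrightarrow> pat (\<lambda>l. H (j l)) = P"
    using homogeneous_subsequence[of N "tuples (univ U) m" "\<lambda>x i. holds U \<theta> (x @ b i)"]
    unfolding pat_def[symmetric] by (elim exE conjE)
  have PH: "P = pat H" using P[rule_format, of "\<lambda>l. l"] by simp
  have binj: "b i \<noteq> b j" if "i < j" for i j using ab(3)[of i i] ab(3)[of i j] that by auto
  have "P \<subseteq> Pow {..<N}" by (auto simp: PH pat_eq)
  moreover have "{t..<N} \<in> P" if "t \<le> N" for t
  proof -
    \<comment> \<open>As \<theta>(a_i,b_j) holds iff \<open>i < j\<close>, the element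
      \<open>a (H (t - 1))\<close> realises the final segment from \<open>t\<close> on; for
      \<open>t = 0\<close> the reserved index 0 does it.\<close>
    let ?i = "if t = 0 then 0 else H (t - 1)"
    have "?i < H l \<longleftrightarrow> l \<in> {t..<N}" if "l < N" for l
      using that H(2)[rule_format, of l] strict_mono_less[OF H(1), of "t - 1" l] by auto
    then have "\<forall>l<N. holds U \<theta> (a ?i @ b (H l)) \<longleftrightarrow> l \<in> {t..<N}" using ab(3) by blast
    then show ?thesis unfolding PH pat_eq using ab(1)[of ?i] by auto
  qed
  moreover have "P \<noteq> Pow {..<N}"
  proof
    assume full: "P = Pow {..<N}"
    let ?X = "(\<lambda>l. b (H l)) ` {..<N}"
    have inj: "inj_on (\<lambda>l. b (H l)) {..<N}"
      using binj strict_mono_less[OF H(1)] by (intro linorder_inj_onI) auto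
    have sh: "\<exists>x\<in>tuples (univ U) m. \<forall>c\<in>?X. holds U \<theta> (x @ c) \<longleftrightarrow> c \<in> Y" if "Y \<subseteq> ?X" for Y
    proof -
      have "{l\<in>{..<N}. b (H l) \<in> Y} \<in> pat H" using full PH by blast
      then obtain x where "x \<in> tuples (univ U) m"
        "\<forall>l<N. holds U \<theta> (x @ b (H l)) \<longleftrightarrow> l \<in> {l\<in>{..<N}. b (H l) \<in> Y}" unfolding pat_eq by blast
      then show ?thesis by (intro bexI[of _ x]) auto
    qed
    have sub: "?X \<subseteq> tuples (univ U) k" using ab(2) by auto
    have "card ?X \<le> d"
      by (rule d[THEN spec, THEN mp]) (intro conjI, simp, rule sub, intro allI impI, rule sh, assumption)
    then show False using card_image[OF inj] by (simp add: N_def)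
  qed
  \<comment> \<open>An adjacent swap turns a realised pattern into an unrealised one; with the other positions
    fixed by parameters, this makes the sets \<open>\<theta>(x, b\<^sub>i)\<close> increase strictly with \<open>i\<close>.\<close>
  ultimately have "\<exists>\<eta> l. \<eta> \<in> P \<and> Suc l < N \<and> l \<notin> \<eta> \<and> Suc l \<in> \<eta> \<and> insert l (\<eta> - {Suc l}) \<notin> P"
    by (rule adjacent_swap_exists)
  then obtain \<eta> l where \<eta>: "\<eta> \<in> P" "Suc l < N" "l \<notin> \<eta>" "Suc l \<in> \<eta>" "insert l (\<eta> - {Suc l}) \<notin> P"
    by (elim exE conjE)
  have "\<eta> \<subseteq> {..<N}" using \<eta>(1) by (auto simp: PH pat_eq)
  define M where "M = N - (l + 2)"
  have N: "N = l + 2 + M" using \<eta>(2) by (simp add: M_def)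
  \<comment> \<open>Positions other than \<open>l\<close> and \<open>Suc l\<close> keep the signs of
    \<eta>; the last entry \<open>True\<close> is the sign of the moving parameter.\<close>
  define s where "s = map (\<lambda>i. i \<in> \<eta>) [0..<l] @ map (\<lambda>u. l + 2 + u \<in> \<eta>) [0..<M] @ [True]"
  obtain \<gamma> where \<gamma>: "\<gamma> \<in> fms L (m + length s * k)" "\<forall>x\<in>tuples (univ U) m. \<forall>as.
    length as = length s \<and> set as \<subseteq> tuples (univ U) k \<longrightarrow>
    (holds U \<gamma> (x @ concat as) \<longleftrightarrow> list_all2 (\<lambda>a t. holds U \<theta> (x @ a) \<longleftrightarrow> t) as s)"
    using fms_signs[OF ne \<theta>(1), of s] by blast
  have "\<exists>x :: nat \<Rightarrow> 'u list. (\<forall>i<q. x i \<in> tuples (univ U) (length s * k)) \<and>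
    (\<forall>i j. i < j \<and> j < q \<longrightarrow> fibre U m \<gamma> (x i) \<subset> fibre U m \<gamma> (x j))" for q
  proof -
    \<comment> \<open>The indices from \<open>l\<close> to \<open>l + q - 1\<close> are kept free
      between the two fixed groups, and the moving parameter runs through them.\<close>
    define ws where "ws i = map (\<lambda>t. b (H t)) [0..<l] @ map (\<lambda>u. b (H (l + q + u))) [0..<M] @ [b (H (l + i))]" for i
    have ws: "length (ws i) = length s \<and> set (ws i) \<subseteq> tuples (univ U) k" for i
      using ab(2) by (auto simp: ws_def s_def)
    have tup: "concat (ws i) \<in> tuples (univ U) (length s * k)" for i
      using concat_in_tuples[of "ws i" "univ U" k] ws[of i] by auto
    have hold: "holds U \<gamma> (x @ concat (ws i)) \<longleftrightarrow>
        (\<forall>t<l. holds U \<theta> (x @ b (H t)) \<longleftrightarrow> t \<in> \<eta>) \<and>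
        (\<forall>u<M. holds U \<theta> (x @ b (H (l + q + u))) \<longleftrightarrow> l + 2 + u \<in> \<eta>) \<and>
        holds U \<theta> (x @ b (H (l + i)))" if x: "x \<in> tuples (univ U) m" for x i
    proof -
      have "holds U \<gamma> (x @ concat (ws i)) \<longleftrightarrow> list_all2 (\<lambda>a t. holds U \<theta> (x @ a) \<longleftrightarrow> t) (ws i) s"
        using \<gamma>(2) x ws by blast
      also have "\<dots> \<longleftrightarrow> (\<forall>t<l. holds U \<theta> (x @ b (H t)) \<longleftrightarrow> t \<in> \<eta>) \<and>
        (\<forall>u<M. holds U \<theta> (x @ b (H (l + q + u))) \<longleftrightarrow> l + 2 + u \<in> \<eta>) \<and>
        holds U \<theta> (x @ b (H (l + i)))"
        unfolding ws_def s_def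
        by (simp add: list_all2_append list_all2_map1 list_all2_map2 list_all2_same Ball_def)
      finally show ?thesis .
    qed
    have "fibre U m \<gamma> (concat (ws i)) \<subset> fibre U m \<gamma> (concat (ws i'))" if ii: "i < i'" "i' < q" for i i'
    proof -
      \<comment> \<open>An increasing choice of indices with positions \<open>l\<close> and
        \<open>Suc l\<close> filled by the moving parameters for \<open>i\<close> and
        \<open>i'\<close>. The pattern \<eta> gives an element of the larger fibre only; an element
        of the smaller fibre only would realise the missing swapped pattern.\<close>
      define j where "j t = (if t < l then t else if t = l then l + i else if t = Suc l then l + i'
        else l + q + (t - (l + 2)))" for t
      have "\<forall>t t'. t < t' \<and> t' < N \<longrightarrow> j t < j t'" using ii by (auto simp: j_def)
      then have Pj: "pat (\<lambda>t. H (j t)) = P" using P by blast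
      have split: "(\<forall>t<N. X t) \<longleftrightarrow> (\<forall>t<l. X t) \<and> X l \<and> X (Suc l) \<and> (\<forall>u<M. X (l + 2 + u))" for X
      proof
        assume R: "(\<forall>t<l. X t) \<and> X l \<and> X (Suc l) \<and> (\<forall>u<M. X (l + 2 + u))"
        show "\<forall>t<N. X t"
        proof (intro allI impI)
          fix t assume t: "t < N"
          consider "t < l" | "t = l" | "t = Suc l" | "t \<ge> l + 2" by linarith
          then show "X t"
          proof cases
            case 4
            then have "t - (l + 2) < M" "l + 2 + (t - (l + 2)) = t" using t N by linarith+
            then show ?thesis using R by metis
          qed (use R in auto)
        qed
      qed (auto simp: N)
      have jv: "t < l \<Longrightarrow> j t = t" "j l = l + i" "j (Suc l) = l + i'" "j (l + 2 + u) = l + q + u" for t u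
        by (auto simp: j_def)
      obtain x where x: "x \<in> tuples (univ U) m" "\<forall>t<N. holds U \<theta> (x @ b (H (j t))) \<longleftrightarrow> t \<in> \<eta>"
        using \<eta>(1) unfolding Pj[symmetric] pat_eq by blast
      have "holds U \<gamma> (x @ concat (ws i'))" "\<not> holds U \<gamma> (x @ concat (ws i))"
        using x(2) \<eta>(3,4) unfolding hold[OF x(1)] split jv(2,3,4) by (auto simp: jv(1))
      then have 1: "x \<in> fibre U m \<gamma> (concat (ws i')) - fibre U m \<gamma> (concat (ws i))"
        using x(1) by (simp add: fibre_def)
      have "y \<in> fibre U m \<gamma> (concat (ws i'))" if y: "y \<in> fibre U m \<gamma> (concat (ws i))" for y
      proof (rule ccontr)
        assume "y \<notin> fibre U m \<gamma> (concat (ws i'))"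
        then have ym: "y \<in> tuples (univ U) m" and h: "holds U \<gamma> (y @ concat (ws i))"
          "\<not> holds U \<gamma> (y @ concat (ws i'))" using y by (auto simp: fibre_def)
        let ?\<eta> = "insert l (\<eta> - {Suc l})"
        have "\<forall>t<N. holds U \<theta> (y @ b (H (j t))) \<longleftrightarrow> t \<in> ?\<eta>"
          using h unfolding hold[OF ym] split jv(2,3,4) by (auto simp: jv(1))
        moreover have "?\<eta> \<subseteq> {..<N}" using \<open>\<eta> \<subseteq> {..<N}\<close> \<eta>(2) by auto
        ultimately have "?\<eta> \<in> pat (\<lambda>t. H (j t))" unfolding pat_eq using ym by blast
        then show False using Pj \<eta>(5) by simp
      qed
      then show ?thesis using 1 by blast
    qed
    then show ?thesis using tup by (intro exI[of _ "\<lambda>i. concat (ws i)"]) auto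
  qed
  then show ?thesis using \<gamma>(1) by blast
qed

section \<open>Unrealised cuts in an omega-saturated model\<close>

lemma holds_Ex:
  assumes "\<eta> \<in> fms L (Suc k)" "length c = k"
  shows "holds M (Ex k \<eta>) c \<longleftrightarrow> (\<exists>u\<in>univ M. holds M \<eta> (c @ [u]))"
proof -
  have "sat M ((\<lambda>i. c ! i)(k := u)) \<eta> \<longleftrightarrow> holds M \<eta> (c @ [u])" for u
    unfolding holds_def using assms
    by (intro sat_cong) (auto simp: fms_def nth_append less_Suc_eq)
  then show ?thesis by (simp add: holds_def)
qed

lemma univ_substruct [simp]: "univ (substruct U M) = M"
  by (simp add: substruct_def)

lemma small_modelD:
  assumes "small_model L T U M"
  shows "small U M" "M \<subseteq> univ U"
    and "\<phi> \<in> fms L k \<Longrightarrow> a \<in> tuples M k \<Longrightarrow> holds (substruct U M) \<phi> a \<longleftrightarrow> holds U \<phi> a"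
  using assms by (auto simp: small_model_def small_def)

text \<open>Tarski-Vaught for tuples: witnesses are found one coordinate at a time and become
  parameters for the next, so parameters stand to the left of the variables.\<close>

lemma small_model_witness_right:
  assumes M: "small_model L T U M" and "\<chi> \<in> fms L (k + n)" "c \<in> tuples M k" "x \<in> tuples (univ U) n"
    "holds U \<chi> (c @ x)"
  shows "\<exists>x\<in>tuples M n. holds U \<chi> (c @ x)"
  using assms(2-)
proof (induction n arbitrary: k c x)
  case 0
  then show ?case by (intro bexI[of _ "[]"]) (auto simp: tuples_def)
next
  case (Suc n)
  obtain u x' where x: "x = u # x'" "u \<in> univ U" "x' \<in> tuples (univ U) n"
    using Suc.prems(3) by (cases x) (auto simp: tuples_def)
  have ck: "length c = k" using Suc.prems(2) by (simp add: tuples_def)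
  have \<chi>: "\<chi> \<in> fms L (Suc k + n)" using Suc.prems(1) by simp
  then obtain \<eta> where \<eta>: "\<eta> \<in> fms L (Suc k)"
    "\<forall>b\<in>tuples (univ U) (Suc k). holds U \<eta> b \<longleftrightarrow> (\<exists>y\<in>tuples (univ U) n. holds U \<chi> (b @ y))"
    using fdef_ex[OF fdef_holds[OF \<chi>], of U] unfolding fdef_def by blast
  have cU: "c @ [v] \<in> tuples (univ U) (Suc k)" if "v \<in> univ U" for v
    using Suc.prems(2) small_modelD(2)[OF M] that by (auto simp: tuples_def)
  have "holds U \<chi> ((c @ [u]) @ x')" using Suc.prems(4) x(1) by simp
  then have "holds U \<eta> (c @ [u])" using \<eta>(2) cU[OF x(2)] x(3) by blast
  then have "holds U (Ex k \<eta>) c" using holds_Ex[OF \<eta>(1) ck] x(2) by blast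
  moreover have "Ex k \<eta> \<in> fms L k" using \<eta>(1) by (auto simp: fms_def less_Suc_eq)
  ultimately have "holds (substruct U M) (Ex k \<eta>) c" using small_modelD(3)[OF M] Suc.prems(2) by blast
  then obtain v where v: "v \<in> M" "holds (substruct U M) \<eta> (c @ [v])"
    using holds_Ex[OF \<eta>(1) ck, of "substruct U M"] by auto
  have cv: "c @ [v] \<in> tuples M (Suc k)" using Suc.prems(2) v(1) by (simp add: tuples_def)
  then have "holds U \<eta> (c @ [v])" using small_modelD(3)[OF M \<eta>(1)] v(2) by blast
  moreover have "v \<in> univ U" using v(1) small_modelD(2)[OF M] by blast
  ultimately obtain y where "y \<in> tuples (univ U) n" "holds U \<chi> ((c @ [v]) @ y)" using \<eta>(2) cU by blast
  then obtain y' where "y' \<in> tuples M n" "holds U \<chi> ((c @ [v]) @ y')"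
    using Suc.IH[OF \<chi> cv] by blast
  then show ?case using v(1) by (intro bexI[of _ "v # y'"]) (auto simp: tuples_def)
qed

lemma small_model_witness:
  assumes M: "small_model L T U M" and "\<chi> \<in> fms L (n + k)" "c \<in> tuples M k" "x \<in> tuples (univ U) n"
    "holds U \<chi> (x @ c)"
  shows "\<exists>x\<in>tuples M n. holds U \<chi> (x @ c)"
proof -
  have "fdef L U (k + n) (\<lambda>v. holds U \<chi> (slice v k n @ slice v 0 k))"
    using assms(2) by (intro fdef_slices) auto
  then obtain \<xi> where \<xi>: "\<xi> \<in> fms L (k + n)"
    "\<forall>v\<in>tuples (univ U) (k + n). holds U \<xi> v \<longleftrightarrow> holds U \<chi> (slice v k n @ slice v 0 k)"
    unfolding fdef_def by blast
  have MU: "M \<subseteq> univ U" by (rule small_modelD(2)[OF M])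
  then have cU: "c \<in> tuples (univ U) k" using assms(3) tuples_mono by blast
  have eq: "holds U \<xi> (c @ y) \<longleftrightarrow> holds U \<chi> (y @ c)" if "y \<in> tuples (univ U) n" for y
    using \<xi>(2)[rule_format, OF tuples_append[OF cU that]] cU that by (simp add: slice_def tuples_def)
  then obtain y where "y \<in> tuples M n" "holds U \<xi> (c @ y)"
    using small_model_witness_right[OF M \<xi>(1) assms(3,4)] assms(4,5) by blast
  then show ?thesis using eq tuples_mono[OF MU] by blast
qed

lemma small_model_realises:
  assumes M: "small_model L T U M" and ne: "univ U \<noteq> {}" and "finite \<Theta>" "\<Theta> \<subseteq> pfms L n M"
    "x \<in> tuples (univ U) n" "realises U x \<Theta>"
  shows "\<exists>x\<in>tuples M n. realises U x \<Theta>"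
proof -
  have MU: "M \<subseteq> univ U" by (rule small_modelD(2)[OF M])
  obtain \<chi> c where \<chi>: "(\<chi>, c) \<in> pfms L n M"
    "\<forall>b\<in>tuples (univ U) n. holds U \<chi> (b @ c) \<longleftrightarrow> realises U b \<Theta>"
    using pfms_conj[OF ne MU assms(3,4)] by blast
  then have "\<chi> \<in> fms L (n + length c)" "c \<in> tuples M (length c)" by (auto simp: pfms_def tuples_def)
  moreover have "holds U \<chi> (x @ c)" using \<chi>(2) assms(5,6) by blast
  ultimately obtain y where "y \<in> tuples M n" "holds U \<chi> (y @ c)"
    using small_model_witness[OF M _ _ assms(5)] by blast
  then show ?thesis using \<chi>(2) tuples_mono[OF MU] by blast
qed

lemma realises_substruct:
  assumes M: "small_model L T U M" and "\<Theta> \<subseteq> pfms L n M" "x \<in> tuples M n"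
  shows "realises (substruct U M) x \<Theta> \<longleftrightarrow> realises U x \<Theta>"
proof -
  have "holds (substruct U M) \<phi> (x @ a) \<longleftrightarrow> holds U \<phi> (x @ a)" if "(\<phi>, a) \<in> \<Theta>" for \<phi> a
  proof -
    have "\<phi> \<in> fms L (n + length a)" "x @ a \<in> tuples M (n + length a)"
      using that assms(2,3) by (auto simp: pfms_def tuples_def)
    then show ?thesis by (rule small_modelD(3)[OF M])
  qed
  then show ?thesis unfolding realises_def by auto
qed

text \<open>Finite satisfiability passes from \<open>U\<close> down to \<open>M\<close> by
  elementarity, and the realisation found in \<open>M\<close> passes back.\<close>

lemma omega_saturated_realises:
  assumes M: "small_model L T U M" "omega_saturated L (substruct U M)" and ne: "univ U \<noteq> {}"
    and A: "finite A" "A \<subseteq> M" and \<Theta>: "\<Theta> \<subseteq> pfms L n A" "finsat U n \<Theta>"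
  shows "\<exists>x\<in>tuples M n. realises U x \<Theta>"
proof -
  have \<Theta>M: "\<Theta> \<subseteq> pfms L n M" using \<Theta>(1) pfms_mono[OF A(2)] by blast
  have "finsat (substruct U M) n \<Theta>"
    unfolding finsat_def univ_substruct
  proof (intro allI impI, elim conjE)
    fix \<Theta>' assume fin: "finite \<Theta>'" and sub: "\<Theta>' \<subseteq> \<Theta>"
    then obtain b where "b \<in> tuples (univ U) n" "realises U b \<Theta>'"
      using \<Theta>(2) unfolding finsat_def by blast
    moreover have sub': "\<Theta>' \<subseteq> pfms L n M" using sub \<Theta>M by blast
    ultimately obtain y where "y \<in> tuples M n" "realises U y \<Theta>'"
      using small_model_realises[OF M(1) ne fin] by blast
    then show "\<exists>b\<in>tuples M n. realises (substruct U M) b \<Theta>'"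
      using realises_substruct[OF M(1) sub'] by blast
  qed
  moreover have "A \<prec> (UNIV :: nat set)" using A(1) by (rule finite_lesspoll_infinite[OF infinite_UNIV_nat])
  moreover have "A \<subseteq> univ (substruct U M)" using A(2) by simp
  ultimately obtain b where "b \<in> tuples (univ (substruct U M)) n" "realises (substruct U M) b \<Theta>"
    using saturated_realises[OF M(2)[unfolded omega_saturated_def] _ _ \<Theta>(1)] by metis
  then show ?thesis using realises_substruct[OF M(1) \<Theta>M] by auto
qed

lemma fdef_slice: "fdef L U n P \<Longrightarrow> i + n \<le> k \<Longrightarrow> fdef L U k (\<lambda>b. P (slice b i n))"
proof (rule fdef_cong)
  assume *: "fdef L U n P" "i + n \<le> k"
  show "fdef L U k (\<lambda>b. P (map ((!) b) [i..<i + n]))"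
    using * by (intro fdef_map) auto
  show "P (map ((!) b) [i..<i + n]) \<longleftrightarrow> P (slice b i n)" if "b \<in> tuples (univ U) k" for b
    using that * by (simp add: slice_eq_map tuples_def)
qed

lemma fdef_fibre_less:
  assumes "\<gamma> \<in> fms L (m + n)"
  shows "fdef L U (n + n) (\<lambda>v. fibre U m \<gamma> (slice v 0 n) \<subset> fibre U m \<gamma> (slice v n n))"
proof (rule fdef_cong)
  show "fdef L U (n + n) (\<lambda>v.
      (\<forall>a\<in>tuples (univ U) m. (\<lambda>w. holds U \<gamma> (slice w (n + n) m @ slice w 0 n) \<longrightarrow>
         holds U \<gamma> (slice w (n + n) m @ slice w n n)) (v @ a)) \<and>
      (\<exists>a\<in>tuples (univ U) m. (\<lambda>w. \<not> holds U \<gamma> (slice w (n + n) m @ slice w 0 n) \<and>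
         holds U \<gamma> (slice w (n + n) m @ slice w n n)) (v @ a)))"
    using assms by (intro fdef_conj fdef_all fdef_ex fdef_imp fdef_not fdef_slices) auto
  fix v assume v: "v \<in> tuples (univ U) (n + n)"
  have "slice (v @ a) (n + n) m = a" "slice (v @ a) 0 n = slice v 0 n" "slice (v @ a) n n = slice v n n"
    if "a \<in> tuples (univ U) m" for a using v that by (simp_all add: tuples_def slice_def)
  then have "((\<forall>a\<in>tuples (univ U) m. (\<lambda>w. holds U \<gamma> (slice w (n + n) m @ slice w 0 n) \<longrightarrow>
         holds U \<gamma> (slice w (n + n) m @ slice w n n)) (v @ a)) \<and>
      (\<exists>a\<in>tuples (univ U) m. (\<lambda>w. \<not> holds U \<gamma> (slice w (n + n) m @ slice w 0 n) \<and>
         holds U \<gamma> (slice w (n + n) m @ slice w n n)) (v @ a))) \<longleftrightarrow>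
      (\<forall>a\<in>tuples (univ U) m. holds U \<gamma> (a @ slice v 0 n) \<longrightarrow> holds U \<gamma> (a @ slice v n n)) \<and>
      (\<exists>a\<in>tuples (univ U) m. \<not> holds U \<gamma> (a @ slice v 0 n) \<and> holds U \<gamma> (a @ slice v n n))"
    by simp
  also have "\<dots> \<longleftrightarrow> fibre U m \<gamma> (slice v 0 n) \<subset> fibre U m \<gamma> (slice v n n)"
    unfolding fibre_def by blast
  finally show "((\<forall>a\<in>tuples (univ U) m. (\<lambda>w. holds U \<gamma> (slice w (n + n) m @ slice w 0 n) \<longrightarrow>
         holds U \<gamma> (slice w (n + n) m @ slice w n n)) (v @ a)) \<and>
      (\<exists>a\<in>tuples (univ U) m. (\<lambda>w. \<not> holds U \<gamma> (slice w (n + n) m @ slice w 0 n) \<and>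
         holds U \<gamma> (slice w (n + n) m @ slice w n n)) (v @ a))) \<longleftrightarrow>
      fibre U m \<gamma> (slice v 0 n) \<subset> fibre U m \<gamma> (slice v n n)" .
qed

text \<open>At least \<open>q\<close> further steps are possible above \<open>x\<close>. The
  recursion quantifies over one element at a time, so definability follows by induction on
  \<open>q\<close>.\<close>

primrec chain_above :: "('a \<Rightarrow> 'a \<Rightarrow> bool) \<Rightarrow> 'a set \<Rightarrow> nat \<Rightarrow> 'a \<Rightarrow> bool" where
  "chain_above R S 0 x \<longleftrightarrow> True"
| "chain_above R S (Suc q) x \<longleftrightarrow> (\<exists>y\<in>S. R x y \<and> chain_above R S q y)"

lemma chain_above_Suc: "chain_above R S (Suc q) x \<Longrightarrow> chain_above R S q x"
  by (induction q arbitrary: x) auto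

lemma chain_above_mono: "q \<le> q' \<Longrightarrow> chain_above R S q' x \<Longrightarrow> chain_above R S q x"
  by (induction q' rule: dec_induct) (auto dest: chain_above_Suc simp del: chain_above.simps)

lemma chain_above_sequence:
  "(\<And>i. i \<le> q \<Longrightarrow> x i \<in> S) \<Longrightarrow> (\<And>i. i < q \<Longrightarrow> R (x i) (x (Suc i))) \<Longrightarrow> chain_above R S q (x 0)"
proof (induction q arbitrary: x)
  case (Suc q)
  have "chain_above R S q ((\<lambda>i. x (Suc i)) 0)" using Suc.prems by (intro Suc.IH) auto
  then show ?case using Suc.prems(1)[of 1] Suc.prems(2)[of 0] by auto
qed simp

text \<open>The chain is built upwards in \<open>M\<close>, one element at a time, keeping
  arbitrarily long finite chains above the current element. The next element realises a type over
  the current tuple alone, which omega-saturation can handle.\<close>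

lemma infinite_chain_in_model:
  fixes U :: "('f, 'r, 'u) struct"
  assumes M: "small_model L T U M" "omega_saturated L (substruct U M)" and ne: "univ U \<noteq> {}"
    and \<gamma>: "\<gamma> \<in> fms L (m + n)"
    and chains: "\<And>q. \<exists>x :: nat \<Rightarrow> 'u list. (\<forall>i<q. x i \<in> tuples (univ U) n) \<and>
      (\<forall>i j. i < j \<and> j < q \<longrightarrow> fibre U m \<gamma> (x i) \<subset> fibre U m \<gamma> (x j))"
  shows "\<exists>c. \<forall>i. c i \<in> tuples M n \<and> fibre U m \<gamma> (c i) \<subset> fibre U m \<gamma> (c (Suc i))"
proof -
  let ?S = "tuples (univ U) n"
  define R where "R x y \<longleftrightarrow> fibre U m \<gamma> x \<subset> fibre U m \<gamma> y" for x y
  let ?ch = "chain_above R ?S"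
  have MU: "M \<subseteq> univ U" by (rule small_modelD(2)[OF M(1)])
  have R: "fdef L U (n + n) (\<lambda>v. R (slice v 0 n) (slice v n n))"
    unfolding R_def by (rule fdef_fibre_less[OF \<gamma>])
  have "fdef L U n (?ch q)" for q
  proof (induction q)
    case 0 show ?case using fdef_True[OF ne] by simp
  next
    case (Suc q)
    have "fdef L U (n + n) (\<lambda>v. R (slice v 0 n) (slice v n n) \<and> ?ch q (slice v n n))"
      using R fdef_slice[OF Suc.IH] by (intro fdef_conj) auto
    from fdef_ex[OF this] show ?case
      by (rule fdef_cong[rotated]) (auto simp: slice_def tuples_def)
  qed
  then have "\<forall>q. \<exists>\<phi>. \<phi> \<in> fms L n \<and> (\<forall>b\<in>?S. holds U \<phi> b \<longleftrightarrow> ?ch q b)" unfolding fdef_def by blast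
  from choice[OF this] obtain lam where lam: "\<And>q. lam q \<in> fms L n"
    "\<And>q b. b \<in> ?S \<Longrightarrow> holds U (lam q) b \<longleftrightarrow> ?ch q b" by blast
  let ?\<Lambda> = "range (\<lambda>q. (lam q, [] :: 'u list))"
  have \<Lambda>: "?\<Lambda> \<subseteq> pfms L n A" for A using lam(1) by (auto simp: pfms_def)
  have real\<Lambda>: "realises U x \<Theta>" if "x \<in> ?S" "?ch N x" "\<Theta> \<subseteq> (\<lambda>q. (lam q, [] :: 'u list)) ` {..N}" for x N \<Theta>
    using that(3) lam(2)[OF that(1)] chain_above_mono[OF _ that(2)] by (auto simp: realises_def)
  have bound: "\<exists>N. \<Theta> \<inter> ?\<Lambda> \<subseteq> (\<lambda>q. (lam q, [] :: 'u list)) ` {..N}" if fin: "finite \<Theta>" for \<Theta>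
  proof -
    obtain Q where Q: "finite Q" "\<Theta> \<inter> ?\<Lambda> = (\<lambda>q. (lam q, [] :: 'u list)) ` Q"
      using finite_subset_image[of "\<Theta> \<inter> ?\<Lambda>" "\<lambda>q. (lam q, [] :: 'u list)" UNIV] fin by auto
    then have "Q \<subseteq> {..Max (insert 0 Q)}" by auto
    then show ?thesis using Q(2) by blast
  qed
  define good where "good x \<longleftrightarrow> x \<in> tuples M n \<and> (\<forall>q. ?ch q x)" for x
  have goodI: "good x" if "x \<in> tuples M n" "realises U x ?\<Lambda>" for x
    using that lam(2)[of x] tuples_mono[OF MU] unfolding good_def realises_def by auto
  have "\<exists>x. good x"
  proof -
    have "finsat U n ?\<Lambda>"
      unfolding finsat_def
    proof (intro allI impI, elim conjE)
      fix \<Theta> assume fin: "finite \<Theta>" and sub: "\<Theta> \<subseteq> ?\<Lambda>"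
      then obtain N where N: "\<Theta> \<subseteq> (\<lambda>q. (lam q, [] :: 'u list)) ` {..N}" using bound[of \<Theta>] by (auto simp: Int_absorb2)
      obtain x :: "nat \<Rightarrow> 'u list" where x: "\<forall>i<Suc N. x i \<in> ?S"
        "\<forall>i j. i < j \<and> j < Suc N \<longrightarrow> fibre U m \<gamma> (x i) \<subset> fibre U m \<gamma> (x j)" using chains[of "Suc N"] by blast
      have "?ch N (x 0)" using x by (intro chain_above_sequence) (auto simp: R_def)
      then show "\<exists>b\<in>?S. realises U b \<Theta>" using real\<Lambda>[OF _ _ N] x(1) by blast
    qed
    then obtain x where "x \<in> tuples M n" "realises U x ?\<Lambda>"
      using omega_saturated_realises[OF M ne _ _ \<Lambda>[of "{}"]] by blast
    then show ?thesis using goodI by blast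
  qed
  moreover have "\<exists>y. good y \<and> R x y" if x: "good x" for x
  proof -
    have xM: "x \<in> tuples M n" using x by (simp add: good_def)
    then have xU: "x \<in> ?S" using tuples_mono[OF MU] by blast
    have "fdef L U (n + n) (\<lambda>v. (\<lambda>u. R (slice u 0 n) (slice u n n)) (map ((!) v) ([n..<n + n] @ [0..<n])))"
      using R by (intro fdef_map) auto
    then obtain \<rho> where \<rho>: "\<rho> \<in> fms L (n + n)" "\<forall>v\<in>tuples (univ U) (n + n). holds U \<rho> v \<longleftrightarrow>
        (\<lambda>u. R (slice u 0 n) (slice u n n)) (map ((!) v) ([n..<n + n] @ [0..<n]))"
      unfolding fdef_def by blast
    have \<rho>x: "holds U \<rho> (y @ x) \<longleftrightarrow> R x y" if y: "y \<in> ?S" for y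
    proof -
      have len: "length x = n" "length y = n" using xU y by (auto simp: tuples_def)
      then have "map ((!) (y @ x)) ([n..<n + n] @ [0..<n]) = x @ y"
        using slice_eq_map[of n n "y @ x"] slice_eq_map[of 0 n "y @ x"] by (simp add: slice_def)
      then show ?thesis using \<rho>(2)[rule_format, OF tuples_append[OF y xU]] len by (simp add: slice_def)
    qed
    let ?\<Theta> = "insert (\<rho>, x) ?\<Lambda>"
    have "?\<Theta> \<subseteq> pfms L n (set x)" using \<Lambda> \<rho>(1) xM by (auto simp: pfms_def tuples_def)
    moreover have "finsat U n ?\<Theta>"
      unfolding finsat_def
    proof (intro allI impI, elim conjE)
      fix \<Theta> assume fin: "finite \<Theta>" and sub: "\<Theta> \<subseteq> ?\<Theta>"
      obtain N where N: "\<Theta> \<inter> ?\<Lambda> \<subseteq> (\<lambda>q. (lam q, [] :: 'u list)) ` {..N}" using bound[OF fin] by blast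
      \<comment> \<open>Above \<open>x\<close> one more step is possible than the finite part asks
        of \<open>y\<close>.\<close>
      have "?ch (Suc N) x" using x unfolding good_def by blast
      then obtain y where y: "y \<in> ?S" "R x y" "?ch N y" by auto
      then have "realises U y (insert (\<rho>, x) (\<Theta> \<inter> ?\<Lambda>))"
        using real\<Lambda>[OF y(1,3) N] \<rho>x by (simp add: realises_insert)
      then have "realises U y \<Theta>" by (rule realises_mono) (use sub in blast)
      then show "\<exists>b\<in>?S. realises U b \<Theta>" using y(1) by blast
    qed
    moreover have "finite (set x)" "set x \<subseteq> M" using xM by (auto simp: tuples_def)
    ultimately have "\<exists>y\<in>tuples M n. realises U y ?\<Theta>" by (intro omega_saturated_realises[OF M ne])
    then obtain y where y: "y \<in> tuples M n" "realises U y ?\<Theta>" by blast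
    then have "good y" using goodI realises_mono by blast
    moreover have "R x y" using y \<rho>x tuples_mono[OF MU] by (auto simp: realises_insert)
    ultimately show ?thesis by blast
  qed
  ultimately have "\<exists>c. \<forall>i :: nat. good (c i) \<and> R (c i) (c (Suc i))"
    by (intro dependent_nat_choice) auto
  then show ?thesis unfolding good_def R_def by blast
qed

text \<open>No element of \<open>S\<close> can lie in a cut of a maximal chain. The given sequence
  is used to choose a cut whose lower part is nonempty and has no last element, so that the cut is
  still finitely satisfiable.\<close>

lemma maximal_chain_cut:
  fixes less :: "'a \<Rightarrow> 'a \<Rightarrow> bool" and c :: "nat \<Rightarrow> 'a"
  assumes irr: "\<And>x. \<not> less x x" and tr: "\<And>x y z. less x y \<Longrightarrow> less y z \<Longrightarrow> less x z"
    and c: "\<And>i. c i \<in> S" "\<And>i. less (c i) (c (Suc i))"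
  shows "\<exists>C1 C2. C1 \<subseteq> S \<and> C2 \<subseteq> S \<and>
    (\<forall>F\<subseteq>C1. finite F \<longrightarrow> (\<exists>z\<in>C1. (\<forall>x\<in>F. less x z) \<and> (\<forall>d\<in>C2. less z d))) \<and>
    (\<forall>F\<subseteq>C2. finite F \<and> F \<noteq> {} \<longrightarrow> (\<exists>d\<in>F. \<forall>d'\<in>F. d = d' \<or> less d d')) \<and>
    (\<forall>b\<in>S. \<not> ((\<forall>x\<in>C1. less x b) \<and> (\<forall>d\<in>C2. less b d)))"
proof -
  define linear where "linear X \<longleftrightarrow> (\<forall>x\<in>X. \<forall>y\<in>X. x = y \<or> less x y \<or> less y x)" for X
  have cmono: "less (c i) (c j)" if "i < j" for i j
    using that
  proof (induction j)
    case (Suc j)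
    then show ?case using c(2)[of j] tr[of "c i" "c j" "c (Suc j)"] by (cases "i = j") auto
  qed simp
  let ?A = "{X. range c \<subseteq> X \<and> X \<subseteq> S \<and> linear X}"
  have "\<exists>C\<in>?A. \<forall>X\<in>?A. C \<subseteq> X \<longrightarrow> X = C"
  proof (rule subset_Zorn_nonempty)
    have "linear (range c)"
      unfolding linear_def
    proof (intro ballI)
      fix x y assume "x \<in> range c" "y \<in> range c"
      then obtain i j where "x = c i" "y = c j" by auto
      then show "x = y \<or> less x y \<or> less y x"
        using cmono[of i j] cmono[of j i] by (cases i j rule: linorder_cases) auto
    qed
    then show "?A \<noteq> {}" using c(1) by blast
    fix \<C> assume C: "\<C> \<noteq> {}" "subset.chain ?A \<C>"
    then have CA: "\<C> \<subseteq> ?A" by (simp add: subset.chain_def)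
    have "linear (\<Union>\<C>)"
      unfolding linear_def
    proof (intro ballI)
      fix x y assume "x \<in> \<Union>\<C>" "y \<in> \<Union>\<C>"
      then obtain X Y where XY: "X \<in> \<C>" "Y \<in> \<C>" "x \<in> X" "y \<in> Y" by blast
      then have "X \<subseteq> Y \<or> Y \<subseteq> X" using C(2) unfolding subset.chain_def by blast
      then obtain Z where "Z \<in> \<C>" "x \<in> Z" "y \<in> Z" using XY by blast
      then show "x = y \<or> less x y \<or> less y x" using CA unfolding linear_def by blast
    qed
    then show "\<Union>\<C> \<in> ?A" using CA C(1) by blast
  qed
  then obtain C where CA: "C \<in> ?A" and max: "\<forall>X\<in>?A. C \<subseteq> X \<longrightarrow> X = C" by (rule bexE)
  have C: "range c \<subseteq> C" "C \<subseteq> S" "linear C" using CA by simp_all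
  define C1 where "C1 = {x\<in>C. \<exists>i. less x (c i)}"
  define C2 where "C2 = C - C1"
  have cC1: "c i \<in> C1" for i using C(1) c(2) by (auto simp: C1_def)
  have cC2: "less (c i) d" if "d \<in> C2" for i d
  proof -
    have d: "d \<in> C" "c i \<in> C" "d \<notin> C1" using that cC1[of i] by (auto simp: C2_def C1_def)
    then have "\<not> less d (c i)" by (auto simp: C1_def)
    moreover have "d \<noteq> c i" using d(3) cC1[of i] by metis
    moreover have "c i = d \<or> less (c i) d \<or> less d (c i)" using C(3) d(1,2) unfolding linear_def by simp
    ultimately show ?thesis by metis
  qed
  have up: "\<exists>z\<in>C1. (\<forall>x\<in>F. less x z) \<and> (\<forall>d\<in>C2. less z d)" if F: "F \<subseteq> C1" "finite F" for F
  proof -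
    have "\<exists>i. \<forall>x\<in>F. less x (c i)"
      using F(2,1)
    proof (induction F)
      case (insert x F)
      then obtain i j where "\<forall>x\<in>F. less x (c i)" "less x (c j)" by (auto simp: C1_def)
      moreover have "less y (c (Suc (max i j)))" if "less y (c i) \<or> less y (c j)" for y
        using that tr[of y "c i" "c (Suc (max i j))"] tr[of y "c j" "c (Suc (max i j))"]
          cmono[of i "Suc (max i j)"] cmono[of j "Suc (max i j)"] by auto
      ultimately show ?case by (intro exI[of _ "Suc (max i j)"]) auto
    qed simp
    then show ?thesis using cC1 cC2 by blast
  qed
  have down: "\<exists>d\<in>F. \<forall>d'\<in>F. d = d' \<or> less d d'" if F: "F \<subseteq> C2" "finite F" "F \<noteq> {}" for F
    using F(2,3,1)
  proof (induction F rule: finite_ne_induct)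
    case (insert x F)
    then obtain d where d: "d \<in> F" "\<forall>d'\<in>F. d = d' \<or> less d d'" by auto
    have "x \<in> C" "d \<in> C" using insert.prems d(1) by (auto simp: C2_def)
    then have "x = d \<or> less x d \<or> less d x" using C(3) unfolding linear_def by simp
    then consider "x = d" | "less x d" | "less d x" by fast
    then show ?case
    proof cases
      case 2
      then have "\<forall>d'\<in>insert x F. x = d' \<or> less x d'" using d(2) tr[of x d] by auto
      then show ?thesis by blast
    qed (use d in auto)
  qed simp
  have "\<not> ((\<forall>x\<in>C1. less x b) \<and> (\<forall>d\<in>C2. less b d))" if b: "b \<in> S" for b
  proof
    assume cut: "(\<forall>x\<in>C1. less x b) \<and> (\<forall>d\<in>C2. less b d)"
    \<comment> \<open>An element in the cut would be strictly comparable with every member of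
      \<open>C\<close> and could be added to it.\<close>
    have "C1 \<union> C2 = C" by (auto simp: C1_def C2_def)
    then have "\<forall>x\<in>C. less x b \<or> less b x" using cut by blast
    then have "linear (insert b C)" and bC: "b \<notin> C" using C(3) irr unfolding linear_def by auto
    then have "insert b C \<in> ?A" using C(1,2) b by auto
    then have "insert b C = C" using max by auto
    then show False using bC by auto
  qed
  moreover have "C1 \<subseteq> S" "C2 \<subseteq> S" using C(2) by (auto simp: C1_def C2_def)
  ultimately show ?thesis using up down by (intro exI[of _ C1] exI[of _ C2]) simp
qed

context monster_model
begin

text \<open>The partial type places \<open>x\<close> between \<open>C1\<close> and
  \<open>C2\<close>. It is finitely satisfied within \<open>C1\<close> and each of its halves is
  directed, so it extends to a strongly compressible type; isolating both halves would produce an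
  element of \<open>M\<close> in the cut.\<close>

lemma exists_strongly_compressible_not_l_isolated:
  assumes M: "small_model L T U M" "omega_saturated L (substruct U M)"
    and nip: "NIP L U" and unst: "\<not> stable_theory L U" and ctbl: "\<And>n. countable (part_fms L n)"
  shows "\<exists>n. \<exists>p\<in>types L U n M. strongly_compressible L U n M p \<and> \<not> l_isolated L U n M p"
proof -
  have sM: "small U M" and MU: "M \<subseteq> univ U" using small_modelD[OF M(1)] by auto
  obtain m n \<gamma> where \<gamma>: "\<gamma> \<in> fms L (m + n)" and chains: "\<forall>q. \<exists>x :: nat \<Rightarrow> 'u list.
    (\<forall>i<q. x i \<in> tuples (univ U) n) \<and>
    (\<forall>i j. i < j \<and> j < q \<longrightarrow> fibre U m \<gamma> (x i) \<subset> fibre U m \<gamma> (x j))"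
    using unstable_NIP_chains[OF nonempty nip unst] by (elim exE conjE)
  have "\<exists>c. \<forall>i. c i \<in> tuples M n \<and> fibre U m \<gamma> (c i) \<subset> fibre U m \<gamma> (c (Suc i))"
    by (rule infinite_chain_in_model[OF M nonempty \<gamma>]) (rule spec[OF chains])
  then obtain c where c: "\<And>i. c i \<in> tuples M n" "\<And>i. fibre U m \<gamma> (c i) \<subset> fibre U m \<gamma> (c (Suc i))"
    by blast
  define less where "less x y \<longleftrightarrow> fibre U m \<gamma> x \<subset> fibre U m \<gamma> y" for x y
  have tr: "less x z" if "less x y" "less y z" for x y z using that unfolding less_def by blast
  have "\<exists>C1 C2. C1 \<subseteq> tuples M n \<and> C2 \<subseteq> tuples M n \<and>
    (\<forall>F\<subseteq>C1. finite F \<longrightarrow> (\<exists>z\<in>C1. (\<forall>x\<in>F. less x z) \<and> (\<forall>d\<in>C2. less z d))) \<and>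
    (\<forall>F\<subseteq>C2. finite F \<and> F \<noteq> {} \<longrightarrow> (\<exists>d\<in>F. \<forall>d'\<in>F. d = d' \<or> less d d')) \<and>
    (\<forall>b\<in>tuples M n. \<not> ((\<forall>x\<in>C1. less x b) \<and> (\<forall>d\<in>C2. less b d)))"
    by (rule maximal_chain_cut[of less c]) (use c tr in \<open>auto simp: less_def\<close>)
  then obtain C1 C2 where C: "C1 \<subseteq> tuples M n" "C2 \<subseteq> tuples M n"
    "\<forall>F\<subseteq>C1. finite F \<longrightarrow> (\<exists>z\<in>C1. (\<forall>x\<in>F. less x z) \<and> (\<forall>d\<in>C2. less z d))"
    "\<forall>F\<subseteq>C2. finite F \<and> F \<noteq> {} \<longrightarrow> (\<exists>d\<in>F. \<forall>d'\<in>F. d = d' \<or> less d d')"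
    "\<forall>b\<in>tuples M n. \<not> ((\<forall>x\<in>C1. less x b) \<and> (\<forall>d\<in>C2. less b d))" by (elim exE conjE)
  have less_def': "fdef L U (n + n) (\<lambda>v. less (slice v 0 n) (slice v n n))"
    unfolding less_def by (rule fdef_fibre_less[OF \<gamma>])
  obtain \<rho> where \<rho>: "\<rho> \<in> fms L (n + n)"
    "\<forall>v\<in>tuples (univ U) (n + n). holds U \<rho> v \<longleftrightarrow> less (slice v 0 n) (slice v n n)"
    using less_def' unfolding fdef_def by blast
  have \<rho>': "holds U \<rho> (x @ y) \<longleftrightarrow> less x y" if "x \<in> tuples (univ U) n" "y \<in> tuples (univ U) n" for x y
    using \<rho>(2)[rule_format, OF tuples_append[OF that]] that by (simp add: slice_def tuples_def)
  \<comment> \<open>\<sigma> is \<rho> with its arguments exchanged: in both halves of the cut the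
    variables of the type have to come first.\<close>
  have "fdef L U (n + n) (\<lambda>v. holds U \<rho> (slice v n n @ slice v 0 n))"
    using \<rho>(1) by (intro fdef_slices) auto
  then obtain \<sigma> where \<sigma>: "\<sigma> \<in> fms L (n + n)"
    "\<forall>v\<in>tuples (univ U) (n + n). holds U \<sigma> v \<longleftrightarrow> holds U \<rho> (slice v n n @ slice v 0 n)"
    unfolding fdef_def by blast
  have \<sigma>': "holds U \<sigma> (x @ y) \<longleftrightarrow> less y x" if "x \<in> tuples (univ U) n" "y \<in> tuples (univ U) n" for x y
    using \<sigma>(2)[rule_format, OF tuples_append[OF that]] that \<rho>'[OF that(2,1)]
    by (simp add: slice_def tuples_def)
  have inU: "x \<in> tuples (univ U) n" if "x \<in> tuples M n" for x using that tuples_mono[OF MU] by blast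
  have C1U: "x \<in> tuples (univ U) n" if "x \<in> C1" for x using that C(1) inU by blast
  have C2U: "x \<in> tuples (univ U) n" if "x \<in> C2" for x using that C(2) inU by blast
  define \<Phi> where "\<Phi> = (\<lambda>c. (\<sigma>, c)) ` C1 \<union> (\<lambda>c. (\<rho>, c)) ` C2"
  have real\<Phi>: "realises U x \<Theta> \<longleftrightarrow> (\<forall>c\<in>C1. (\<sigma>, c) \<in> \<Theta> \<longrightarrow> less c x) \<and> (\<forall>c\<in>C2. (\<rho>, c) \<in> \<Theta> \<longrightarrow> less x c)"
    if x: "x \<in> tuples (univ U) n" "\<Theta> \<subseteq> \<Phi>" for x \<Theta>
  proof
    assume r: "realises U x \<Theta>"
    show "(\<forall>c\<in>C1. (\<sigma>, c) \<in> \<Theta> \<longrightarrow> less c x) \<and> (\<forall>c\<in>C2. (\<rho>, c) \<in> \<Theta> \<longrightarrow> less x c)"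
      using r \<sigma>'[OF x(1) C1U] \<rho>'[OF x(1) C2U] unfolding realises_def by auto
  next
    assume r: "(\<forall>c\<in>C1. (\<sigma>, c) \<in> \<Theta> \<longrightarrow> less c x) \<and> (\<forall>c\<in>C2. (\<rho>, c) \<in> \<Theta> \<longrightarrow> less x c)"
    show "realises U x \<Theta>"
      unfolding realises_def
    proof
      fix \<theta> assume \<theta>: "\<theta> \<in> \<Theta>"
      then consider c where "c \<in> C1" "\<theta> = (\<sigma>, c)" | c where "c \<in> C2" "\<theta> = (\<rho>, c)"
        using x(2) unfolding \<Phi>_def by blast
      then show "case \<theta> of (\<phi>, a) \<Rightarrow> holds U \<phi> (x @ a)"
        using r \<theta> \<sigma>'[OF x(1) C1U] \<rho>'[OF x(1) C2U] by cases auto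
    qed
  qed
  have \<Phi>_pfms: "\<Phi> \<subseteq> pfms L n M"
    using \<rho>(1) \<sigma>(1) C(1,2) by (auto simp: \<Phi>_def pfms_def tuples_def)
  have "finsat U n \<Phi>"
    unfolding finsat_def
  proof (intro allI impI, elim conjE)
    fix \<Theta> assume fin: "finite \<Theta>" and sub: "\<Theta> \<subseteq> \<Phi>"
    have "C1 \<inter> snd ` \<Theta> \<subseteq> C1" "finite (C1 \<inter> snd ` \<Theta>)" using fin by auto
    then obtain z where z: "z \<in> C1" "\<forall>x\<in>C1 \<inter> snd ` \<Theta>. less x z" "\<forall>d\<in>C2. less z d" using C(3) by meson
    have "less c z" if "c \<in> C1" "(\<sigma>, c) \<in> \<Theta>" for c using z(2) that by force
    then have "realises U z \<Theta>" using real\<Phi>[OF C1U[OF z(1)] sub] z(3) by blast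
    then show "\<exists>b\<in>tuples (univ U) n. realises U b \<Theta>" using C1U z(1) by blast
  qed
  have "compressible_partial n M \<Phi>"
    unfolding \<Phi>_def
  proof (rule compressible_partial_Un[OF MU])
    show "compressible_partial n M ((\<lambda>c. (\<sigma>, c)) ` C1)"
    proof (rule compressible_partial_directed[OF \<sigma>(1) C(1)])
      fix F assume F: "finite F" "F \<subseteq> C1"
      then obtain z where z: "z \<in> C1" "\<forall>x\<in>F. less x z" using C(3) by meson
      have "\<forall>x\<in>tuples (univ U) n. holds U \<sigma> (x @ z) \<longrightarrow> (\<forall>c'\<in>F. holds U \<sigma> (x @ c'))"
      proof (intro ballI impI)
        fix x c' assume x: "x \<in> tuples (univ U) n" "holds U \<sigma> (x @ z)" "c' \<in> F"
        then have "less z x" "less c' z" using \<sigma>'[OF x(1) C1U[OF z(1)]] z(2) by auto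
        then have "less c' x" using tr by blast
        moreover have "c' \<in> tuples (univ U) n" using x(3) F(2) C1U by blast
        ultimately show "holds U \<sigma> (x @ c')" using \<sigma>'[OF x(1)] by simp
      qed
      then show "\<exists>c\<in>C1. \<forall>x\<in>tuples (univ U) n. holds U \<sigma> (x @ c) \<longrightarrow> (\<forall>c'\<in>F. holds U \<sigma> (x @ c'))"
        using z(1) by (rule bexI)
    qed
    show "compressible_partial n M ((\<lambda>c. (\<rho>, c)) ` C2)"
    proof (rule compressible_partial_directed[OF \<rho>(1) C(2)])
      fix F assume F: "finite F" "F \<subseteq> C2" "F \<noteq> {}"
      then obtain d where d: "d \<in> F" "\<forall>d'\<in>F. d = d' \<or> less d d'" using C(4) by meson
      have dC2: "d \<in> C2" using d(1) F(2) by blast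
      have "\<forall>x\<in>tuples (univ U) n. holds U \<rho> (x @ d) \<longrightarrow> (\<forall>c'\<in>F. holds U \<rho> (x @ c'))"
      proof (intro ballI impI)
        fix x c' assume x: "x \<in> tuples (univ U) n" "holds U \<rho> (x @ d)" "c' \<in> F"
        then have "less x d" "d = c' \<or> less d c'" using \<rho>'[OF x(1) C2U[OF dC2]] d(2) by auto
        then have "less x c'" using tr by blast
        moreover have "c' \<in> tuples (univ U) n" using x(3) F(2) C2U by blast
        ultimately show "holds U \<rho> (x @ c')" using \<rho>'[OF x(1)] by simp
      qed
      then show "\<exists>c\<in>C2. \<forall>x\<in>tuples (univ U) n. holds U \<rho> (x @ c) \<longrightarrow> (\<forall>c'\<in>F. holds U \<rho> (x @ c'))"
        using dC2 by (rule bexI)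
    qed
  qed
  moreover have \<Delta>: "{(n, \<sigma>), (n, \<rho>)} \<subseteq> part_fms L n" using \<rho>(1) \<sigma>(1) by (simp add: part_fms_def)
  moreover have "(length a, \<phi>) \<in> {(n, \<sigma>), (n, \<rho>)}" if "(\<phi>, a) \<in> \<Phi>" for \<phi> a
    using that C(1,2) by (auto simp: \<Phi>_def tuples_def)
  ultimately obtain p where p: "p \<in> types L U n M" "\<Phi> \<subseteq> p" "strongly_compressible L U n M p"
    using exists_strongly_compressible[OF sM nip ctbl \<Phi>_pfms \<open>finsat U n \<Phi>\<close>, of "{(n, \<sigma>), (n, \<rho>)}"] by blast
  have "\<not> l_isolated L U n M p"
  proof
    assume "l_isolated L U n M p"
    then obtain \<zeta>1 \<zeta>2 where \<zeta>: "\<zeta>1 \<in> p" "entails U n {\<zeta>1} (restr p {(n, \<sigma>)} M)"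
      "\<zeta>2 \<in> p" "entails U n {\<zeta>2} (restr p {(n, \<rho>)} M)"
      using \<Delta> unfolding l_isolated_def ball_pair by (meson insert_subset)
    have sub: "{\<zeta>1, \<zeta>2} \<subseteq> pfms L n M" using \<zeta>(1,3) p(1) by (auto simp: types_def)
    \<comment> \<open>Both isolating formulas lie in \<open>p\<close>, so they are jointly
      consistent and, being over \<open>M\<close>, have a common solution in
      \<open>M\<close>.\<close>
    have "finite {\<zeta>1, \<zeta>2} \<and> {\<zeta>1, \<zeta>2} \<subseteq> p" using \<zeta>(1,3) by simp
    then obtain b where "b \<in> tuples (univ U) n" "realises U b {\<zeta>1, \<zeta>2}"
      using types_finsat[OF p(1)] unfolding finsat_def by blast
    then obtain e where e: "e \<in> tuples M n" "realises U e {\<zeta>1, \<zeta>2}"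
      using small_model_realises[OF M(1) nonempty _ sub] by blast
    have "realises U e {\<zeta>1}" "realises U e {\<zeta>2}" using realises_mono[OF e(2)] by blast+
    then have r: "realises U e (restr p {(n, \<sigma>)} M)" "realises U e (restr p {(n, \<rho>)} M)"
      using \<zeta>(2,4) inU[OF e(1)] unfolding entails_def by blast+
    have "less c e" if "c \<in> C1" for c
    proof -
      have "(\<sigma>, c) \<in> restr p {(n, \<sigma>)} M"
        using that C(1) p(2) by (auto simp: restr_def \<Phi>_def tuples_def)
      then have "holds U \<sigma> (e @ c)" using r(1) by (auto simp: realises_def)
      then show ?thesis using \<sigma>'[OF inU[OF e(1)] C1U[OF that]] by simp
    qed
    moreover have "less e d" if "d \<in> C2" for d
    proof -
      have "(\<rho>, d) \<in> restr p {(n, \<rho>)} M"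
        using that C(2) p(2) by (auto simp: restr_def \<Phi>_def tuples_def)
      then have "holds U \<rho> (e @ d)" using r(2) by (auto simp: realises_def)
      then show ?thesis using \<rho>'[OF inU[OF e(1)] C2U[OF that]] by simp
    qed
    ultimately show False using C(5) e(1) by blast
  qed
  then show ?thesis using p(1,3) by blast
qed

end

section \<open>Small omega-saturated models\<close>

lemma tuples_lepoll_infinite:
  assumes "infinite B" "A \<lesssim> B" shows "tuples A m \<lesssim> B"
proof (induction m)
  case 0
  have "tuples A 0 = {[]}" by (auto simp: tuples_def)
  moreover have "{[]} \<lesssim> B" by (rule finite_lepoll_infinite[OF assms(1)]) simp
  ultimately show ?case by (simp only:)
next
  case (Suc m)
  have "tuples A (Suc m) = (\<Union>x\<in>A. Cons x ` tuples A m)"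
    by (auto simp: tuples_def length_Suc_conv)
  also have "\<dots> \<lesssim> B"
    by (rule UN_lepoll_infinite[OF assms]) (rule lepoll_trans[OF image_lepoll Suc.IH])
  finally show ?case .
qed

text \<open>Parameters are replaced by their positions in \<open>a\<close>. In a countable language
  one stock of such codes, no larger than the power set of the set of formulas, serves all base
  sets.\<close>

definition indexed_pfms :: "('f, 'r, 'u) pfm set \<Rightarrow> 'u list \<Rightarrow> (('f, 'r) fm \<times> nat list) set" where
  "indexed_pfms p a = {(\<phi>, js). set js \<subseteq> {..<length a} \<and> (\<phi>, map ((!) a) js) \<in> p}"

definition instance_at :: "'u list \<Rightarrow> (('f, 'r) fm \<times> nat list) set \<Rightarrow> ('f, 'r, 'u) pfm set" where
  "instance_at a \<Phi> = (\<lambda>(\<phi>, js). (\<phi>, map ((!) a) js)) ` \<Phi>"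

lemma instance_at_indexed_pfms:
  assumes "\<And>\<phi> c. (\<phi>, c) \<in> p \<Longrightarrow> set c \<subseteq> set a"
  shows "instance_at a (indexed_pfms p a) = p"
proof
  show "instance_at a (indexed_pfms p a) \<subseteq> p" by (auto simp: instance_at_def indexed_pfms_def)
  show "p \<subseteq> instance_at a (indexed_pfms p a)"
  proof
    fix \<theta> assume \<theta>: "\<theta> \<in> p"
    obtain \<phi> c where \<theta>': "\<theta> = (\<phi>, c)" by (cases \<theta>)
    have "\<forall>u\<in>set c. \<exists>i<length a. a ! i = u" using assms \<theta> \<theta>' by (metis in_set_conv_nth subsetD)
    then obtain h where h: "\<forall>u\<in>set c. h u < length a \<and> a ! h u = u" by metis
    then have "map ((!) a) (map h c) = c" by (simp add: map_idI)
    moreover have "set (map h c) \<subseteq> {..<length a}" using h by auto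
    ultimately have "(\<phi>, map h c) \<in> indexed_pfms p a" "\<theta> = (\<phi>, map ((!) a) (map h c))"
      using \<theta> \<theta>' by (simp_all add: indexed_pfms_def)
    then show "\<theta> \<in> instance_at a (indexed_pfms p a)" unfolding instance_at_def by force
  qed
qed

text \<open>Types over finite sets are sets \<open>instance_at a \<Phi>\<close>, so only finitary operations are needed to
  close a set under the realisation of such types.\<close>

definition realisation_closed :: "('f, 'r) lang \<Rightarrow> ('f, 'r, 'u) struct \<Rightarrow> 'u set \<Rightarrow> bool" where
  "realisation_closed L U M \<longleftrightarrow> M \<subseteq> univ U \<and>
     (\<forall>a n \<Phi>. set a \<subseteq> M \<and> fst ` \<Phi> \<subseteq> {\<phi>. wf_fm L \<phi>} \<and>
       (\<exists>b\<in>tuples (univ U) n. realises U b (instance_at a \<Phi>)) \<longrightarrow>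
       (\<exists>b\<in>tuples M n. realises U b (instance_at a \<Phi>)))"

text \<open>Even without any symbols the iterated negations of one equation are available.\<close>

lemma infinite_wf_fm: "infinite {\<phi> :: ('f, 'r) fm. wf_fm L \<phi>}"
proof -
  let ?f = "\<lambda>i. (Neg ^^ i) (Eq (Var 0) (Var 0)) :: ('f, 'r) fm"
  have "wf_fm L (?f i)" for i by (induction i) auto
  moreover have "inj ?f"
  proof (rule injI)
    fix i j assume "?f i = ?f j"
    then show "i = j"
    proof (induction i arbitrary: j)
      case 0 then show ?case by (cases j) auto
    next
      case (Suc i) then show ?case by (cases j) auto
    qed
  qed
  ultimately show ?thesis using range_inj_infinite infinite_super[of "range ?f"] by blast
qed

text \<open>One finitary operation for each code and length keeps the size at most that of the power
  set of the formulas, and after \<omega> rounds every finite tuple is contained in some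
  round.\<close>

lemma exists_realisation_closed:
  fixes U :: "('f, 'r, 'u) struct"
  assumes ctbl: "countable {\<phi> :: ('f, 'r) fm. wf_fm L \<phi>}"
  shows "\<exists>M. realisation_closed L U M \<and> M \<lesssim> Pow {\<phi> :: ('f, 'r) fm. wf_fm L \<phi>}"
proof -
  let ?W = "{\<phi> :: ('f, 'r) fm. wf_fm L \<phi>}"
  let ?I = "{\<Phi> :: (('f, 'r) fm \<times> nat list) set. fst ` \<Phi> \<subseteq> ?W}"
  have infP: "infinite (Pow ?W)" using infinite_wf_fm[of L] by (simp add: finite_Pow_iff)
  have natP: "(UNIV :: nat set) \<lesssim> Pow ?W" using infP infinite_le_lepoll by blast
  \<comment> \<open>Formulas with index lists are no more numerous than formulas, so codes embed
    into \<open>Pow ?W\<close>.\<close>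
  have "countable (?W \<times> (UNIV :: nat list set))" using ctbl by simp
  then have "?W \<times> (UNIV :: nat list set) \<lesssim> (UNIV :: nat set)"
    unfolding lepoll_def countable_def by auto
  also have "(UNIV :: nat set) \<lesssim> ?W" using infinite_wf_fm[of L] infinite_le_lepoll by blast
  finally obtain h :: "('f, 'r) fm \<times> nat list \<Rightarrow> ('f, 'r) fm" where
    h: "inj_on h (?W \<times> UNIV)" "h ` (?W \<times> UNIV) \<subseteq> ?W" unfolding lepoll_def by blast
  have "?I \<subseteq> Pow (?W \<times> UNIV)" by force
  then have "inj_on ((`) h) ?I" using inj_on_image_Pow[OF h(1)] inj_on_subset by blast
  moreover have "(`) h ` ?I \<subseteq> Pow ?W" using h(2) \<open>?I \<subseteq> Pow (?W \<times> UNIV)\<close> by blast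
  ultimately have I: "?I \<lesssim> Pow ?W" unfolding lepoll_def by blast
  \<comment> \<open>The default \<open>[]\<close> contributes no elements when a code is not
    realised.\<close>
  define g where "g a n \<Phi> = (if \<exists>b\<in>tuples (univ U) n. realises U b (instance_at a \<Phi>)
    then SOME b. b \<in> tuples (univ U) n \<and> realises U b (instance_at a \<Phi>) else [])" for a n \<Phi>
  have g: "g a n \<Phi> \<in> tuples (univ U) n \<and> realises U (g a n \<Phi>) (instance_at a \<Phi>)"
    if "\<exists>b\<in>tuples (univ U) n. realises U b (instance_at a \<Phi>)" for a n \<Phi>
  proof -
    have "\<exists>b. b \<in> tuples (univ U) n \<and> realises U b (instance_at a \<Phi>)" using that by blast
    from someI_ex[OF this] show ?thesis using that by (simp add: g_def)
  qed
  have gU: "set (g a n \<Phi>) \<subseteq> univ U" for a n \<Phi>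
    using g[of n a \<Phi>] by (cases "\<exists>b\<in>tuples (univ U) n. realises U b (instance_at a \<Phi>)")
      (auto simp: tuples_def g_def)
  define st where "st X = X \<union> (\<Union>j. \<Union>a\<in>tuples X j. \<Union>n. \<Union>\<Phi>\<in>?I. set (g a n \<Phi>))" for X
  \<comment> \<open>The start is the empty set; the first round realises the codes over the empty
    tuple.\<close>
  define Ms where "Ms i = (st ^^ i) {}" for i :: nat
  have Ms_Suc: "Ms (Suc i) = st (Ms i)" "Ms 0 = {}" for i by (simp_all add: Ms_def)
  have Ms_card: "Ms i \<lesssim> Pow ?W" for i
  proof (induction i)
    case 0 then show ?case by (simp add: Ms_Suc)
  next
    case (Suc i)
    have "set (g a n \<Phi>) \<lesssim> Pow ?W" for a n \<Phi> by (rule finite_lepoll_infinite[OF infP]) simp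
    then have "(\<Union>j. \<Union>a\<in>tuples (Ms i) j. \<Union>n. \<Union>\<Phi>\<in>?I. set (g a n \<Phi>)) \<lesssim> Pow ?W"
      using tuples_lepoll_infinite[OF infP Suc.IH] natP I
      by (intro UN_lepoll_infinite[OF infP]) auto
    then show ?case unfolding Ms_Suc st_def by (rule Un_lepoll_infinite[OF infP Suc.IH])
  qed
  have mono: "Ms i \<subseteq> Ms j" if "i \<le> j" for i j
    using that by (rule lift_Suc_mono_le[rotated]) (auto simp: Ms_Suc(1) st_def)
  define M where "M = (\<Union>i. Ms i)"
  have "M \<lesssim> Pow ?W" unfolding M_def by (rule UN_lepoll_infinite[OF infP natP Ms_card])
  moreover have "realisation_closed L U M"
    unfolding realisation_closed_def
  proof (intro conjI allI impI)
    have "Ms i \<subseteq> univ U" for i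
    proof (induction i)
      case (Suc i)
      then show ?case unfolding Ms_Suc st_def using gU by blast
    qed (simp add: Ms_Suc)
    then show "M \<subseteq> univ U" by (auto simp: M_def)
    fix a n \<Phi> assume as: "set a \<subseteq> M \<and> fst ` \<Phi> \<subseteq> ?W \<and>
      (\<exists>b\<in>tuples (univ U) n. realises U b (instance_at a \<Phi>))"
    have cover: "\<exists>i. set a' \<subseteq> Ms i" if "set a' \<subseteq> M" for a'
      using that
    proof (induction a')
      case (Cons u a')
      then obtain i j where "set a' \<subseteq> Ms i" "u \<in> Ms j" by (auto simp: M_def)
      then show ?case using mono[of i "max i j"] mono[of j "max i j"]
        by (intro exI[of _ "max i j"]) auto
    qed simp
    have "set a \<subseteq> M" using as by (rule conjunct1)
    from cover[OF this] obtain i where "set a \<subseteq> Ms i" by (rule exE)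
    then have "a \<in> tuples (Ms i) (length a)" by (simp add: tuples_def)
    moreover have "\<Phi> \<in> ?I" using as by simp
    ultimately have "set (g a n \<Phi>) \<subseteq> Ms (Suc i)" unfolding Ms_Suc st_def by blast
    then have "set (g a n \<Phi>) \<subseteq> M" unfolding M_def by blast
    moreover have "g a n \<Phi> \<in> tuples (univ U) n \<and> realises U (g a n \<Phi>) (instance_at a \<Phi>)"
      using as by (intro g) (elim conjE)
    ultimately show "\<exists>b\<in>tuples M n. realises U b (instance_at a \<Phi>)"
      by (intro bexI[of _ "g a n \<Phi>"]) (auto simp: tuples_def)
  qed
  ultimately show ?thesis by blast
qed

lemma realisation_closedD:
  assumes "realisation_closed L U M" "wf_fm L \<phi>" "set a \<subseteq> M" "b \<in> tuples (univ U) n"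
    "holds U \<phi> (b @ a)"
  shows "\<exists>b\<in>tuples M n. holds U \<phi> (b @ a)"
proof -
  have inst: "instance_at a {(\<phi>, [0..<length a])} = {(\<phi>, a)}"
    by (simp add: instance_at_def map_nth)
  have real: "realises U x {(\<phi>, a)} \<longleftrightarrow> holds U \<phi> (x @ a)" for x by (simp add: realises_def)
  have "\<exists>b\<in>tuples (univ U) n. realises U b (instance_at a {(\<phi>, [0..<length a])})"
    unfolding inst real using assms(4,5) by blast
  moreover have "fst ` {(\<phi>, [0..<length a])} \<subseteq> {\<phi>. wf_fm L \<phi>}" using assms(2) by simp
  ultimately have "\<exists>b\<in>tuples M n. realises U b (instance_at a {(\<phi>, [0..<length a])})"
    using assms(1,3) unfolding realisation_closed_def by blast
  then show ?thesis unfolding inst real .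
qed

lemma val_substruct: "val (substruct U M) e t = val U e t"
proof (induction t)
  case (Fn f ts)
  then have "map (val (substruct U M) e) ts = map (val U e) ts" by (intro map_cong) auto
  moreover have "fint (substruct U M) = fint U" by (simp add: substruct_def)
  ultimately show ?case by (simp only: val.simps)
qed simp

text \<open>Tarski-Vaught: closure under realisations of single formulas makes \<open>M\<close>
  elementary.\<close>

lemma sat_substruct:
  assumes cl: "realisation_closed L U M" and "wf_fm L \<phi>" "\<And>i. e i \<in> M"
  shows "sat (substruct U M) e \<phi> \<longleftrightarrow> sat U e \<phi>"
  using assms(2,3)
proof (induction \<phi> arbitrary: e)
  case (Eq s t)
  show ?case by (simp only: sat.simps val_substruct)
next
  case (Rel r ts)
  have "map (val (substruct U M) e) ts = map (val U e) ts" by (simp add: val_substruct)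
  moreover have "rint (substruct U M) = rint U" by (simp add: substruct_def)
  ultimately show ?case by (simp only: sat.simps)
next
  case (Ex i \<phi>)
  have MU: "M \<subseteq> univ U" using cl by (simp add: realisation_closed_def)
  have "\<exists>u\<in>M. sat U (e(i := u)) \<phi>" if u: "u \<in> univ U" "sat U (e(i := u)) \<phi>" for u
  proof -
    from finite_fv[of \<phi>] obtain N where N: "\<forall>j\<in>fv \<phi>. j < N"
      unfolding finite_nat_set_iff_bounded by (rule exE)
    \<comment> \<open>The quantified variable becomes variable 0 and the others are shifted, since
      \<open>realisation_closedD\<close> puts the witness before the parameters; \<open>N\<close>
      cuts the assignment down to finitely many of them.\<close>
    let ?\<phi> = "subst_fm \<phi> (\<lambda>j. if j = i then 0 else Suc j)"
    let ?a = "map e [0..<N]"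
    have eq: "holds U ?\<phi> ([v] @ ?a) \<longleftrightarrow> sat U (e(i := v)) \<phi>" for v
      unfolding holds_def sat_subst_fm by (rule sat_cong) (use N in \<open>auto simp: nth_Cons split: nat.split\<close>)
    have "wf_fm L ?\<phi>" "set ?a \<subseteq> M" "[u] \<in> tuples (univ U) 1"
      using Ex.prems u(1) by (auto simp: wf_subst_fm tuples_def)
    from realisation_closedD[OF cl this] eq u(2)
    obtain b where b: "b \<in> tuples M 1" "holds U ?\<phi> (b @ ?a)" by auto
    then obtain v where "b = [v]" "v \<in> M" by (auto simp: tuples_def length_Suc_conv)
    then show ?thesis using b(2) eq[of v] by auto
  qed
  then have "(\<exists>u\<in>univ U. sat U (e(i := u)) \<phi>) \<longleftrightarrow> (\<exists>u\<in>M. sat U (e(i := u)) \<phi>)" using MU by blast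
  moreover have "sat (substruct U M) (e(i := u)) \<phi> \<longleftrightarrow> sat U (e(i := u)) \<phi>" if "u \<in> M" for u
    using Ex.prems that by (intro Ex.IH) auto
  ultimately show ?case by simp
qed simp_all

context monster_model
begin

lemma exists_small_omega_saturated:
  assumes mod: "is_model L T U" and T: "T \<subseteq> fms L 0" and ctbl: "countable {\<phi> :: ('f, 'r) fm. wf_fm L \<phi>}"
    and large: "Pow {\<phi> :: ('f, 'r) fm. wf_fm L \<phi>} \<prec> univ U"
  shows "\<exists>M. small_model L T U M \<and> omega_saturated L (substruct U M)"
proof -
  obtain M where cl: "realisation_closed L U M" and card: "M \<lesssim> Pow {\<phi> :: ('f, 'r) fm. wf_fm L \<phi>}"
    using exists_realisation_closed[OF ctbl] by blast
  have MU: "M \<subseteq> univ U" using cl by (simp add: realisation_closed_def)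
  have small: "small U M" unfolding small_def using MU card large lesspoll_trans1 by blast
  have ne: "M \<noteq> {}"
  proof -
    obtain u where "u \<in> univ U" using nonempty by blast
    then have "[u] \<in> tuples (univ U) 1" "holds U (Eq (Var 0) (Var 0) :: ('f, 'r) fm) ([u] @ [])"
      by (auto simp: tuples_def holds_def)
    then obtain b where "b \<in> tuples M 1"
      using realisation_closedD[OF cl, of "Eq (Var 0) (Var 0)" "[]"] by auto
    then show ?thesis by (auto simp: tuples_def length_Suc_conv)
  qed
  have elem: "holds (substruct U M) \<phi> a \<longleftrightarrow> holds U \<phi> a" if "\<phi> \<in> fms L k" "a \<in> tuples M k" for \<phi> k a
  proof -
    obtain u where u: "u \<in> M" using ne by blast
    \<comment> \<open>\<open>sat_substruct\<close> wants the whole assignment in \<open>M\<close>,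
      so \<open>u\<close> fills the places from \<open>k\<close> on.\<close>
    let ?e = "\<lambda>i. if i < k then a ! i else u"
    have e: "?e i \<in> M" for i using that(2) u by (auto simp: tuples_def)
    have "sat S (\<lambda>i. a ! i) \<phi> \<longleftrightarrow> sat S ?e \<phi>" for S
      using that(1) by (intro sat_cong) (auto simp: fms_def)
    then show ?thesis
      unfolding holds_def using sat_substruct[OF cl _ e] that(1) by (auto simp: fms_def)
  qed
  have "is_structure L (substruct U M)"
    unfolding is_structure_def univ_substruct
  proof (intro conjI allI impI ballI)
    show "M \<noteq> {}" by (rule ne)
    fix f k a assume f: "far L f = Some k" and a: "a \<in> tuples M k"
    \<comment> \<open>Closure under \<open>f\<close>: the formula x = f(a) has a solution in
      \<open>U\<close>, hence one in \<open>M\<close>, and the solution is unique.\<close>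
    let ?ts = "map (\<lambda>i. Var (Suc i)) [0..<k]"
    let ?\<phi> = "Eq (Var 0) (Fn f ?ts) :: ('f, 'r) fm"
    have hold: "holds U ?\<phi> ([v] @ a) \<longleftrightarrow> v = fint U f a" for v
    proof -
      have "map (val U ((!) (v # a))) ?ts = a" using a by (simp add: tuples_def comp_def list_eq_iff_nth_eq)
      then show ?thesis by (simp add: holds_def)
    qed
    have "a \<in> tuples (univ U) k" using a tuples_mono[OF MU] by blast
    then have "fint U f a \<in> univ U" using mod f by (simp add: is_model_def is_structure_def)
    then have tup: "[fint U f a] \<in> tuples (univ U) 1" by (simp add: tuples_def)
    have wf: "wf_fm L ?\<phi>" using f by (simp add: list_all_iff)
    have "set a \<subseteq> M" using a by (simp add: tuples_def)
    from realisation_closedD[OF cl wf this tup] hold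
    obtain b where b: "b \<in> tuples M 1" "holds U ?\<phi> (b @ a)" by blast
    then obtain v where "b = [v]" "v \<in> M" by (auto simp: tuples_def length_Suc_conv)
    then have "fint U f a \<in> M" using b(2) hold by metis
    then show "fint (substruct U M) f a \<in> M" by (simp add: substruct_def)
  qed
  moreover have "\<forall>\<phi>\<in>T. holds (substruct U M) \<phi> []"
    using mod T elem[of _ 0 "[]"] by (auto simp: is_model_def tuples_def)
  ultimately have sm: "small_model L T U M"
    unfolding small_model_def is_model_def using small elem by blast
  have "omega_saturated L (substruct U M)"
    unfolding omega_saturated_def saturated_card_def univ_substruct
  proof (intro allI impI ballI)
    fix A n p assume A: "A \<subseteq> M" "A \<prec> (UNIV :: nat set)" and p: "p \<in> types L (substruct U M) n A"
    have "finite A"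
    proof (rule ccontr)
      assume "infinite A"
      then have "(UNIV :: nat set) \<lesssim> A" using infinite_le_lepoll by blast
      then show False using A(2) lesspoll_trans1 by blast
    qed
    \<comment> \<open>The finite set \<open>A\<close> is listed as a tuple, and \<open>p\<close> is
      the instance of its code at this tuple.\<close>
    then obtain a where a: "set a = A" using finite_list by blast
    have pA: "p \<subseteq> pfms L n A" using p by (simp add: types_def)
    then have pM: "p \<subseteq> pfms L n M" using pfms_mono[OF A(1)] by blast
    have "finsat U n p"
      unfolding finsat_def
    proof (intro allI impI, elim conjE)
      fix \<Theta> assume "finite \<Theta>" and sub: "\<Theta> \<subseteq> p"
      then obtain b where b: "b \<in> tuples M n" "realises (substruct U M) b \<Theta>"
        using types_finsat[OF p] unfolding finsat_def univ_substruct by blast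
      have "\<Theta> \<subseteq> pfms L n M" using sub pM by blast
      then have "realises U b \<Theta>" using realises_substruct[OF sm _ b(1)] b(2) by blast
      then show "\<exists>b\<in>tuples (univ U) n. realises U b \<Theta>" using b(1) tuples_mono[OF MU] by blast
    qed
    moreover have "A \<subseteq> univ U" using A(1) MU by blast
    moreover have "A \<prec> univ U" using countable_lesspoll_univ countable_finite[OF \<open>finite A\<close>] by blast
    ultimately obtain b where b: "b \<in> tuples (univ U) n" "realises U b p"
      using saturated_realises[OF saturated[unfolded saturated_def] _ _ pA] by metis
    have inst: "instance_at a (indexed_pfms p a) = p"
      using pA a by (intro instance_at_indexed_pfms) (auto simp: pfms_def)
    have "fst ` indexed_pfms p a \<subseteq> {\<phi>. wf_fm L \<phi>}"
      using pA by (auto simp: indexed_pfms_def pfms_def fms_def)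
    moreover have "\<exists>b\<in>tuples (univ U) n. realises U b (instance_at a (indexed_pfms p a))"
      unfolding inst using b by blast
    moreover have "set a \<subseteq> M" using a A(1) by simp
    ultimately have "\<exists>b\<in>tuples M n. realises U b (instance_at a (indexed_pfms p a))"
      using cl unfolding realisation_closed_def by blast
    then obtain b' where "b' \<in> tuples M n" "realises U b' p" unfolding inst by blast
    then show "\<exists>b\<in>tuples M n. realises (substruct U M) b p"
      using realises_substruct[OF sm pM] by blast
  qed
  then show ?thesis using sm by blast
qed

text \<open>\<zeta>(x,c) follows from a part of \<open>p\<close>, so it holds at a realisation of
  \<open>p\<close> and belongs to \<open>p\<close>; the formulas of \<Delta> other than \<phi> are
  then forgotten.\<close>

lemma strongly_compressible_imp_compressible:
  assumes A: "small U A" and p: "p \<in> types L U n A" and "strongly_compressible L U n A p"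
  shows "compressible L U n A p"
  unfolding compressible_def ball_pair bex_pair
proof (intro allI impI)
  fix m \<phi> assume m\<phi>: "(m, \<phi>) \<in> part_fms L n"
  obtain b where b: "b \<in> tuples (univ U) n" "p = tp L U A b"
    by (rule small_type_realised[OF saturated A p])
  have bp: "realises U b p" using b(2) by (auto simp: realises_def tp_def)
  obtain \<Delta> k \<zeta> where \<Delta>: "(m, \<phi>) \<in> \<Delta>" "(k, \<zeta>) \<in> part_fms L n" "\<forall>A\<^sub>0\<subseteq>A. finite A\<^sub>0 \<longrightarrow>
         (\<exists>c\<in>tuples A k. entails U n (restr p \<Delta> A) {(\<zeta>, c)} \<and>
                          entails U n {(\<zeta>, c)} (restr p \<Delta> A\<^sub>0))"
    using assms(3)[unfolded strongly_compressible_def ball_pair bex_pair, rule_format, OF m\<phi>]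
    by (elim exE conjE) (rule that)
  have "\<exists>c\<in>tuples A k. (\<zeta>, c) \<in> p \<and> entails U n {(\<zeta>, c)} (restr p {(m, \<phi>)} A0)"
    if A0: "A0 \<subseteq> A" "finite A0" for A0
  proof -
    obtain c where c: "c \<in> tuples A k" "entails U n (restr p \<Delta> A) {(\<zeta>, c)}"
      "entails U n {(\<zeta>, c)} (restr p \<Delta> A0)" using \<Delta>(3) A0 by blast
    have "restr p \<Delta> A \<subseteq> p" unfolding restr_def by blast
    then have "realises U b (restr p \<Delta> A)" by (rule realises_mono[OF bp])
    then have "holds U \<zeta> (b @ c)" using c(2) b(1) unfolding entails_def by (simp add: realises_insert)
    moreover have "(\<zeta>, c) \<in> pfms L (length b) A"
      using c(1) \<Delta>(2) b(1) by (auto simp: pfms_def part_fms_def tuples_def)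
    ultimately have "(\<zeta>, c) \<in> p" using b(2) by (simp add: tp_def)
    moreover have "restr p {(m, \<phi>)} A0 \<subseteq> restr p \<Delta> A0" using \<Delta>(1) unfolding restr_def by blast
    then have "entails U n {(\<zeta>, c)} (restr p {(m, \<phi>)} A0)"
      using c(3) realises_mono unfolding entails_def by blast
    ultimately show ?thesis using c(1) by blast
  qed
  then show "\<exists>k \<psi>. (k, \<psi>) \<in> part_fms L n \<and> (\<forall>A\<^sub>0\<subseteq>A. finite A\<^sub>0 \<longrightarrow>
      (\<exists>c\<in>tuples A k. (\<psi>, c) \<in> p \<and> entails U n {(\<psi>, c)} (restr p {(m, \<phi>)} A\<^sub>0)))"
    using \<Delta>(2) by (intro exI[of _ k] exI[of _ \<zeta>]) simp
qed

end

section \<open>Countability of the language, and the final assembly\<close>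

fun closure_fm :: "nat \<Rightarrow> ('f, 'r) fm \<Rightarrow> ('f, 'r) fm" where
  "closure_fm 0 \<phi> = \<phi>"
| "closure_fm (Suc k) \<phi> = closure_fm k (Ex k \<phi>)"

lemma closure_fm_fms: "\<phi> \<in> fms L k \<Longrightarrow> closure_fm k \<phi> \<in> fms L 0"
proof (induction k arbitrary: \<phi>)
  case (Suc k)
  then have "Ex k \<phi> \<in> fms L k" by (auto simp: fms_def less_Suc_eq)
  then show ?case using Suc.IH by simp
qed simp

lemma inj_closure_fm: "closure_fm k \<phi> = closure_fm k \<psi> \<Longrightarrow> \<phi> = \<psi>"
  by (induction k arbitrary: \<phi> \<psi>) fastforce+

text \<open>A complete theory contains each sentence or its negation, so there are countably many
  sentences. Prefixing existential quantifiers maps the formulas in \<open>k\<close> variables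
  injectively to sentences.\<close>

lemma countable_wf_fm:
  assumes "complete_theory L T" "countable T"
  shows "countable {\<phi>. wf_fm L \<phi>}"
proof -
  have c0: "countable (fms L 0)"
  proof (rule countable_subset)
    show "fms L 0 \<subseteq> T \<union> Neg -` T" using assms(1) by (auto simp: complete_theory_def)
    have "countable (Neg -` T)"
      by (rule countable_image_inj_on[of Neg]) (auto simp: inj_on_def intro: countable_subset[OF _ assms(2)])
    then show "countable (T \<union> Neg -` T)" using assms(2) by simp
  qed
  have "countable (fms L k)" for k
  proof (rule countable_image_inj_on)
    show "countable (closure_fm k ` fms L k)"
      by (rule countable_subset[OF _ c0]) (auto intro: closure_fm_fms)
    show "inj_on (closure_fm k) (fms L k)" by (rule inj_onI) (rule inj_closure_fm)
  qed
  then have "countable (\<Union>k. fms L k)" by simp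
  moreover have "{\<phi>. wf_fm L \<phi>} \<subseteq> (\<Union>k. fms L k)"
  proof
    fix \<phi> assume "\<phi> \<in> {\<phi>. wf_fm L \<phi>}"
    moreover from finite_fv[of \<phi>] obtain k where "\<forall>j\<in>fv \<phi>. j < k"
      unfolding finite_nat_set_iff_bounded by (rule exE)
    ultimately show "\<phi> \<in> (\<Union>k. fms L k)" by (auto simp: fms_def)
  qed
  ultimately show ?thesis by (rule countable_subset[rotated])
qed

text \<open>A countable \<open>U\<close> would close a cycle of cardinal inequalities: the power set
  of the formulas is strictly below \<open>U\<close>, \<open>U\<close> is at most countable, and the
  infinite set of formulas is strictly below its power set.\<close>

lemma monster_imp_monster_model:
  assumes "monster L T U" shows "monster_model L U"
proof
  show "univ U \<noteq> {}" "saturated L U" using assms by (auto simp: monster_def is_model_def is_structure_def)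
  show "uncountable (univ U)"
  proof
    assume c: "countable (univ U)"
    let ?W = "{\<phi> :: ('a, 'b) fm. wf_fm L \<phi>}"
    have "Pow ?W \<prec> univ U" using assms by (simp add: monster_def)
    also have "univ U \<lesssim> (UNIV :: nat set)" using c unfolding lepoll_def countable_def by auto
    also have "(UNIV :: nat set) \<lesssim> ?W" using infinite_wf_fm[of L] infinite_le_lepoll by blast
    also have "?W \<prec> Pow ?W" by (rule lesspoll_Pow_self)
    finally show False by simp
  qed
qed

lemma order_in_mono:
  assumes "order_in L U A m k \<theta>" "A \<subseteq> B" shows "order_in L U B m k \<theta>"
proof -
  obtain a b :: "nat \<Rightarrow> _ list" where ab: "(\<forall>i. a i \<in> tuples A m \<and> b i \<in> tuples A k) \<and>
      (\<forall>i j. holds U \<theta> (a i @ b j) \<longleftrightarrow> i < j)"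
    using assms(1) unfolding order_in_def by (elim exE)
  then have "\<forall>i. a i \<in> tuples B m \<and> b i \<in> tuples B k"
    by (auto dest: subsetD[OF tuples_mono[OF assms(2)]])
  with ab show ?thesis unfolding order_in_def by (intro exI[of _ a] exI[of _ b]) simp
qed

theorem lemma4p8:
  fixes L :: "('f, 'r) lang"
    and T :: "('f, 'r) fm set"
    and U :: "('f, 'r, 'u) struct"
  assumes "complete_theory L T"
    and "monster L T U"
  shows "(\<forall>A n p. small U A \<and> p \<in> types L U n A \<and> compressible L U n A p \<and> \<not> l_isolated L U n A p \<longrightarrow>
            (\<exists>m k. \<exists>\<theta>\<in>fms L (m + k). order_in L U A m k \<theta>) \<and>
            \<not> stable_type L U n A p) \<and>
         (stable_theory L U \<longrightarrow> all_compressible_l_isolated L U) \<and>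
         (countable T \<and> NIP L U \<longrightarrow>
            (stable_theory L U \<longleftrightarrow> all_compressible_l_isolated L U) \<and>
            (all_compressible_l_isolated L U \<longleftrightarrow>
              (\<exists>M. small_model L T U M \<and> omega_saturated L (substruct U M) \<and>
                (\<forall>n. \<forall>p\<in>types L U n M. strongly_compressible L U n M p \<longrightarrow> l_isolated L U n M p))))"
proof -
  interpret monster_model L U by (rule monster_imp_monster_model[OF assms(2)])
  have part1: "(\<exists>m k. \<exists>\<theta>\<in>fms L (m + k). order_in L U A m k \<theta>) \<and> \<not> stable_type L U n A p"
    if "small U A" "p \<in> types L U n A" "compressible L U n A p" "\<not> l_isolated L U n A p" for A n p
    using compressible_not_l_isolated[OF that] by blast
  have stable_imp: "all_compressible_l_isolated L U" if st: "stable_theory L U"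
    unfolding all_compressible_l_isolated_def
  proof (intro allI impI ballI)
    fix A n p assume A: "small U A" "p \<in> types L U n A" "compressible L U n A p"
    show "l_isolated L U n A p"
    proof (rule ccontr)
      assume "\<not> l_isolated L U n A p"
      then obtain m k \<theta> where \<theta>: "\<theta> \<in> fms L (m + k)" "order_in L U A m k \<theta>"
        using part1[OF A] by blast
      have "A \<subseteq> univ U" using A(1) by (simp add: small_def)
      then have "order_in L U (univ U) m k \<theta>" by (rule order_in_mono[OF \<theta>(2)])
      then show False using st \<theta>(1) unfolding stable_theory_def by blast
    qed
  qed
  let ?E = "\<exists>M. small_model L T U M \<and> omega_saturated L (substruct U M) \<and>
      (\<forall>n. \<forall>p\<in>types L U n M. strongly_compressible L U n M p \<longrightarrow> l_isolated L U n M p)"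
  have part2: "(stable_theory L U \<longleftrightarrow> all_compressible_l_isolated L U) \<and>
      (all_compressible_l_isolated L U \<longleftrightarrow> ?E)" if T: "countable T" and nip: "NIP L U"
  proof -
    have ctbl: "countable {\<phi>. wf_fm L \<phi>}" by (rule countable_wf_fm[OF assms(1) T])
    have "?E" if all: "all_compressible_l_isolated L U"
    proof -
      have "is_model L T U" "Pow {\<phi>. wf_fm L \<phi>} \<prec> univ U" "T \<subseteq> fms L 0"
        using assms by (auto simp: monster_def complete_theory_def)
      then obtain M where M: "small_model L T U M" "omega_saturated L (substruct U M)"
        using exists_small_omega_saturated[OF _ _ ctbl] by blast
      have sM: "small U M" by (rule small_modelD(1)[OF M(1)])
      have "l_isolated L U n M p" if "p \<in> types L U n M" "strongly_compressible L U n M p" for n p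
        using all sM that strongly_compressible_imp_compressible[OF sM that]
        unfolding all_compressible_l_isolated_def by blast
      then show ?thesis using M by blast
    qed
    moreover have "stable_theory L U" if ex: ?E
    proof (rule ccontr)
      assume unst: "\<not> stable_theory L U"
      obtain M where M: "small_model L T U M" "omega_saturated L (substruct U M)"
        "\<forall>n. \<forall>p\<in>types L U n M. strongly_compressible L U n M p \<longrightarrow> l_isolated L U n M p"
        using ex by blast
      have "countable (part_fms L n)" for n
      proof (rule countable_subset)
        show "part_fms L n \<subseteq> UNIV \<times> {\<phi>. wf_fm L \<phi>}" by (auto simp: part_fms_def fms_def)
        show "countable ((UNIV :: nat set) \<times> {\<phi>. wf_fm L \<phi>})" using ctbl by simp
      qed
      then show False
        using exists_strongly_compressible_not_l_isolated[OF M(1,2) nip unst] M(3) by blast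
    qed
    \<comment> \<open>This closes the cycle from stability through l-isolation of compressible types
      and the omega-saturated model back to stability.\<close>
    ultimately show ?thesis using stable_imp by blast
  qed
  show ?thesis
    by (rule conjI, intro allI impI, elim conjE, rule part1, assumption+, rule conjI, rule impI,
        rule stable_imp, assumption, rule impI, elim conjE, rule part2, assumption+)
qed

end
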